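(* Let $k$ be an algebraically closed field of characteristic $2$ and let $m>n\geq 2$ both be even. Then the $m$-linear $O(n)$-invariant $g=g_{n\times m}$ is an indecomposable element of $R_{n\times m}^{O(n)}$.
   Context: Write $n=2\nu$ and $m=2\mu$. **Groups.** Coordinates on $k^n$ are $x_1,y_1,\dots,x_\nu,y_\nu$, and $q=x_1y_1+\dots+x_\nu y_\nu$. $O(n)=O(n,k)$ is the group of linear automorphisms of $k^n$ preserving $q$. **Invariants.** $R=R_{n\times m}$ is the $k$-algebra of polynomials in the coordinates $x_r^{(i)},y_r^{(i)}$ of indeterminate $n$-dimensional vectors $v^{(1)},\dots,v^{(m)}$; for a group $G$ acting on $k^n$, $R^G$ is the subalgebra of polynomials invariant under the simultaneous action of $G$ on $m$-tuples of vectors. A polynomial is $m$-linear if it is multilinear in $v^{(1)},\dots,v^{(m)}$. An element of $R^G$ is indecomposable if it is not contained in the subalgebra of $R^G$ generated by the elements of $R^G$ of lower degree (i.e. of total degree strictly less than that of the given element). **The polynomial $g$.** Over $\mathbb Z$, let $B^{(ij)}=\sum_{r=1}^\nu(x_r^{(i)}y_r^{(j)}+y_r^{(i)}x_r^{(j)})$ for $1\le i,j\le m$, and let $\mathrm{Pf}^{(1,\dots,2\mu)}$ be the Pfaffian of the $2\mu\times2\mu$ skew-symmetric matrix whose $(i,j)$ entry for $i<j$ is $B^{(ij)}$. Put $\tilde g=2^{-(\mu-\nu)}\,\mathrm{Pf}^{(1,\dots,2\mu)}$; it has integer coefficients, and $g=g_{n\times m}\in R$ is its reduction modulo 2 (coefficients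 in the prime field $\mathbb F_2\subset k$). The polynomial $g$ is $O(n)$-invariant. *)

theory Defs
  imports
    "HOL-Library.Poly_Mapping"
    "HOL-Combinatorics.Permutations"
    "HOL-Computational_Algebra.Polynomial"
    "Jordan_Normal_Form.Matrix"
begin

text \<open>
  Multivariate polynomials are finitely supported functions from exponent vectors to coefficients;
  the library's \<^typ>\<open>_ \<Rightarrow>\<^sub>0 _\<close> carries the convolution product.
  All indices are 0-based. The variable \<open>(i, c)\<close> is the \<open>c\<close>-th coordinate of the \<open>i\<close>-th vector,
  the coordinates of \<open>k\<^sup>n\<close> being ordered as \<open>x\<^sub>1, y\<^sub>1, x\<^sub>2, y\<^sub>2, \<dots>\<close>; so the even coordinate
  \<open>2 * r\<close> is an \<open>x\<close> and the odd coordinate \<open>2 * r + 1\<close> is the matching \<open>y\<close>.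
\<close>

type_synonym 'a mpoly = "((nat \<times> nat) \<Rightarrow>\<^sub>0 nat) \<Rightarrow>\<^sub>0 'a"

definition Const :: "'a \<Rightarrow> 'a::comm_semiring_1 mpoly" where
  "Const a = Poly_Mapping.single 0 a"

definition Var :: "nat \<times> nat \<Rightarrow> 'a::comm_semiring_1 mpoly" where
  "Var v = Poly_Mapping.single (Poly_Mapping.single v 1) 1"

definition poly_ring :: "nat \<Rightarrow> nat \<Rightarrow> 'a::comm_semiring_1 mpoly set" where
  "poly_ring n m =
     {p. \<forall>t \<in> Poly_Mapping.keys p. Poly_Mapping.keys t \<subseteq> {..<m} \<times> {..<n}}"

definition total_degree :: "'a::zero mpoly \<Rightarrow> nat" where
  "total_degree p =
     Max (insert 0 ((\<lambda>t. \<Sum>v \<in> Poly_Mapping.keys t. Poly_Mapping.lookup t v)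
                      ` Poly_Mapping.keys p))"

definition multilinear :: "nat \<Rightarrow> nat \<Rightarrow> 'a::comm_semiring_1 mpoly \<Rightarrow> bool" where
  "multilinear n m p \<longleftrightarrow> p \<in> poly_ring n m \<and>
     (\<forall>t \<in> Poly_Mapping.keys p. \<forall>i<m. (\<Sum>c<n. Poly_Mapping.lookup t (i, c)) = 1)"

definition subst_mpoly ::
    "(nat \<times> nat \<Rightarrow> 'a::comm_semiring_1 mpoly) \<Rightarrow> 'a mpoly \<Rightarrow> 'a mpoly" where
  "subst_mpoly \<sigma> p =
     (\<Sum>t \<in> Poly_Mapping.keys p.
        Const (Poly_Mapping.lookup p t) *
        (\<Prod>v \<in> Poly_Mapping.keys t. \<sigma> v ^ Poly_Mapping.lookup t v))"

text \<open>The polynomial \<open>p (A v\<^sup>1, \<dots>, A v\<^sup>m)\<close>:\<close>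

definition act :: "nat \<Rightarrow> 'a::comm_semiring_1 mat \<Rightarrow> 'a mpoly \<Rightarrow> 'a mpoly" where
  "act n A = subst_mpoly (\<lambda>(i, c). \<Sum>d<n. Const (A $$ (c, d)) * Var (i, d))"

definition quad_form :: "nat \<Rightarrow> 'a::comm_semiring_1 vec \<Rightarrow> 'a" where
  "quad_form n v = (\<Sum>r < n div 2. v $ (2 * r) * v $ (2 * r + 1))"

definition orthogonal_group :: "nat \<Rightarrow> 'a::field mat set" where
  "orthogonal_group n =
     {A \<in> carrier_mat n n. invertible_mat A \<and>
        (\<forall>v \<in> carrier_vec n. quad_form n (A *\<^sub>v v) = quad_form n v)}"

definition invariants :: "nat \<Rightarrow> nat \<Rightarrow> 'a::field mat set \<Rightarrow> 'a mpoly set" where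
  "invariants n m G = {p \<in> poly_ring n m. \<forall>A \<in> G. act n A p = p}"

inductive_set subalgebra_generated :: "'a::comm_semiring_1 mpoly set \<Rightarrow> 'a mpoly set"
  for S :: "'a mpoly set" where
  const: "Const a \<in> subalgebra_generated S"
| gen: "p \<in> S \<Longrightarrow> p \<in> subalgebra_generated S"
| add: "p \<in> subalgebra_generated S \<Longrightarrow> q \<in> subalgebra_generated S \<Longrightarrow>
    p + q \<in> subalgebra_generated S"
| mult: "p \<in> subalgebra_generated S \<Longrightarrow> q \<in> subalgebra_generated S \<Longrightarrow>
    p * q \<in> subalgebra_generated S"

definition indecomposable_in :: "'a::comm_semiring_1 mpoly set \<Rightarrow> 'a mpoly \<Rightarrow> bool" where
  "indecomposable_in S p \<longleftrightarrow> p \<in> S \<and>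
     p \<notin> subalgebra_generated {h \<in> S. total_degree h < total_degree p}"

text \<open>
  The permutations summed over are the normal forms
  \<open>(i\<^sub>1, j\<^sub>1, \<dots>, i\<^sub>\<mu>, j\<^sub>\<mu>)\<close> of the perfect matchings of the index set:
  \<open>i\<^sub>s < j\<^sub>s\<close> for all \<open>s\<close>, and \<open>i\<^sub>1 < \<dots> < i\<^sub>\<mu>\<close>.
\<close>

definition pfaffian :: "'a::comm_ring_1 mat \<Rightarrow> 'a" where
  "pfaffian A =
     (let \<mu> = dim_row A div 2 in
      \<Sum>p \<in> {p. p permutes {..<2 * \<mu>} \<and>
               (\<forall>s<\<mu>. p (2 * s) < p (2 * s + 1)) \<and>
               (\<forall>s<\<mu>. \<forall>t<\<mu>. s < t \<longrightarrow> p (2 * s) < p (2 * t))}.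
        of_int (sign p) * (\<Prod>s<\<mu>. A $$ (p (2 * s), p (2 * s + 1))))"

definition B_poly :: "nat \<Rightarrow> nat \<Rightarrow> nat \<Rightarrow> int mpoly" where
  "B_poly n i j =
     (\<Sum>r < n div 2. Var (i, 2 * r) * Var (j, 2 * r + 1) + Var (i, 2 * r + 1) * Var (j, 2 * r))"

definition B_mat :: "nat \<Rightarrow> nat \<Rightarrow> int mpoly mat" where
  "B_mat n m =
     mat m m (\<lambda>(i, j). if i < j then B_poly n i j else if j < i then - B_poly n j i else 0)"

text \<open>
  The coefficientwise division is exact: up to sign, a nonzero coefficient of the Pfaffian is a
  product of at most \<open>\<nu> = n div 2\<close> determinants of \<open>\<plusminus>1\<close>-matrices (one for each \<open>r\<close> whose
  variables \<open>x\<^sub>r, y\<^sub>r\<close> occur in the monomial) with sizes adding up to \<open>\<mu> = m div 2\<close>, and such a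
  determinant of size \<open>a\<close> is divisible by \<open>2 ^ (a - 1)\<close>.
\<close>

definition g_tilde :: "nat \<Rightarrow> nat \<Rightarrow> int mpoly" where
  "g_tilde n m = Poly_Mapping.map (\<lambda>c. c div 2 ^ (m div 2 - n div 2)) (pfaffian (B_mat n m))"

text \<open>In characteristic 2, \<^const>\<open>of_int\<close> is reduction modulo 2 followed by the inclusion of
  the prime field.\<close>

definition g_poly :: "nat \<Rightarrow> nat \<Rightarrow> 'a::comm_ring_1 mpoly" where
  "g_poly n m = Poly_Mapping.map of_int (g_tilde n m)"

end

theory Submission
  imports Defs
begin

text \<open>
  Write \<open>n = 2\<nu>\<close>, \<open>m = 2\<mu>\<close>. The proof has three parts: a formula for \<open>g\<close> in characteristic 2 that does not
  mention the division by \<open>2 ^ (\<mu> - \<nu>)\<close>, the invariance of \<open>g\<close> read off from that formula, and a linear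
  functional that kills all decomposable invariants but takes the value 1 at \<open>g\<close>.

  The formula. Let \<open>N\<close> be the bilinear form \<open>N(u, v) = \<Sum>\<^sub>r y\<^sub>r(u) x\<^sub>r(v)\<close>, so that \<open>N(v, v) = q(v)\<close>, and let
  \<open>M(u, v) = N(v, u) - N(u, v)\<close>, the standard alternating form. For \<open>i < j\<close> the entry of the Pfaffian is
  \<open>B\<^sub>i\<^sub>j = M\<^sub>i\<^sub>j + 2 N\<^sub>i\<^sub>j\<close>. Expanding every product over a perfect matching writes \<open>Pf B\<close> as a sum over matchings
  whose edges are coloured by \<open>M\<close> or \<open>2 N\<close>. An alternating form in \<open>n\<close> coordinates has vanishing Pfaffian on
  more than \<open>n\<close> vectors, and the same argument shows that the terms with a given number \<open>k > \<nu>\<close> of edges of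
  colour \<open>M\<close> add up to 0 (\<open>sum_nf_low_rank\<close>). Hence \<open>2 ^ (\<mu> - \<nu>)\<close> divides \<open>Pf B\<close>, and modulo 2 the quotient is
  the sum of the terms with exactly \<open>\<nu>\<close> edges of colour \<open>M\<close> (\<open>g_poly_eq_pf_level\<close>).

  Invariance. An element of \<open>O(n)\<close> preserves \<open>M\<close> in characteristic 2, and it replaces \<open>N\<close> by another bilinear
  form with the same values on the diagonal, that is, by \<open>N + \<delta>\<close> with \<open>\<delta>\<close> alternating in \<open>n\<close> coordinates. The
  terms in which \<open>\<delta>\<close> occurs have more than \<open>\<nu>\<close> edges coloured by the forms \<open>M\<close> and \<open>\<delta>\<close> of low rank, so they
  cancel as well (\<open>pf_level_perturb\<close>, \<open>act_g_poly\<close>).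

  Indecomposability. Let \<open>e\<^sub>r, f\<^sub>r\<close> be the standard hyperbolic pairs and \<open>w\<^sub>r = e\<^sub>r + f\<^sub>r\<close>. Send a polynomial \<open>p\<close>
  to the value \<open>\<lambda>(p)\<close> of its multilinear part at the point
  \<open>(e\<^sub>1, w\<^sub>1, e\<^sub>2, w\<^sub>2, \<dots>, e\<^sub>\<nu>, w\<^sub>\<nu>, w\<^sub>\<nu>, \<dots>, w\<^sub>\<nu>)\<close>. Then \<open>\<lambda>(p q)\<close> is the sum, over the ways to split the set of
  vectors into \<open>J\<close> and \<open>K\<close>, of the product of the values of the part of \<open>p\<close> that is multilinear in \<open>J\<close> and the part
  of \<open>q\<close> that is multilinear in \<open>K\<close>. If \<open>J\<close> and \<open>K\<close> both meet the block of vectors lying in one hyperbolic plane,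
  one of the two parts sees only the vector \<open>w\<^sub>r\<close> of that plane; expanding one \<open>w\<^sub>r\<close> as \<open>e\<^sub>r + f\<^sub>r\<close> gives two
  values that are exchanged by the reflection in \<open>w\<^sub>r\<close>, so the part vanishes
  (\<open>special_vanish_partial_block\<close>). Otherwise the part that contains the large last block
  \<open>e\<^sub>\<nu>, w\<^sub>\<nu>, w\<^sub>\<nu>, \<dots>\<close>, which has at least four vectors because \<open>m > n\<close>, misses a whole plane. This free plane
  supplies enough further reflections to make the part vanish (\<open>eq_0_of_large_block\<close>). So \<open>\<lambda>\<close> vanishes on products
  as soon as it vanishes on the factors, and it vanishes on invariants of degree less than \<open>m\<close>. On the other
  hand \<open>\<lambda>(g) = 1\<close>: up to the factor \<open>2 ^ (\<mu> - \<nu>)\<close>, the value of \<open>Pf B\<close> at the special point is a signed count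
  of the matchings that pair vectors of the same block, and their number is odd (\<open>g_poly_special\<close>).
\<close>

section \<open>Evaluation homomorphisms\<close>

text \<open>
  Substitution, evaluation at a point of \<open>k\<close>, and specialisation of integral identities to other rings
  are all of this form.
\<close>

definition eval_mpoly ::
    "('a::comm_ring_1 \<Rightarrow> 'b::comm_ring_1) \<Rightarrow> ('v \<Rightarrow> 'b) \<Rightarrow> (('v \<Rightarrow>\<^sub>0 nat) \<Rightarrow>\<^sub>0 'a) \<Rightarrow> 'b" where
  "eval_mpoly \<phi> f p =
     (\<Sum>t\<in>Poly_Mapping.keys p. \<phi> (Poly_Mapping.lookup p t) *
        (\<Prod>v\<in>Poly_Mapping.keys t. f v ^ Poly_Mapping.lookup t v))"

lemma subst_mpoly_eq_eval: "subst_mpoly \<sigma> = eval_mpoly Const \<sigma>"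
  by (rule ext) (simp add: subst_mpoly_def eval_mpoly_def)

lemma monomial_eval_superset:
  fixes f :: "'v \<Rightarrow> 'b::comm_monoid_mult"
  assumes "finite A" "Poly_Mapping.keys t \<subseteq> A"
  shows "(\<Prod>v\<in>Poly_Mapping.keys t. f v ^ Poly_Mapping.lookup t v) =
         (\<Prod>v\<in>A. f v ^ Poly_Mapping.lookup t v)"
  using assms by (intro prod.mono_neutral_left) (auto simp: in_keys_iff)

lemma monomial_eval_add:
  fixes f :: "'v \<Rightarrow> 'b::comm_monoid_mult"
  shows "(\<Prod>v\<in>Poly_Mapping.keys (s + t). f v ^ Poly_Mapping.lookup (s + t) v) =
         (\<Prod>v\<in>Poly_Mapping.keys s. f v ^ Poly_Mapping.lookup s v) *
         (\<Prod>v\<in>Poly_Mapping.keys t. f v ^ Poly_Mapping.lookup t v)"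
proof -
  let ?A = "Poly_Mapping.keys s \<union> Poly_Mapping.keys t"
  have *: "Poly_Mapping.keys (s + t) \<subseteq> ?A" by (rule keys_add)
  show ?thesis
    unfolding monomial_eval_superset[of ?A "s + t" f, OF _ *, simplified]
      monomial_eval_superset[of ?A s f, simplified] monomial_eval_superset[of ?A t f, simplified]
    by (simp add: lookup_add power_add prod.distrib)
qed

lemma poly_mapping_sum_single:
  "p = (\<Sum>t\<in>Poly_Mapping.keys p. Poly_Mapping.single t (Poly_Mapping.lookup p t))"
  by (rule poly_mapping_eqI) (auto simp: lookup_sum lookup_single when_def in_keys_iff)

lemma comm_ring_homI:
  assumes "h 0 = 0" "h 1 = 1" "\<And>x y. h (x + y) = h x + h y" "\<And>x y. h (x * y) = h x * h y"
  shows "comm_ring_hom h"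
  by unfold_locales (use assms in auto)

text \<open>Monomials span, so multiplicativity of an additive map only has to be checked on them.\<close>

lemma comm_ring_hom_monomialsI:
  fixes h :: "(('v \<Rightarrow>\<^sub>0 nat) \<Rightarrow>\<^sub>0 'a::comm_ring_1) \<Rightarrow> 'b::comm_ring_1"
  assumes zero: "h 0 = 0" and one: "h 1 = 1" and add: "\<And>p q. h (p + q) = h p + h q"
    and single: "\<And>s t a b. h (Poly_Mapping.single s a * Poly_Mapping.single t b) =
      h (Poly_Mapping.single s a) * h (Poly_Mapping.single t b)"
  shows "comm_ring_hom h"
proof (rule comm_ring_homI)
  fix p q
  have sum: "h (sum P I) = (\<Sum>i\<in>I. h (P i))" for P and I :: "('v \<Rightarrow>\<^sub>0 nat) set"
    by (induction I rule: infinite_finite_induct) (auto simp: zero add)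
  have "h (p * q) = h
     ((\<Sum>s\<in>Poly_Mapping.keys p. Poly_Mapping.single s (Poly_Mapping.lookup p s)) *
      (\<Sum>t\<in>Poly_Mapping.keys q. Poly_Mapping.single t (Poly_Mapping.lookup q t)))"
    by (simp flip: poly_mapping_sum_single)
  also have "\<dots> =
      h (\<Sum>s\<in>Poly_Mapping.keys p. Poly_Mapping.single s (Poly_Mapping.lookup p s)) *
      h (\<Sum>t\<in>Poly_Mapping.keys q. Poly_Mapping.single t (Poly_Mapping.lookup q t))"
    by (simp only: sum_product sum single)
  finally show "h (p * q) = h p * h q" by (simp flip: poly_mapping_sum_single)
qed (fact zero one add)+

lemma comm_ring_hom_eval:
  assumes "comm_ring_hom \<phi>"
  shows "comm_ring_hom (eval_mpoly \<phi> f)"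
proof -
  interpret comm_ring_hom \<phi> by fact
  have single: "eval_mpoly \<phi> f (Poly_Mapping.single t a) =
      \<phi> a * (\<Prod>v\<in>Poly_Mapping.keys t. f v ^ Poly_Mapping.lookup t v)" for t a
    by (simp add: eval_mpoly_def)
  show ?thesis
  proof (rule comm_ring_hom_monomialsI)
    show "eval_mpoly \<phi> f 0 = 0" by (simp add: eval_mpoly_def)
    show "eval_mpoly \<phi> f 1 = 1" using single[of 0 1] by simp
    show "eval_mpoly \<phi> f (p + q) = eval_mpoly \<phi> f p + eval_mpoly \<phi> f q" for p q
      unfolding eval_mpoly_def
      by (rule setsum_keys_plus_distrib) (simp_all add: hom_distribs algebra_simps)
  qed (simp only: mult_single single monomial_eval_add, simp add: hom_distribs algebra_simps)
qed

lemma eval_Const: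
  assumes "comm_ring_hom \<phi>"
  shows "eval_mpoly \<phi> f (Const a) = \<phi> a"
proof -
  interpret comm_ring_hom \<phi> by fact
  show ?thesis by (simp add: Const_def eval_mpoly_def)
qed

lemma eval_single_var:
  assumes "comm_ring_hom \<phi>"
  shows "eval_mpoly \<phi> f (Poly_Mapping.single (Poly_Mapping.single v 1) 1) = f v"
proof -
  interpret comm_ring_hom \<phi> by fact
  show ?thesis by (simp add: eval_mpoly_def)
qed

lemma eval_Var:
  assumes "comm_ring_hom \<phi>"
  shows "eval_mpoly \<phi> f (Var v) = f v"
  unfolding Var_def by (rule eval_single_var[OF assms])

lemma eval_mpoly_cong:
  assumes "\<And>t v. t \<in> Poly_Mapping.keys p \<Longrightarrow> v \<in> Poly_Mapping.keys t \<Longrightarrow> f v = g v"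
  shows "eval_mpoly \<phi> f p = eval_mpoly \<phi> g p"
  unfolding eval_mpoly_def using assms by (intro sum.cong refl arg_cong2[of _ _ _ _ "(*)"] prod.cong) auto

lemma hom_eval_mpoly:
  assumes "comm_ring_hom h"
  shows "h (eval_mpoly \<phi> f p) = eval_mpoly (\<lambda>a. h (\<phi> a)) (\<lambda>v. h (f v)) p"
proof -
  interpret comm_ring_hom h by fact
  show ?thesis by (simp add: eval_mpoly_def hom_distribs)
qed

lemma comm_ring_hom_Const: "comm_ring_hom (Const :: 'a::comm_ring_1 \<Rightarrow> 'a mpoly)"
  by (rule comm_ring_homI) (simp_all add: Const_def single_add mult_single)

lemma comm_ring_hom_of_int: "comm_ring_hom (of_int :: int \<Rightarrow> 'a::comm_ring_1)"
  by (rule comm_ring_homI) simp_all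

lemma comm_ring_hom_id: "comm_ring_hom (\<lambda>x :: 'a::comm_ring_1. x)"
  by (rule comm_ring_homI) simp_all

lemma lookup_map:
  assumes "f 0 = 0"
  shows "Poly_Mapping.lookup (Poly_Mapping.map f p) t = f (Poly_Mapping.lookup p t)"
  using assms by (simp add: Poly_Mapping.map.rep_eq when_def)

text \<open>
  Reduction of coefficients modulo 2 is the case that matters here.
\<close>

lemma comm_ring_hom_map:
  assumes "comm_ring_hom \<phi>"
  shows "comm_ring_hom (Poly_Mapping.map \<phi> ::
    (('v \<Rightarrow>\<^sub>0 nat) \<Rightarrow>\<^sub>0 'a::comm_ring_1) \<Rightarrow> (('v \<Rightarrow>\<^sub>0 nat) \<Rightarrow>\<^sub>0 'b::comm_ring_1))"
proof -
  interpret comm_ring_hom \<phi> by fact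
  have single: "Poly_Mapping.map \<phi> (Poly_Mapping.single t a) = Poly_Mapping.single t (\<phi> a)"
    for t :: "'v \<Rightarrow>\<^sub>0 nat" and a
    by (rule poly_mapping_eqI) (simp add: lookup_map lookup_single when_def)
  show ?thesis
  proof (rule comm_ring_hom_monomialsI)
    show "Poly_Mapping.map \<phi> (0 :: ('v \<Rightarrow>\<^sub>0 nat) \<Rightarrow>\<^sub>0 'a) = 0"
      by (rule poly_mapping_eqI) (simp add: lookup_map)
    show "Poly_Mapping.map \<phi> 1 = (1 :: ('v \<Rightarrow>\<^sub>0 nat) \<Rightarrow>\<^sub>0 'b)"
      using single[of 0 1] by simp
    show "Poly_Mapping.map \<phi> (p + q) = Poly_Mapping.map \<phi> p + Poly_Mapping.map \<phi> q"
      for p q :: "('v \<Rightarrow>\<^sub>0 nat) \<Rightarrow>\<^sub>0 'a"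
      by (rule poly_mapping_eqI) (simp add: lookup_map lookup_add hom_distribs)
  qed (simp_all add: mult_single single hom_distribs)
qed

lemma map_Var:
  assumes "comm_ring_hom \<phi>"
  shows "Poly_Mapping.map \<phi> (Var v) = Var v"
proof -
  interpret comm_ring_hom \<phi> by fact
  show ?thesis
    unfolding Var_def by (rule poly_mapping_eqI) (simp add: lookup_map lookup_single when_def)
qed

lemma eval_map:
  assumes "comm_ring_hom \<phi>"
  shows "eval_mpoly (\<lambda>x. x) f (Poly_Mapping.map \<phi> p) = eval_mpoly \<phi> f p"
proof -
  interpret comm_ring_hom \<phi> by fact
  have "Poly_Mapping.keys (Poly_Mapping.map \<phi> p) \<subseteq> Poly_Mapping.keys p"
    by (auto simp: in_keys_iff lookup_map)
  then show ?thesis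
    unfolding eval_mpoly_def
    by (intro sum.mono_neutral_cong_left) (auto simp: lookup_map in_keys_iff)
qed

section \<open>Normal forms of perfect matchings\<close>

text \<open>
  The index set of the sum that defines the Pfaffian of a matrix of size \<open>2 * \<mu>\<close>. A permutation \<open>p\<close> stands
  for the perfect matching with the edges \<open>{p (2 * s), p (2 * s + 1)}\<close>.
\<close>

definition matching_nf :: "nat \<Rightarrow> (nat \<Rightarrow> nat) set" where
  "matching_nf \<mu> = {p. p permutes {..<2 * \<mu>} \<and>
     (\<forall>s<\<mu>. p (2 * s) < p (2 * s + 1)) \<and>
     (\<forall>s<\<mu>. \<forall>t<\<mu>. s < t \<longrightarrow> p (2 * s) < p (2 * t))}"

definition mate :: "nat \<Rightarrow> nat" where
  "mate i = (if even i then i + 1 else i - 1)"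

definition flip :: "nat \<Rightarrow> nat \<Rightarrow> nat" where
  "flip s = transpose (2 * s) (2 * s + 1)"

definition pair_swap :: "nat \<Rightarrow> nat \<Rightarrow> nat \<Rightarrow> nat" where
  "pair_swap s t = transpose (2 * s) (2 * t) \<circ> transpose (2 * s + 1) (2 * t + 1)"

text \<open>
  The permutations that preserve the standard matching \<open>{0, 1}, {2, 3}, \<dots>\<close>. Two permutations stand for the
  same matching iff they differ by such a permutation on the right. The group is presented by generators,
  because the invariance of a summand is only ever checked on these.
\<close>

inductive_set hyperoct :: "nat \<Rightarrow> (nat \<Rightarrow> nat) set" for \<mu> where
  id: "id \<in> hyperoct \<mu>"
| flip: "h \<in> hyperoct \<mu> \<Longrightarrow> s < \<mu> \<Longrightarrow> h \<circ> flip s \<in> hyperoct \<mu>"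
| pair_swap: "h \<in> hyperoct \<mu> \<Longrightarrow> s < \<mu> \<Longrightarrow> t < \<mu> \<Longrightarrow> s \<noteq> t \<Longrightarrow> h \<circ> pair_swap s t \<in> hyperoct \<mu>"

lemma nat_parity_cases [case_names even odd]:
  fixes i :: nat
  obtains r where "i = 2 * r" | r where "i = Suc (2 * r)"
  by (cases "even i") (auto elim!: evenE oddE)

lemma mate_mate [simp]: "mate (mate i) = i"
  by (auto simp: mate_def)

lemma mate_even [simp]: "mate (2 * s) = Suc (2 * s)"
  and mate_odd [simp]: "mate (Suc (2 * s)) = 2 * s"
  by (auto simp: mate_def)

lemma flip_permutes: "s < \<mu> \<Longrightarrow> flip s permutes {..<2 * \<mu>}"
  unfolding flip_def by (rule permutes_swap_id) auto

lemma pair_swap_permutes: "s < \<mu> \<Longrightarrow> t < \<mu> \<Longrightarrow> pair_swap s t permutes {..<2 * \<mu>}"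
  unfolding pair_swap_def by (intro permutes_compose permutes_swap_id) auto

lemma flip_flip [simp]: "flip s \<circ> flip s = id"
  by (simp add: flip_def)

lemma pair_swap_apply:
  "s \<noteq> t \<Longrightarrow> pair_swap s t i =
     (if i = 2 * s then 2 * t else if i = 2 * t then 2 * s else
      if i = 2 * s + 1 then 2 * t + 1 else if i = 2 * t + 1 then 2 * s + 1 else i)"
  by (cases i rule: nat_parity_cases) (simp_all add: pair_swap_def transpose_def)

lemma pair_swap_pair_swap: "s \<noteq> t \<Longrightarrow> pair_swap s t \<circ> pair_swap s t = id"
  by (rule ext) (auto simp: pair_swap_apply)

lemma mate_flip: "mate (flip s i) = flip s (mate i)"
  by (cases i rule: nat_parity_cases) (auto simp: flip_def transpose_def)

lemma mate_pair_swap: "s \<noteq> t \<Longrightarrow> mate (pair_swap s t i) = pair_swap s t (mate i)"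
  by (cases i rule: nat_parity_cases) (auto simp: pair_swap_apply)

lemma hyperoct_permutes: "h \<in> hyperoct \<mu> \<Longrightarrow> h permutes {..<2 * \<mu>}"
  by (induction rule: hyperoct.induct)
    (blast intro: permutes_compose flip_permutes pair_swap_permutes permutes_id)+

lemma hyperoct_mate: "h \<in> hyperoct \<mu> \<Longrightarrow> h (mate i) = mate (h i)"
  by (induction arbitrary: i rule: hyperoct.induct) (auto simp flip: mate_flip mate_pair_swap)

lemma hyperoct_comp: "h' \<in> hyperoct \<mu> \<Longrightarrow> h \<in> hyperoct \<mu> \<Longrightarrow> h \<circ> h' \<in> hyperoct \<mu>"
  by (induction rule: hyperoct.induct) (auto simp flip: comp_assoc intro: hyperoct.intros)

lemma hyperoct_inverse:
  "h \<in> hyperoct \<mu> \<Longrightarrow> \<exists>h'\<in>hyperoct \<mu>. h \<circ> h' = id"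
proof (induction rule: hyperoct.induct)
  case id
  show ?case by (intro bexI[of _ id] hyperoct.id) simp
next
  case (flip h s)
  then obtain h' where h': "h' \<in> hyperoct \<mu>" "h \<circ> h' = id" by blast
  have "flip s \<in> hyperoct \<mu>" using hyperoct.flip[OF hyperoct.id flip(2)] by simp
  then have "flip s \<circ> h' \<in> hyperoct \<mu>" by (rule hyperoct_comp[OF h'(1)])
  moreover have "(h \<circ> flip s) \<circ> (flip s \<circ> h') = id"
    by (metis comp_assoc flip_flip h'(2) id_comp)
  ultimately show ?case by blast
next
  case (pair_swap h s t)
  then obtain h' where h': "h' \<in> hyperoct \<mu>" "h \<circ> h' = id" by blast
  have "pair_swap s t \<in> hyperoct \<mu>"
    using hyperoct.pair_swap[OF hyperoct.id pair_swap(2-4)] by simp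
  then have "pair_swap s t \<circ> h' \<in> hyperoct \<mu>" by (rule hyperoct_comp[OF h'(1)])
  moreover have "(h \<circ> pair_swap s t) \<circ> (pair_swap s t \<circ> h') = id"
    by (metis comp_assoc pair_swap_pair_swap[OF pair_swap(4)] h'(2) id_comp)
  ultimately show ?case by blast
qed

lemma finite_hyperoct: "finite (hyperoct \<mu>)"
  by (rule finite_subset[OF _ finite_permutations[of "{..<2 * \<mu>}"]]) (auto dest: hyperoct_permutes)

lemma finite_matching_nf: "finite (matching_nf \<mu>)"
  by (rule finite_subset[OF _ finite_permutations[of "{..<2 * \<mu>}"]]) (auto simp: matching_nf_def)

lemma strict_mono_lessThan_eq_id:
  fixes \<sigma> :: "nat \<Rightarrow> nat"
  assumes mono: "\<And>s t. s < t \<Longrightarrow> t < \<mu> \<Longrightarrow> \<sigma> s < \<sigma> t"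
    and bound: "\<And>s. s < \<mu> \<Longrightarrow> \<sigma> s < \<mu>" and "s < \<mu>"
  shows "\<sigma> s = s"
proof (rule antisym)
  show "s \<le> \<sigma> s" using \<open>s < \<mu>\<close>
  proof (induction s)
    case (Suc s)
    then show ?case using mono[of s "Suc s"] by simp
  qed simp
  have "\<sigma> s + d < \<mu>" if "s + d < \<mu>" for s d
    using that
  proof (induction d arbitrary: s)
    case (Suc d)
    have "\<sigma> s < \<sigma> (Suc s)" using Suc.prems by (intro mono) auto
    moreover have "\<sigma> (Suc s) + d < \<mu>" using Suc.prems by (intro Suc.IH) auto
    ultimately show ?case by simp
  qed (use bound in simp)
  from this[of s "\<mu> - 1 - s"] show "\<sigma> s \<le> s" using \<open>s < \<mu>\<close> by simp
qed

text \<open>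
  A permutation that commutes with \<open>mate\<close> permutes the standard edges and flips some of them. The normal
  form fixes the orientation of every edge, which excludes the flips, and the order of the edges, so that
  the induced permutation of edges is increasing and therefore the identity.
\<close>

lemma matching_nf_unique:
  assumes p: "p \<in> matching_nf \<mu>" and ph: "p \<circ> h \<in> matching_nf \<mu>"
    and h: "h permutes {..<2 * \<mu>}" and comm: "\<And>i. h (mate i) = mate (h i)"
  shows "h = id"
proof -
  have lt: "h (2 * s) < 2 * \<mu>" if "s < \<mu>" for s
    using permutes_in_image[OF h, of "2 * s"] that by simp
  have ev: "even (h (2 * s))" if "s < \<mu>" for s
  proof (rule ccontr)
    assume "odd (h (2 * s))"
    then obtain r where r: "h (2 * s) = 2 * r + 1" by (elim oddE)
    then have "h (2 * s + 1) = 2 * r" using comm[of "2 * s"] by simp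
    moreover have "p (h (2 * s)) < p (h (2 * s + 1))" using ph that by (simp add: matching_nf_def)
    moreover have "p (2 * r) < p (2 * r + 1)" using p lt[OF that] r by (simp add: matching_nf_def)
    ultimately show False using r by simp
  qed
  define \<sigma> where "\<sigma> s = h (2 * s) div 2" for s
  have \<sigma>: "h (2 * s) = 2 * \<sigma> s" "\<sigma> s < \<mu>" if "s < \<mu>" for s
    using ev[OF that] lt[OF that] by (auto simp: \<sigma>_def)
  have mono: "\<sigma> s < \<sigma> t" if "s < t" "t < \<mu>" for s t
  proof (rule ccontr)
    assume "\<not> \<sigma> s < \<sigma> t"
    then have "\<sigma> t = \<sigma> s \<or> \<sigma> t < \<sigma> s" by auto
    moreover have "p (2 * \<sigma> t) < p (2 * \<sigma> s)" if "\<sigma> t < \<sigma> s"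
      using p \<sigma>(2)[of s] \<sigma>(2)[of t] that \<open>s < t\<close> \<open>t < \<mu>\<close> by (simp add: matching_nf_def)
    ultimately have "p (2 * \<sigma> t) \<le> p (2 * \<sigma> s)" by auto
    moreover have "p (h (2 * s)) < p (h (2 * t))" using ph that by (simp add: matching_nf_def)
    ultimately show False using \<sigma> that by simp
  qed
  have \<sigma>_id: "\<sigma> s = s" if "s < \<mu>" for s
    using strict_mono_lessThan_eq_id[of \<mu> \<sigma> s] mono \<sigma>(2) that by auto
  show ?thesis
  proof
    fix i
    show "h i = id i"
    proof (cases "i < 2 * \<mu>")
      case True
      show ?thesis
      proof (cases "even i")
        case True
        then show ?thesis using \<open>i < 2 * \<mu>\<close> \<sigma> \<sigma>_id by (auto elim!: evenE)
      next
        case False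
        then obtain s where "i = 2 * s + 1" by (elim oddE)
        then show ?thesis using \<open>i < 2 * \<mu>\<close> \<sigma>[of s] \<sigma>_id[of s] comm[of "2 * s"] by simp
      qed
    qed (use h in \<open>auto simp: permutes_def\<close>)
  qed
qed

lemma sum_two_terms:
  fixes f :: "nat \<Rightarrow> 'a::comm_monoid_add"
  assumes "s < \<mu>" "t < \<mu>" "s \<noteq> t"
  shows "(\<Sum>r<\<mu>. f r) = f s + (f t + (\<Sum>r\<in>{..<\<mu>} - {s} - {t}. f r))"
  using assms by (simp add: sum.remove[of "{..<\<mu>}" s] sum.remove[of "{..<\<mu>} - {s}" t])

text \<open>
  Sorting inside the edges and then the edges among each other is replaced by an extremal argument: a
  permutation in the orbit that maximises a suitable weighted sum of its values has to be in normal form,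
  as otherwise a flip or a swap of two edges would increase the sum.
\<close>

lemma matching_nf_exists:
  assumes p: "p permutes {..<2 * \<mu>}"
  shows "\<exists>h\<in>hyperoct \<mu>. p \<circ> h \<in> matching_nf \<mu>"
proof -
  \<comment> \<open>The weight \<open>\<mu>\<close> of the odd positions exceeds the weight \<open>s\<close> of position \<open>2 * s\<close>, which forces the order
  inside an edge; as it is constant, a swap of two edges is governed by the even positions alone.\<close>
  define W where "W q = (\<Sum>s<\<mu>. s * q (2 * s) + \<mu> * q (2 * s + 1))" for q :: "nat \<Rightarrow> nat"
  let ?V = "(\<lambda>h. W (p \<circ> h)) ` hyperoct \<mu>"
  have fin: "finite ?V" using finite_hyperoct by simp
  have "Max ?V \<in> ?V" by (rule Max_in[OF fin]) (use hyperoct.id in blast)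
  then obtain h where h: "h \<in> hyperoct \<mu>" and max: "Max ?V = W (p \<circ> h)" by auto
  define q where "q = p \<circ> h"
  have q: "q permutes {..<2 * \<mu>}"
    unfolding q_def using permutes_compose[OF hyperoct_permutes[OF h] p] .
  have maximal: "W (q \<circ> g) \<le> W q" if "h \<circ> g \<in> hyperoct \<mu>" for g
    using Max_ge[OF fin, of "W (p \<circ> (h \<circ> g))"] that unfolding max q_def by (simp add: comp_assoc)
  have inj: "q i = q j \<longleftrightarrow> i = j" for i j using permutes_inj[OF q] by (auto dest: injD)
  have "q (2 * s) < q (2 * s + 1)" if s: "s < \<mu>" for s
  proof (rule ccontr)
    assume "\<not> ?thesis"
    then have gt: "q (2 * s + 1) < q (2 * s)" using inj[of "2 * s" "2 * s + 1"] by linarith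
    have rest: "(\<Sum>r\<in>{..<\<mu>} - {s}. r * q (flip s (2 * r)) + \<mu> * q (flip s (2 * r + 1))) =
        (\<Sum>r\<in>{..<\<mu>} - {s}. r * q (2 * r) + \<mu> * q (2 * r + 1))"
    proof (rule sum.cong)
      fix r assume "r \<in> {..<\<mu>} - {s}"
      then have "flip s (2 * r) = 2 * r" "flip s (2 * r + 1) = 2 * r + 1"
        by (auto simp: flip_def transpose_def)
      then show "r * q (flip s (2 * r)) + \<mu> * q (flip s (2 * r + 1)) =
          r * q (2 * r) + \<mu> * q (2 * r + 1)" by simp
    qed simp
    have fs: "flip s (2 * s) = 2 * s + 1" "flip s (2 * s + 1) = 2 * s" by (simp_all add: flip_def)
    define a where "a = q (2 * s) - q (2 * s + 1)"
    have a: "q (2 * s) = q (2 * s + 1) + a" "s * a < \<mu> * a" using gt s by (auto simp: a_def)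
    have "W q < W (q \<circ> flip s)"
      unfolding W_def sum.remove[OF finite_lessThan lessThan_iff[THEN iffD2, OF s]] rest o_apply fs a(1)
      using a(2) by (simp add: algebra_simps)
    then show False using maximal[OF hyperoct.flip[OF h s]] by simp
  qed
  moreover have "q (2 * s) < q (2 * t)" if s: "s < t" and t: "t < \<mu>" for s t
  proof (rule ccontr)
    assume "\<not> ?thesis"
    then have gt: "q (2 * t) < q (2 * s)" using inj[of "2 * s" "2 * t"] s by linarith
    have s': "s < \<mu>" "s \<noteq> t" using s t by auto
    have rest: "(\<Sum>r\<in>{..<\<mu>} - {s} - {t}. r * q (pair_swap s t (2 * r)) +
          \<mu> * q (pair_swap s t (2 * r + 1))) =
        (\<Sum>r\<in>{..<\<mu>} - {s} - {t}. r * q (2 * r) + \<mu> * q (2 * r + 1))"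
      by (rule sum.cong) (use s' in \<open>auto simp: pair_swap_apply\<close>)
    have ps: "pair_swap s t (2 * s) = 2 * t" "pair_swap s t (2 * t) = 2 * s"
      "pair_swap s t (2 * s + 1) = 2 * t + 1" "pair_swap s t (2 * t + 1) = 2 * s + 1"
      using s' by (simp_all add: pair_swap_apply)
    define a where "a = q (2 * s) - q (2 * t)"
    have a: "q (2 * s) = q (2 * t) + a" "s * a < t * a" using gt s by (auto simp: a_def)
    have "W q < W (q \<circ> pair_swap s t)"
      unfolding W_def sum_two_terms[OF s'(1) t s'(2)] rest o_apply ps a(1)
      using a(2) by (simp add: algebra_simps)
    then show False using maximal[OF hyperoct.pair_swap[OF h s'(1) t s'(2)]] by simp
  qed
  ultimately have "q \<in> matching_nf \<mu>" using q by (simp add: matching_nf_def)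
  then show ?thesis using h unfolding q_def by blast
qed

lemma bij_betw_nf_hyperoct:
  "bij_betw (\<lambda>(p, h). p \<circ> h) (matching_nf \<mu> \<times> hyperoct \<mu>) {p. p permutes {..<2 * \<mu>}}"
proof (rule bij_betw_imageI)
  show "inj_on (\<lambda>(p, h). p \<circ> h) (matching_nf \<mu> \<times> hyperoct \<mu>)"
  proof (rule inj_onI, clarify)
    fix p h q k assume p: "p \<in> matching_nf \<mu>" and q: "q \<in> matching_nf \<mu>"
      and h: "h \<in> hyperoct \<mu>" and k: "k \<in> hyperoct \<mu>" and eq: "p \<circ> h = q \<circ> k"
    obtain k' where k': "k' \<in> hyperoct \<mu>" "k \<circ> k' = id" using hyperoct_inverse[OF k] by blast
    have hk: "h \<circ> k' \<in> hyperoct \<mu>" by (rule hyperoct_comp[OF k'(1) h])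
    have "p \<circ> (h \<circ> k') = q" by (metis comp_assoc comp_id eq k'(2))
    then have "h \<circ> k' = id"
      using matching_nf_unique[OF p _ hyperoct_permutes[OF hk]] hyperoct_mate[OF hk] q by simp
    with \<open>p \<circ> (h \<circ> k') = q\<close> have "p = q" by simp
    moreover have "h = k" using \<open>p = q\<close> eq p
      by (metis (no_types, lifting) comp_assoc id_comp matching_nf_def mem_Collect_eq permutes_inv_o(2))
    ultimately show "p = q \<and> h = k" by simp
  qed
  show "(\<lambda>(p, h). p \<circ> h) ` (matching_nf \<mu> \<times> hyperoct \<mu>) = {p. p permutes {..<2 * \<mu>}}"
  proof (intro equalityI subsetI)
    fix q assume "q \<in> {p. p permutes {..<2 * \<mu>}}"
    then obtain h where h: "h \<in> hyperoct \<mu>" "q \<circ> h \<in> matching_nf \<mu>"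
      using matching_nf_exists by blast
    obtain h' where h': "h' \<in> hyperoct \<mu>" "h \<circ> h' = id" using hyperoct_inverse[OF h(1)] by blast
    have "q = (q \<circ> h) \<circ> h'" by (simp add: comp_assoc h'(2))
    then show "q \<in> (\<lambda>(p, h). p \<circ> h) ` (matching_nf \<mu> \<times> hyperoct \<mu>)"
      using h(2) h'(1) by (metis (mono_tags, lifting) SigmaI case_prod_conv image_eqI)
  qed (auto simp: matching_nf_def intro: permutes_compose hyperoct_permutes)
qed

text \<open>
  A sum over all permutations is easier to handle than one over normal forms, since it admits arbitrary
  changes of the summation index. If the summand depends only on the matching, the two sums differ by
  the order of the group \<open>hyperoct \<mu>\<close>.
\<close>

lemma sum_permutes_eq_nf:
  fixes \<Phi> :: "(nat \<Rightarrow> nat) \<Rightarrow> 'r::comm_ring_1"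
  assumes flip: "\<And>p s. p permutes {..<2 * \<mu>} \<Longrightarrow> s < \<mu> \<Longrightarrow> \<Phi> (p \<circ> flip s) = \<Phi> p"
    and pair_swap: "\<And>p s t. p permutes {..<2 * \<mu>} \<Longrightarrow> s < \<mu> \<Longrightarrow> t < \<mu> \<Longrightarrow> s \<noteq> t \<Longrightarrow>
      \<Phi> (p \<circ> pair_swap s t) = \<Phi> p"
  shows "(\<Sum>p | p permutes {..<2 * \<mu>}. \<Phi> p) =
    of_nat (card (hyperoct \<mu>)) * (\<Sum>p\<in>matching_nf \<mu>. \<Phi> p)"
proof -
  have inv: "\<Phi> (p \<circ> h) = \<Phi> p" if "h \<in> hyperoct \<mu>" "p permutes {..<2 * \<mu>}" for p h
    using that
  proof (induction rule: hyperoct.induct)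
    case (flip h s)
    have "(p \<circ> h) permutes {..<2 * \<mu>}"
      using permutes_compose[OF hyperoct_permutes[OF flip(1)] flip(4)] .
    from assms(1)[OF this flip(2)] show ?case using flip(3,4) by (metis comp_assoc)
  next
    case (pair_swap h s t)
    have "(p \<circ> h) permutes {..<2 * \<mu>}"
      using permutes_compose[OF hyperoct_permutes[OF pair_swap(1)] pair_swap(6)] .
    from assms(2)[OF this pair_swap(2-4)] show ?case using pair_swap(5,6) by (metis comp_assoc)
  qed simp
  have "(\<Sum>p | p permutes {..<2 * \<mu>}. \<Phi> p) =
      (\<Sum>(p, h)\<in>matching_nf \<mu> \<times> hyperoct \<mu>. \<Phi> (p \<circ> h))"
    using sum.reindex_bij_betw[OF bij_betw_nf_hyperoct, of \<Phi> \<mu>] by (simp add: case_prod_unfold)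
  also have "\<dots> = (\<Sum>(p, h)\<in>matching_nf \<mu> \<times> hyperoct \<mu>. \<Phi> p)"
    by (rule sum.cong) (auto simp: inv matching_nf_def)
  also have "\<dots> = of_nat (card (hyperoct \<mu>)) * (\<Sum>p\<in>matching_nf \<mu>. \<Phi> p)"
    by (simp add: sum.cartesian_product[symmetric] sum_distrib_left)
  finally show ?thesis .
qed

section \<open>Coloured Pfaffian sums with forms of low rank\<close>

text \<open>
  The term of a Pfaffian that belongs to \<open>p\<close>, where the entry for the \<open>s\<close>-th edge is taken from the matrix
  \<open>E c\<close> of its colour \<open>c = \<chi> s\<close>.
\<close>

definition col_term ::
    "('c \<Rightarrow> nat \<Rightarrow> nat \<Rightarrow> 'r::comm_ring_1) \<Rightarrow> nat \<Rightarrow> (nat \<Rightarrow> 'c) \<Rightarrow> (nat \<Rightarrow> nat) \<Rightarrow> 'r" where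
  "col_term E \<mu> \<chi> p = of_int (sign p) * (\<Prod>s<\<mu>. E (\<chi> s) (p (2 * s)) (p (2 * s + 1)))"

lemma sign_comp_transpose:
  fixes k :: nat
  assumes "p permutes {..<k}" "a < k" "b < k" "a \<noteq> b"
  shows "sign (p \<circ> transpose a b) = - sign p"
proof -
  have "permutation p" by (rule permutes_imp_permutation[OF _ assms(1)]) simp
  moreover have "permutation (transpose a b)" by (rule permutation_swap_id)
  ultimately show ?thesis using assms(4) by (simp add: sign_compose sign_swap_id)
qed

lemma col_term_flip:
  assumes skew: "\<And>c i j. E c j i = - E c i j" and p: "p permutes {..<2 * \<mu>}" and s: "s < \<mu>"
  shows "col_term E \<mu> \<chi> (p \<circ> flip s) = col_term E \<mu> \<chi> p"
proof -
  have sg: "sign (p \<circ> flip s) = - sign p"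
    unfolding flip_def using s by (intro sign_comp_transpose[OF p]) auto
  have fs: "flip s (2 * s) = 2 * s + 1" "flip s (2 * s + 1) = 2 * s" by (simp_all add: flip_def)
  have rest: "(\<Prod>r\<in>{..<\<mu>} - {s}. E (\<chi> r) (p (flip s (2 * r))) (p (flip s (2 * r + 1)))) =
      (\<Prod>r\<in>{..<\<mu>} - {s}. E (\<chi> r) (p (2 * r)) (p (2 * r + 1)))"
  proof (rule prod.cong)
    fix r assume "r \<in> {..<\<mu>} - {s}"
    then have "flip s (2 * r) = 2 * r" "flip s (2 * r + 1) = 2 * r + 1"
      by (auto simp: flip_def transpose_def)
    then show "E (\<chi> r) (p (flip s (2 * r))) (p (flip s (2 * r + 1))) =
        E (\<chi> r) (p (2 * r)) (p (2 * r + 1))" by simp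
  qed simp
  show ?thesis
    unfolding col_term_def sg prod.remove[OF finite_lessThan lessThan_iff[THEN iffD2, OF s]]
      o_apply rest fs skew[of _ "p (2 * s + 1)"]
    by simp
qed

lemma col_term_pair_swap:
  assumes p: "p permutes {..<2 * \<mu>}" and s: "s < \<mu>" and t: "t < \<mu>" and st: "s \<noteq> t"
  shows "col_term E \<mu> \<chi> (p \<circ> pair_swap s t) = col_term E \<mu> (\<chi> \<circ> transpose s t) p"
proof -
  have "sign (p \<circ> transpose (2 * s) (2 * t)) = - sign p"
    using s t st by (intro sign_comp_transpose[OF p]) auto
  moreover have "sign ((p \<circ> transpose (2 * s) (2 * t)) \<circ> transpose (2 * s + 1) (2 * t + 1)) =
      - sign (p \<circ> transpose (2 * s) (2 * t))"
    using s t st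
    by (intro sign_comp_transpose[of _ "2 * \<mu>"] permutes_compose[OF permutes_swap_id p]) auto
  ultimately have sg: "sign (p \<circ> pair_swap s t) = sign p"
    unfolding pair_swap_def by (simp only: comp_assoc minus_minus)
  have ps: "pair_swap s t (2 * r) = 2 * transpose s t r"
    "pair_swap s t (2 * r + 1) = 2 * transpose s t r + 1" for r
    using st by (auto simp: pair_swap_apply transpose_def)
  let ?g = "\<lambda>r. E (\<chi> (transpose s t r)) (p (2 * r)) (p (2 * r + 1))"
  have "(\<Prod>r<\<mu>. ?g r) = (\<Prod>r<\<mu>. (?g \<circ> transpose s t) r)"
    using s t by (subst prod.permute[OF permutes_swap_id, of s "{..<\<mu>}" t]) (auto simp: o_def)
  then show ?thesis
    unfolding col_term_def sg o_apply ps by simp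
qed

text \<open>
  This is the reason why a Pfaffian of a form of rank at most \<open>n\<close> vanishes on more than \<open>n\<close> vectors, for one
  fixed colouring. Expanding the edges of low rank distributes \<open>n\<close> coordinate indices over more than \<open>n\<close>
  positions, so two positions get the same index, and transposing these two positions changes the sign
  of \<open>p\<close> but nothing else.
\<close>

lemma sum_col_term_low_rank:
  fixes E :: "'c \<Rightarrow> nat \<Rightarrow> nat \<Rightarrow> 'r::comm_ring_1"
  assumes low: "\<And>c i j. c \<in> L \<Longrightarrow> E c i j = (\<Sum>a<n. \<Sum>b<n. X i a * K c a b * X j b)"
    and n: "n < 2 * card {s\<in>{..<\<mu>}. \<chi> s \<in> L}"
  shows "(\<Sum>p | p permutes {..<2 * \<mu>}. col_term E \<mu> \<chi> p) = 0"
proof -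
  define S where "S = {s\<in>{..<\<mu>}. \<chi> s \<in> L}"
  have finS: "finite S" by (simp add: S_def)
  define rest where "rest p = (\<Prod>s\<in>{..<\<mu>} - S. E (\<chi> s) (p (2 * s)) (p (2 * s + 1)))" for p
  define F where "F f p = of_int (sign p) * rest p *
      (\<Prod>s\<in>S. X (p (2 * s)) (fst (f s)) * K (\<chi> s) (fst (f s)) (snd (f s)) *
        X (p (2 * s + 1)) (snd (f s)))" for f p
  define I where "I = PiE S (\<lambda>_. {..<n} \<times> {..<n})"
  have expand: "col_term E \<mu> \<chi> p = (\<Sum>f\<in>I. F f p)" for p
  proof -
    have "(\<Prod>s<\<mu>. E (\<chi> s) (p (2 * s)) (p (2 * s + 1))) =
        (\<Prod>s\<in>S. E (\<chi> s) (p (2 * s)) (p (2 * s + 1))) * rest p"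
      unfolding rest_def by (rule prod.subset_diff[of S, THEN trans]) (auto simp: S_def mult.commute)
    also have "(\<Prod>s\<in>S. E (\<chi> s) (p (2 * s)) (p (2 * s + 1))) =
        (\<Prod>s\<in>S. \<Sum>y\<in>{..<n} \<times> {..<n}. X (p (2 * s)) (fst y) * K (\<chi> s) (fst y) (snd y) *
          X (p (2 * s + 1)) (snd y))"
      by (intro prod.cong refl) (simp add: S_def low sum.cartesian_product case_prod_unfold)
    also have "\<dots> = (\<Sum>f\<in>I. \<Prod>s\<in>S. X (p (2 * s)) (fst (f s)) * K (\<chi> s) (fst (f s)) (snd (f s)) *
          X (p (2 * s + 1)) (snd (f s)))"
      unfolding I_def by (rule prod_sum_PiE) (use finS in auto)
    finally show ?thesis
      unfolding col_term_def F_def by (simp add: sum_distrib_left sum_distrib_right mult_ac)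
  qed
  have "(\<Sum>p | p permutes {..<2 * \<mu>}. F f p) = 0" if f: "f \<in> I" for f
  proof -
    \<comment> \<open>The choice \<open>f\<close> of a pair of coordinates for every edge is read as a choice of one coordinate for every position.\<close>
    define coord where "coord i = (if even i then fst (f (i div 2)) else snd (f (i div 2)))" for i
    define pos where "pos = (\<lambda>s. 2 * s) ` S \<union> (\<lambda>s. 2 * s + 1) ` S"
    have disj: "(\<lambda>s. 2 * s) ` S \<inter> (\<lambda>s. 2 * s + 1) ` S = {}" by auto presburger
    have inj: "inj_on (\<lambda>s::nat. 2 * s) S" "inj_on (\<lambda>s::nat. 2 * s + 1) S" by (auto simp: inj_on_def)
    have "card pos = 2 * card S"
      unfolding pos_def using disj inj finS by (simp add: card_Un_disjoint card_image)
    then have "n < card pos" using n by (simp add: S_def)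
    moreover have "coord ` pos \<subseteq> {..<n}"
      using f unfolding pos_def coord_def I_def by (force simp: PiE_iff)
    then have "card (coord ` pos) \<le> n" using card_mono[of "{..<n}"] by fastforce
    ultimately have "\<not> inj_on coord pos" by (auto dest: card_image)
    then obtain a b where ab: "a \<in> pos" "b \<in> pos" "a \<noteq> b" "coord a = coord b"
      by (auto simp: inj_on_def)
    define \<tau> where "\<tau> = transpose a b"
    have lt: "i < 2 * \<mu>" if "i \<in> pos" for i using that by (auto simp: pos_def S_def)
    have \<tau>: "\<tau> permutes pos" unfolding \<tau>_def using ab by (intro permutes_swap_id)
    have coord_\<tau>: "coord (\<tau> i) = coord i" for i using ab(4) by (auto simp: \<tau>_def transpose_def)
    have F: "F f p = of_int (sign p) * rest p * (\<Prod>s\<in>S. K (\<chi> s) (fst (f s)) (snd (f s))) *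
        (\<Prod>i\<in>pos. X (p i) (coord i))" for p
    proof -
      have "(\<Prod>i\<in>pos. X (p i) (coord i)) =
          (\<Prod>s\<in>S. X (p (2 * s)) (fst (f s))) * (\<Prod>s\<in>S. X (p (2 * s + 1)) (snd (f s)))"
        unfolding pos_def using disj inj finS
        by (subst prod.union_disjoint) (auto simp: prod.reindex coord_def)
      then show ?thesis unfolding F_def by (simp add: prod.distrib mult_ac)
    qed
    have rest: "rest (p \<circ> \<tau>) = rest p" for p
    proof -
      have fixed: "\<tau> i = i" if "i div 2 \<notin> S" for i
      proof -
        have "i \<notin> pos" using that by (auto simp: pos_def)
        then show ?thesis using \<tau> by (auto simp: permutes_def)
      qed
      show ?thesis unfolding rest_def by (intro prod.cong refl) (simp add: fixed)
    qed
    have X: "(\<Prod>i\<in>pos. X ((p \<circ> \<tau>) i) (coord i)) = (\<Prod>i\<in>pos. X (p i) (coord i))" for p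
      by (subst prod.permute[OF \<tau>, of "\<lambda>i. X (p i) (coord i)"]) (simp add: coord_\<tau>)
    have sg: "sign (p \<circ> \<tau>) = - sign p" if "p permutes {..<2 * \<mu>}" for p
      unfolding \<tau>_def using ab lt by (intro sign_comp_transpose[OF that]) auto
    have \<tau>': "\<tau> permutes {..<2 * \<mu>}" by (rule permutes_subset[OF \<tau>]) (use lt in auto)
    show ?thesis
    proof (rule sum_involution_eq_0[where h = "\<lambda>p. p \<circ> \<tau>"])
      fix p assume "p \<in> {p. p permutes {..<2 * \<mu>}}"
      then have p: "p permutes {..<2 * \<mu>}" by simp
      show "F f (p \<circ> \<tau>) + F f p = 0" unfolding F rest X sg[OF p] by simp
      show "p \<circ> \<tau> \<in> {p. p permutes {..<2 * \<mu>}}" using permutes_compose[OF \<tau>' p] by simp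
      show "p \<circ> \<tau> \<circ> \<tau> = p" unfolding \<tau>_def by (simp add: comp_assoc)
      have "p (\<tau> a) \<noteq> p a" using ab(3) permutes_inj[OF p] by (auto simp: \<tau>_def dest: injD)
      then show "p \<circ> \<tau> \<noteq> p" by (metis comp_apply)
    qed
  qed
  then have "(\<Sum>f\<in>I. \<Sum>p | p permutes {..<2 * \<mu>}. F f p) = 0" by simp
  then show ?thesis unfolding expand by (subst sum.swap)
qed

lemma of_nat_mult_poly_mapping_eq_0:
  fixes x :: "('v \<Rightarrow>\<^sub>0 nat) \<Rightarrow>\<^sub>0 int"
  assumes "of_nat c * x = 0" "c > 0"
  shows "x = 0"
proof (rule poly_mapping_eqI)
  fix k
  have "of_nat c * x = (\<Sum>i<c. x)" by simp
  then have "0 = Poly_Mapping.lookup (\<Sum>i<c. x) k" using assms(1) by (simp only: lookup_zero)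
  also have "\<dots> = of_nat c * Poly_Mapping.lookup x k" unfolding lookup_sum by simp
  finally show "Poly_Mapping.lookup x k = Poly_Mapping.lookup 0 k" using assms(2) by simp
qed

text \<open>
  The passage from all permutations to normal forms requires a division by the order of \<open>hyperoct \<mu>\<close>, which
  is possible over the integers. A swap of two edges permutes the colours, so only the sum over a set of
  colourings that is closed under such permutations depends on the matching alone.
\<close>

lemma sum_nf_low_rank_int:
  fixes E :: "'c \<Rightarrow> nat \<Rightarrow> nat \<Rightarrow> (('v \<Rightarrow>\<^sub>0 nat) \<Rightarrow>\<^sub>0 int)"
  assumes skew: "\<And>c i j. E c j i = - E c i j"
    and low: "\<And>c i j. c \<in> L \<Longrightarrow> E c i j = (\<Sum>a<n. \<Sum>b<n. X i a * K c a b * X j b)"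
    and closed: "\<And>\<chi> s t. \<chi> \<in> C \<Longrightarrow> s < \<mu> \<Longrightarrow> t < \<mu> \<Longrightarrow> \<chi> \<circ> transpose s t \<in> C"
    and n: "\<And>\<chi>. \<chi> \<in> C \<Longrightarrow> n < 2 * card {s\<in>{..<\<mu>}. \<chi> s \<in> L}"
  shows "(\<Sum>\<chi>\<in>C. \<Sum>p\<in>matching_nf \<mu>. col_term E \<mu> \<chi> p) = 0"
proof -
  define \<Phi> where "\<Phi> p = (\<Sum>\<chi>\<in>C. col_term E \<mu> \<chi> p)" for p
  have "(\<Sum>p | p permutes {..<2 * \<mu>}. \<Phi> p) = of_nat (card (hyperoct \<mu>)) * (\<Sum>p\<in>matching_nf \<mu>. \<Phi> p)"
  proof (rule sum_permutes_eq_nf)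
    fix p s assume "p permutes {..<2 * \<mu>}" "s < \<mu>"
    then show "\<Phi> (p \<circ> flip s) = \<Phi> p" unfolding \<Phi>_def by (simp only: col_term_flip[OF skew])
  next
    fix p s t assume p: "p permutes {..<2 * \<mu>}" and st: "s < \<mu>" "t < \<mu>" "s \<noteq> t"
    have "\<Phi> (p \<circ> pair_swap s t) = (\<Sum>\<chi>\<in>C. col_term E \<mu> (\<chi> \<circ> transpose s t) p)"
      unfolding \<Phi>_def by (intro sum.cong refl col_term_pair_swap p st)
    also have "\<dots> = \<Phi> p"
      unfolding \<Phi>_def
      by (rule sum.reindex_bij_witness[where i = "\<lambda>\<chi>. \<chi> \<circ> transpose s t" and j = "\<lambda>\<chi>. \<chi> \<circ> transpose s t"])
        (use closed[OF _ st(1,2)] in \<open>simp_all only: comp_assoc transpose_comp_involutory comp_id\<close>)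
    finally show "\<Phi> (p \<circ> pair_swap s t) = \<Phi> p" .
  qed
  moreover have "(\<Sum>p | p permutes {..<2 * \<mu>}. \<Phi> p) = 0"
    unfolding \<Phi>_def by (subst sum.swap) (simp add: sum_col_term_low_rank[OF low n])
  moreover have "card (hyperoct \<mu>) > 0"
    using finite_hyperoct hyperoct.id by (auto simp: card_gt_0_iff)
  ultimately have "(\<Sum>p\<in>matching_nf \<mu>. \<Phi> p) = 0"
    using of_nat_mult_poly_mapping_eq_0 by metis
  then show ?thesis unfolding \<Phi>_def by (subst sum.swap)
qed


lemma col_term_hom:
  assumes "comm_ring_hom h"
  shows "h (col_term E \<mu> \<chi> p) = col_term (\<lambda>c i j. h (E c i j)) \<mu> \<chi> p"
proof -
  interpret comm_ring_hom h by fact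
  show ?thesis by (simp add: col_term_def hom_distribs)
qed

text \<open>
  Over a ring of characteristic 2 the division is impossible, but the identity is a specialisation of the
  one for generic vectors and generic alternating matrices over the integers.
\<close>

lemma sum_nf_low_rank:
  fixes E :: "nat \<Rightarrow> nat \<Rightarrow> nat \<Rightarrow> 'r::comm_ring_1"
  assumes low: "\<And>c i j. c \<in> L \<Longrightarrow> E c i j = (\<Sum>a<n. \<Sum>b<n. X i a * K c a b * X j b)"
    and K: "\<And>c a b. K c b a = - K c a b" "\<And>c a. K c a a = 0"
    and E: "\<And>c i j. c \<notin> L \<Longrightarrow> E c j i = - E c i j" "\<And>c i. c \<notin> L \<Longrightarrow> E c i i = 0"
    and closed: "\<And>\<chi> s t. \<chi> \<in> C \<Longrightarrow> s < \<mu> \<Longrightarrow> t < \<mu> \<Longrightarrow> \<chi> \<circ> transpose s t \<in> C"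
    and n: "\<And>\<chi>. \<chi> \<in> C \<Longrightarrow> n < 2 * card {s\<in>{..<\<mu>}. \<chi> s \<in> L}"
  shows "(\<Sum>\<chi>\<in>C. \<Sum>p\<in>matching_nf \<mu>. col_term E \<mu> \<chi> p) = 0"
proof -
  \<comment> \<open>Generic variables: the first component of an index tells vectors (0), the matrices \<open>K\<close> (3) and the
  entries of the remaining colours (2) apart.\<close>
  define V :: "nat \<times> nat \<times> nat \<times> nat \<Rightarrow> ((nat \<times> nat \<times> nat \<times> nat) \<Rightarrow>\<^sub>0 nat) \<Rightarrow>\<^sub>0 int"
    where "V v = Poly_Mapping.single (Poly_Mapping.single v 1) 1" for v
  define alt where "alt f a b = (if a < b then f a b else if b < a then - f b a else 0)"
    for f :: "nat \<Rightarrow> nat \<Rightarrow> ((nat \<times> nat \<times> nat \<times> nat) \<Rightarrow>\<^sub>0 nat) \<Rightarrow>\<^sub>0 int" and a b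
  define K' where "K' c = alt (\<lambda>a b. V (3, c, a, b))" for c
  define E' where "E' c i j = (if c \<in> L then \<Sum>a<n. \<Sum>b<n. V (0, 0, i, a) * K' c a b * V (0, 0, j, b)
      else alt (\<lambda>i j. V (2, c, i, j)) i j)" for c i j
  define h :: "_ \<Rightarrow> 'r" where "h = eval_mpoly of_int
    (\<lambda>(t, c, i, j). if t = 0 then X i j else if t = (3::nat) then K c i j else E c i j)"
  have hom: "comm_ring_hom h" unfolding h_def by (rule comm_ring_hom_eval[OF comm_ring_hom_of_int])
  interpret h: comm_ring_hom h by fact
  have hV: "h (V (0, 0, i, j)) = X i j" "h (V (3, c, i, j)) = K c i j" "h (V (2, c, i, j)) = E c i j"
    for c i j
    unfolding h_def V_def by (simp_all only: eval_single_var[OF comm_ring_hom_of_int]) simp_all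
  have alt_skew: "alt f b a = - alt f a b" for f a b by (simp add: alt_def)
  have K'_skew: "K' c a b = - K' c b a" for c a b unfolding K'_def by (rule alt_skew)
  have hK: "h (K' c a b) = K c a b" for c a b
    using K(1)[of c b a] K(2)[of c a] by (auto simp: K'_def alt_def hV h.hom_uminus not_less_iff_gr_or_eq)
  have hE: "h (E' c i j) = E c i j" for c i j
    using low E(1)[of c j i] E(2)[of c i]
    by (auto simp: E'_def alt_def hV hK h.hom_uminus h.hom_sum h.hom_mult not_less_iff_gr_or_eq)
  have "(\<Sum>\<chi>\<in>C. \<Sum>p\<in>matching_nf \<mu>. col_term E' \<mu> \<chi> p) = 0"
  proof (rule sum_nf_low_rank_int[where L = L and n = n])
    fix c i j
    have "(\<Sum>a<n. \<Sum>b<n. V (0, 0, j, a) * K' c a b * V (0, 0, i, b)) =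
        (\<Sum>b<n. \<Sum>a<n. V (0, 0, j, a) * K' c a b * V (0, 0, i, b))" by (rule sum.swap)
    also have "\<dots> = (\<Sum>b<n. \<Sum>a<n. - (V (0, 0, i, b) * K' c b a * V (0, 0, j, a)))"
      by (intro sum.cong refl, subst K'_skew) (simp add: mult_ac)
    finally show "E' c j i = - E' c i j"
      by (auto simp: E'_def sum_negf intro: alt_skew)
  qed (use closed n in \<open>auto simp: E'_def\<close>)
  then have "h (\<Sum>\<chi>\<in>C. \<Sum>p\<in>matching_nf \<mu>. col_term E' \<mu> \<chi> p) = 0" by simp
  then show ?thesis by (simp add: h.hom_sum col_term_hom[OF hom] hE)
qed

text \<open>
  Functions on \<open>{..<\<mu>}\<close> with values in \<open>{0} \<union> B\<close>, made unique by a default value outside, that use the colour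
  0 exactly \<open>k\<close> times.
\<close>

definition colourings :: "nat \<Rightarrow> nat \<Rightarrow> nat set \<Rightarrow> (nat \<Rightarrow> nat) set" where
  "colourings \<mu> k B = {\<chi> \<in> {..<\<mu>} \<rightarrow>\<^sub>E insert 0 B. card {s\<in>{..<\<mu>}. \<chi> s = 0} = k}"

text \<open>
  The part of an expanded Pfaffian in which exactly \<open>k\<close> edges have the colour 0.
\<close>

definition pf_level :: "(nat \<Rightarrow> nat \<Rightarrow> nat \<Rightarrow> 'r::comm_ring_1) \<Rightarrow> nat \<Rightarrow> nat \<Rightarrow> nat set \<Rightarrow> 'r" where
  "pf_level E \<mu> k B = (\<Sum>\<chi>\<in>colourings \<mu> k B. \<Sum>p\<in>matching_nf \<mu>. col_term E \<mu> \<chi> p)"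

lemma sum_nf_prod_sum:
  assumes "\<And>s. finite (B s)"
  shows "(\<Sum>p\<in>P. of_int (sign p) * (\<Prod>s<\<mu>. \<Sum>c\<in>B s. E c (p (2 * s)) (p (2 * s + 1)))) =
    (\<Sum>\<chi>\<in>PiE {..<\<mu>} B. \<Sum>p\<in>P. col_term E \<mu> \<chi> p)"
proof -
  have "(\<Prod>s<\<mu>. \<Sum>c\<in>B s. E c (p (2 * s)) (p (2 * s + 1))) =
      (\<Sum>\<chi>\<in>PiE {..<\<mu>} B. \<Prod>s<\<mu>. E (\<chi> s) (p (2 * s)) (p (2 * s + 1)))" for p
    by (rule prod_sum_PiE) (use assms in auto)
  then show ?thesis
    by (subst sum.swap) (simp add: col_term_def sum_distrib_left)
qed

lemma finite_colourings:
  assumes "finite B"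
  shows "finite (colourings \<mu> k B)"
proof (rule finite_subset)
  show "colourings \<mu> k B \<subseteq> {..<\<mu>} \<rightarrow>\<^sub>E insert 0 B" by (auto simp: colourings_def)
  show "finite ({..<\<mu>} \<rightarrow>\<^sub>E insert 0 B)" by (rule finite_PiE) (use assms in auto)
qed

text \<open>
  Summing over all colours in \<open>B\<close> amounts to one edge form that is the sum of the forms in \<open>B\<close>. This is how the
  perturbed form \<open>N + \<delta>\<close> is split into two colours.
\<close>

lemma pf_level_eq:
  assumes B: "finite B" "0 \<notin> B"
  shows "pf_level E \<mu> k B = (\<Sum>T | T \<subseteq> {..<\<mu>} \<and> card T = k. \<Sum>p\<in>matching_nf \<mu>.
    of_int (sign p) * (\<Prod>s<\<mu>. if s \<in> T then E 0 (p (2 * s)) (p (2 * s + 1))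
      else \<Sum>c\<in>B. E c (p (2 * s)) (p (2 * s + 1))))"
proof -
  let ?D = "\<lambda>T s. if s \<in> T then {0} else B"
  have "pf_level E \<mu> k B = (\<Sum>T | T \<subseteq> {..<\<mu>} \<and> card T = k.
      \<Sum>\<chi>\<in>{\<chi>\<in>colourings \<mu> k B. {s\<in>{..<\<mu>}. \<chi> s = 0} = T}. \<Sum>p\<in>matching_nf \<mu>. col_term E \<mu> \<chi> p)"
    unfolding pf_level_def
    by (rule sum.group[symmetric], rule finite_colourings[OF B(1)], simp)
      (auto simp: colourings_def)
  also have "\<dots> = (\<Sum>T | T \<subseteq> {..<\<mu>} \<and> card T = k.
      \<Sum>\<chi>\<in>PiE {..<\<mu>} (?D T). \<Sum>p\<in>matching_nf \<mu>. col_term E \<mu> \<chi> p)"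
  proof (rule sum.cong[OF refl])
    fix T assume "T \<in> {T. T \<subseteq> {..<\<mu>} \<and> card T = k}"
    then have T: "T \<subseteq> {..<\<mu>}" "card T = k" by auto
    have "{\<chi>\<in>colourings \<mu> k B. {s\<in>{..<\<mu>}. \<chi> s = 0} = T} = PiE {..<\<mu>} (?D T)"
    proof (intro equalityI subsetI)
      fix \<chi> assume "\<chi> \<in> {\<chi>\<in>colourings \<mu> k B. {s\<in>{..<\<mu>}. \<chi> s = 0} = T}"
      then show "\<chi> \<in> PiE {..<\<mu>} (?D T)" by (auto simp: colourings_def PiE_iff)
    next
      fix \<chi> assume \<chi>: "\<chi> \<in> PiE {..<\<mu>} (?D T)"
      then have v: "\<chi> s \<in> ?D T s" if "s < \<mu>" for s using that by (auto simp: PiE_iff)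
      have "{s\<in>{..<\<mu>}. \<chi> s = 0} = T"
      proof (intro equalityI subsetI)
        fix s assume "s \<in> {s\<in>{..<\<mu>}. \<chi> s = 0}"
        then show "s \<in> T" using v[of s] B(2) by (cases "s \<in> T") auto
      next
        fix s assume "s \<in> T"
        then show "s \<in> {s\<in>{..<\<mu>}. \<chi> s = 0}" using v[of s] T(1) by auto
      qed
      moreover have "\<chi> \<in> {..<\<mu>} \<rightarrow>\<^sub>E insert 0 B"
        using v \<chi> unfolding PiE_iff by (metis insertCI lessThan_iff singletonD)
      ultimately show "\<chi> \<in> {\<chi>\<in>colourings \<mu> k B. {s\<in>{..<\<mu>}. \<chi> s = 0} = T}"
        using T(2) by (simp add: colourings_def)
    qed
    then show "(\<Sum>\<chi>\<in>{\<chi>\<in>colourings \<mu> k B. {s\<in>{..<\<mu>}. \<chi> s = 0} = T}. \<Sum>p\<in>matching_nf \<mu>. col_term E \<mu> \<chi> p) =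
        (\<Sum>\<chi>\<in>PiE {..<\<mu>} (?D T). \<Sum>p\<in>matching_nf \<mu>. col_term E \<mu> \<chi> p)" by simp
  qed
  also have "\<dots> = (\<Sum>T | T \<subseteq> {..<\<mu>} \<and> card T = k. \<Sum>p\<in>matching_nf \<mu>.
      of_int (sign p) * (\<Prod>s<\<mu>. \<Sum>c\<in>?D T s. E c (p (2 * s)) (p (2 * s + 1))))"
    by (intro sum.cong refl sum_nf_prod_sum[symmetric]) (use B in auto)
  also have "\<dots> = (\<Sum>T | T \<subseteq> {..<\<mu>} \<and> card T = k. \<Sum>p\<in>matching_nf \<mu>.
      of_int (sign p) * (\<Prod>s<\<mu>. if s \<in> T then E 0 (p (2 * s)) (p (2 * s + 1))
      else \<Sum>c\<in>B. E c (p (2 * s)) (p (2 * s + 1))))"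
    by (intro sum.cong refl arg_cong2[of _ _ _ _ "(*)"] prod.cong) auto
  finally show ?thesis .
qed

lemma colourings_comp_transpose:
  assumes \<chi>: "\<chi> \<in> colourings \<mu> k B" and s: "s < \<mu>" and t: "t < \<mu>"
  shows "\<chi> \<circ> transpose s t \<in> colourings \<mu> k B"
proof -
  have \<tau>: "transpose s t permutes {..<\<mu>}" using s t by (intro permutes_swap_id) auto
  have "{r\<in>{..<\<mu>}. (\<chi> \<circ> transpose s t) r = 0} = transpose s t ` {r\<in>{..<\<mu>}. \<chi> r = 0}"
    using s t by (auto simp: transpose_def image_iff)
  then have "card {r\<in>{..<\<mu>}. (\<chi> \<circ> transpose s t) r = 0} = card {r\<in>{..<\<mu>}. \<chi> r = 0}"
    by (simp only: card_image[OF permutes_inj_on[OF \<tau>]])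
  moreover have "\<chi> \<circ> transpose s t \<in> {..<\<mu>} \<rightarrow>\<^sub>E insert 0 B"
    using \<chi> s t by (auto simp: colourings_def PiE_iff extensional_def transpose_def)
  ultimately show ?thesis using \<chi> by (simp add: colourings_def)
qed

section \<open>The Pfaffian of the polar form and its reduction modulo 2\<close>

text \<open>
  The bilinear form \<open>N(u, v) = \<Sum>\<^sub>r y\<^sub>r(u) x\<^sub>r(v)\<close> on the \<open>i\<close>-th and \<open>j\<close>-th vector; its diagonal is the quadratic
  form \<open>q\<close> and its symmetrisation is the polar form of \<open>q\<close>.
\<close>

definition polar_half :: "nat \<Rightarrow> (nat \<Rightarrow> nat \<Rightarrow> 'r::comm_ring_1) \<Rightarrow> nat \<Rightarrow> nat \<Rightarrow> 'r" where
  "polar_half n X i j = (\<Sum>r<n div 2. X i (2 * r + 1) * X j (2 * r))"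

text \<open>
  Colour 0 is the standard alternating form \<open>M\<close>, colour 1 is the form \<open>\<delta>\<close> with matrix \<open>D\<close>, and all other colours
  stand for \<open>N\<close>. Only entries of \<open>N\<close> with \<open>i < j\<close> occur in the Pfaffian; the other ones are chosen so
  that the matrix is alternating.
\<close>

definition colour_forms ::
    "nat \<Rightarrow> (nat \<Rightarrow> nat \<Rightarrow> 'r::comm_ring_1) \<Rightarrow> (nat \<Rightarrow> nat \<Rightarrow> 'r) \<Rightarrow> nat \<Rightarrow> nat \<Rightarrow> nat \<Rightarrow> 'r" where
  "colour_forms n X D c i j =
     (if c = 0 then polar_half n X j i - polar_half n X i j
      else if c = 1 then \<Sum>a<n. \<Sum>b<n. X i a * D a b * X j b
      else if i < j then polar_half n X i j else if j < i then - polar_half n X j i else 0)"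

lemma sum_lessThan_double:
  fixes f :: "nat \<Rightarrow> 'a::comm_monoid_add"
  shows "(\<Sum>a<2 * k. f a) = (\<Sum>r<k. f (2 * r) + f (2 * r + 1))"
  by (induction k) (auto simp: algebra_simps)

lemma colour_forms_hom:
  assumes "comm_ring_hom h"
  shows "h (colour_forms n X D c i j) =
    colour_forms n (\<lambda>i c. h (X i c)) (\<lambda>a b. h (D a b)) c i j"
proof -
  interpret comm_ring_hom h by fact
  show ?thesis by (simp add: colour_forms_def polar_half_def hom_distribs)
qed

lemma colour_forms_0_low_rank:
  assumes "even n"
  shows "colour_forms n X D 0 i j = (\<Sum>a<n. \<Sum>b<n. X i a *
    (if even a \<and> b = a + 1 then 1 else if odd a \<and> a = b + 1 then - 1 else 0) * X j b)"
proof -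
  obtain k where k: "n = 2 * k" using assms by (elim evenE)
  let ?J = "\<lambda>a b. if even a \<and> b = a + 1 then 1 else if odd a \<and> a = b + 1 then - 1 else 0 :: 'a"
  have ev: "(\<Sum>b<n. X i (2 * r) * ?J (2 * r) b * X j b) = X i (2 * r) * X j (2 * r + 1)" if "r < k" for r
  proof -
    have "(\<Sum>b<n. X i (2 * r) * ?J (2 * r) b * X j b) =
        (\<Sum>b<n. if b = 2 * r + 1 then X i (2 * r) * X j (2 * r + 1) else 0)"
      by (intro sum.cong refl) simp
    then show ?thesis using that k by simp
  qed
  have od: "(\<Sum>b<n. X i (2 * r + 1) * ?J (2 * r + 1) b * X j b) = - (X i (2 * r + 1) * X j (2 * r))"
    if "r < k" for r
  proof -
    have "(\<Sum>b<n. X i (2 * r + 1) * ?J (2 * r + 1) b * X j b) =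
        (\<Sum>b<n. if b = 2 * r then - (X i (2 * r + 1) * X j (2 * r)) else 0)"
      by (intro sum.cong refl) simp
    then show ?thesis using that k by simp
  qed
  have "(\<Sum>a<n. \<Sum>b<n. X i a * ?J a b * X j b) =
      (\<Sum>r<k. X i (2 * r) * X j (2 * r + 1) + - (X i (2 * r + 1) * X j (2 * r)))"
    unfolding k sum_lessThan_double[of "\<lambda>a. \<Sum>b<2 * k. X i a * ?J a b * X j b"] unfolding k[symmetric]
    by (intro sum.cong refl arg_cong2[of _ _ _ _ "(+)"] ev od) auto
  then show ?thesis
    by (simp add: colour_forms_def polar_half_def k sum_subtractf sum.distrib sum_negf mult.commute)
qed

lemma sum_nf_colour_forms_eq_0:
  fixes X :: "nat \<Rightarrow> nat \<Rightarrow> 'r::comm_ring_1"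
  assumes n: "even n" and D: "\<And>a b. D b a = - D a b" "\<And>a. D a a = 0"
    and closed: "\<And>\<chi> s t. \<chi> \<in> C \<Longrightarrow> s < \<mu> \<Longrightarrow> t < \<mu> \<Longrightarrow> \<chi> \<circ> transpose s t \<in> C"
    and many: "\<And>\<chi>. \<chi> \<in> C \<Longrightarrow> n < 2 * card {s\<in>{..<\<mu>}. \<chi> s \<in> {0, 1}}"
  shows "(\<Sum>\<chi>\<in>C. \<Sum>p\<in>matching_nf \<mu>. col_term (colour_forms n X D) \<mu> \<chi> p) = 0"
proof (rule sum_nf_low_rank[where L = "{0, 1}" and n = n and X = X and K = "\<lambda>c a b.
    if c = 0 then if even a \<and> b = a + 1 then 1 else if odd a \<and> a = b + 1 then - 1 else 0 else D a b"])
  show "colour_forms n X D c i j = (\<Sum>a<n. \<Sum>b<n. X i a * (if c = 0 then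
      if even a \<and> b = a + 1 then 1 else if odd a \<and> a = b + 1 then - 1 else 0 else D a b) * X j b)"
    if "c \<in> {0, 1}" for c i j
    using that colour_forms_0_low_rank[OF n, of X D i j] by (auto simp: colour_forms_def[of n X D "Suc 0" i j])
  show "(if c = 0 then if even b \<and> a = b + 1 then 1 else if odd b \<and> b = a + 1 then - 1 else 0 else D b a) =
      - (if c = 0 then if even a \<and> b = a + 1 then 1 else if odd a \<and> a = b + 1 then - 1 else 0 else D a b)"
    for c :: nat and a b
    using D(1)[of b a] by auto
  show "colour_forms n X D c j i = - colour_forms n X D c i j" "colour_forms n X D c i i = 0"
    if "c \<notin> {0, 1}" for c i j
    using that by (auto simp: colour_forms_def)
  show "n < 2 * card {s\<in>{..<\<mu>}. \<chi> s \<in> {0, 1}}" if "\<chi> \<in> C" for \<chi>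
    by (rule many[OF that])
qed (simp_all add: D(2) closed)

text \<open>
  Every edge of colour 0 carries a form of rank at most \<open>n\<close>, so at most \<open>n div 2\<close> of them can occur.
\<close>

lemma pf_level_eq_0:
  fixes X :: "nat \<Rightarrow> nat \<Rightarrow> 'r::comm_ring_1"
  assumes n: "even n" and D: "\<And>a b. D b a = - D a b" "\<And>a. D a a = 0" and k: "n < 2 * k"
  shows "pf_level (colour_forms n X D) \<mu> k {2} = 0"
  unfolding pf_level_def
proof (rule sum_nf_colour_forms_eq_0[OF n D])
  fix \<chi> assume \<chi>: "\<chi> \<in> colourings \<mu> k {2}"
  then have "{s\<in>{..<\<mu>}. \<chi> s \<in> {0, 1}} = {s\<in>{..<\<mu>}. \<chi> s = 0}"
    by (auto simp: colourings_def PiE_iff)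
  then show "n < 2 * card {s\<in>{..<\<mu>}. \<chi> s \<in> {0, 1}}" using \<chi> k by (simp add: colourings_def)
qed (rule colourings_comp_transpose)

text \<open>
  With \<open>n div 2\<close> edges of colour 0, a single further edge of colour 1 exceeds the rank bound; so exactly the
  colourings without the colour 1 remain.
\<close>

lemma pf_level_perturb:
  fixes X :: "nat \<Rightarrow> nat \<Rightarrow> 'r::comm_ring_1"
  assumes n: "even n" and D: "\<And>a b. D b a = - D a b" "\<And>a. D a a = 0" and k: "n = 2 * k"
  shows "pf_level (colour_forms n X D) \<mu> k {1, 2} = pf_level (colour_forms n X D) \<mu> k {2}"
proof -
  let ?C = "{\<chi>\<in>colourings \<mu> k {1, 2}. \<exists>s<\<mu>. \<chi> s = 1}"
  let ?f = "\<lambda>\<chi>. \<Sum>p\<in>matching_nf \<mu>. col_term (colour_forms n X D) \<mu> \<chi> p"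
  have split: "colourings \<mu> k {1, 2} = ?C \<union> colourings \<mu> k {2}"
  proof (intro equalityI subsetI)
    fix \<chi> assume \<chi>: "\<chi> \<in> colourings \<mu> k {1, 2}"
    show "\<chi> \<in> ?C \<union> colourings \<mu> k {2}"
    proof (cases "\<exists>s<\<mu>. \<chi> s = 1")
      case False
      then have "\<chi> \<in> colourings \<mu> k {2}" using \<chi> by (fastforce simp: colourings_def PiE_iff)
      then show ?thesis by simp
    qed (use \<chi> in simp)
  next
    fix \<chi> assume "\<chi> \<in> ?C \<union> colourings \<mu> k {2}"
    moreover have "colourings \<mu> k {2} \<subseteq> colourings \<mu> k {1, 2}"
      unfolding colourings_def using PiE_mono[of "{..<\<mu>}" "\<lambda>_. {0, 2}" "\<lambda>_. {0, 1, 2}"] by blast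
    ultimately show "\<chi> \<in> colourings \<mu> k {1, 2}" by blast
  qed
  have fin: "finite ?C" "finite (colourings \<mu> k {2})"
    using finite_colourings[of "{1, 2}" \<mu> k] finite_colourings[of "{2}" \<mu> k] by auto
  have disj: "?C \<inter> colourings \<mu> k {2} = {}"
  proof -
    have "\<chi> s \<noteq> 1" if "\<chi> \<in> colourings \<mu> k {2}" "s < \<mu>" for \<chi> s
    proof -
      have "\<chi> \<in> {..<\<mu>} \<rightarrow>\<^sub>E insert 0 {2}" using that(1) unfolding colourings_def by blast
      from PiE_mem[OF this, of s] that(2) show ?thesis by auto
    qed
    then show ?thesis by blast
  qed
  have "sum ?f ?C = 0"
  proof (rule sum_nf_colour_forms_eq_0[OF n D])
    fix \<chi> s t assume \<chi>: "\<chi> \<in> ?C" and st: "s < \<mu>" "t < \<mu>"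
    from \<chi> obtain r where r: "r < \<mu>" "\<chi> r = 1" by auto
    then have "transpose s t r < \<mu>" "(\<chi> \<circ> transpose s t) (transpose s t r) = 1"
      using st by (auto simp: transpose_def)
    then show "\<chi> \<circ> transpose s t \<in> ?C"
      using colourings_comp_transpose[OF _ st, of \<chi>] \<chi> by blast
  next
    fix \<chi> assume \<chi>: "\<chi> \<in> ?C"
    then obtain r where r: "r < \<mu>" "\<chi> r = 1" by auto
    have "card {s\<in>{..<\<mu>}. \<chi> s = 0} < card {s\<in>{..<\<mu>}. \<chi> s \<in> {0, 1}}"
    proof (rule psubset_card_mono)
      have "r \<in> {s\<in>{..<\<mu>}. \<chi> s \<in> {0, 1}}" "r \<notin> {s\<in>{..<\<mu>}. \<chi> s = 0}" using r by simp_all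
      then show "{s\<in>{..<\<mu>}. \<chi> s = 0} \<subset> {s\<in>{..<\<mu>}. \<chi> s \<in> {0, 1}}" by blast
    qed simp
    then show "n < 2 * card {s\<in>{..<\<mu>}. \<chi> s \<in> {0, 1}}" using \<chi> k by (simp add: colourings_def)
  qed
  moreover have "sum ?f (colourings \<mu> k {1, 2}) = sum ?f ?C + sum ?f (colourings \<mu> k {2})"
    by (subst split) (rule sum.union_disjoint[OF fin disj])
  ultimately show ?thesis unfolding pf_level_def by (simp only: add_0)
qed

lemma pfaffian_B_mat:
  assumes "even m"
  shows "pfaffian (B_mat n m) = (\<Sum>p\<in>matching_nf (m div 2). of_int (sign p) *
    (\<Prod>s<m div 2. B_poly n (p (2 * s)) (p (2 * s + 1))))"
proof -
  define \<mu> where "\<mu> = m div 2"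
  have m: "m = 2 * \<mu>" using assms by (simp add: \<mu>_def)
  have nf: "{p. p permutes {..<2 * \<mu>} \<and> (\<forall>s<\<mu>. p (2 * s) < p (2 * s + 1)) \<and>
      (\<forall>s<\<mu>. \<forall>t<\<mu>. s < t \<longrightarrow> p (2 * s) < p (2 * t))} = matching_nf \<mu>"
    by (simp add: matching_nf_def)
  have dim: "dim_row (B_mat n m) div 2 = \<mu>" by (simp add: B_mat_def \<mu>_def)
  show ?thesis
    unfolding pfaffian_def Let_def dim nf \<mu>_def[symmetric]
  proof (intro sum.cong refl arg_cong2[of _ _ _ _ "(*)"] prod.cong)
    fix p s assume p: "p \<in> matching_nf \<mu>" and s: "s \<in> {..<\<mu>}"
    have "p (2 * s) < 2 * \<mu>" "p (2 * s + 1) < 2 * \<mu>"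
      using permutes_in_image[of p "{..<2 * \<mu>}" "2 * s"] permutes_in_image[of p "{..<2 * \<mu>}" "2 * s + 1"]
        p s by (auto simp: matching_nf_def)
    moreover have "p (2 * s) < p (2 * s + 1)" using p s by (simp add: matching_nf_def)
    ultimately show "B_mat n m $$ (p (2 * s), p (2 * s + 1)) = B_poly n (p (2 * s)) (p (2 * s + 1))"
      by (simp add: B_mat_def m)
  qed
qed

definition coords :: "nat \<Rightarrow> nat \<Rightarrow> 'a::comm_ring_1 mpoly" where
  "coords i c = Var (i, c)"

lemma B_poly_eq_colour_forms:
  assumes "i < j"
  shows "B_poly n i j = (\<Sum>c\<in>{0, 2}. (if c = 0 then 1 else 2) * colour_forms n coords D c i j)"
  using assms
  by (simp add: B_poly_def colour_forms_def polar_half_def coords_def sum.distrib algebra_simps)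

lemma pfaffian_levels:
  fixes D :: "nat \<Rightarrow> nat \<Rightarrow> int mpoly"
  assumes "even m"
  shows "pfaffian (B_mat n m) =
    (\<Sum>k\<le>m div 2. 2 ^ (m div 2 - k) * pf_level (colour_forms n coords D) (m div 2) k {2})"
proof -
  define \<mu> where "\<mu> = m div 2"
  let ?E = "colour_forms n coords D"
  let ?w = "\<lambda>c::nat. if c = 0 then 1 else 2 :: int mpoly"
  let ?P = "{..<\<mu>} \<rightarrow>\<^sub>E {0, 2 :: nat}"
  have finP: "finite ?P" by (rule finite_PiE) auto
  have weight: "col_term (\<lambda>c i j. ?w c * ?E c i j) \<mu> \<chi> p =
      2 ^ (\<mu> - card {s\<in>{..<\<mu>}. \<chi> s = 0}) * col_term ?E \<mu> \<chi> p" for \<chi> p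
  proof -
    have "(\<Prod>s<\<mu>. ?w (\<chi> s)) = (\<Prod>s\<in>{..<\<mu>} - {s\<in>{..<\<mu>}. \<chi> s = 0}. 2)"
      by (rule prod.mono_neutral_cong_right) auto
    also have "\<dots> = 2 ^ (\<mu> - card {s\<in>{..<\<mu>}. \<chi> s = 0})"
      unfolding prod_constant by (subst card_Diff_subset) auto
    finally show ?thesis unfolding col_term_def prod.distrib by (simp add: mult_ac)
  qed
  have card_le: "card {s\<in>{..<\<mu>}. \<chi> s = 0} \<le> \<mu>" for \<chi> :: "nat \<Rightarrow> nat"
    using card_mono[of "{..<\<mu>}" "{s\<in>{..<\<mu>}. \<chi> s = 0}"] by auto
  have "pfaffian (B_mat n m) = (\<Sum>p\<in>matching_nf \<mu>. of_int (sign p) *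
      (\<Prod>s<\<mu>. \<Sum>c\<in>{0, 2}. ?w c * ?E c (p (2 * s)) (p (2 * s + 1))))"
    unfolding pfaffian_B_mat[OF assms] \<mu>_def[symmetric]
    by (intro sum.cong refl arg_cong2[of _ _ _ _ "(*)"] prod.cong B_poly_eq_colour_forms)
      (auto simp: matching_nf_def)
  also have "\<dots> = (\<Sum>\<chi>\<in>?P. \<Sum>p\<in>matching_nf \<mu>. col_term (\<lambda>c i j. ?w c * ?E c i j) \<mu> \<chi> p)"
    by (rule sum_nf_prod_sum) simp
  also have "\<dots> = (\<Sum>k\<le>\<mu>. \<Sum>\<chi>\<in>{\<chi>\<in>?P. card {s\<in>{..<\<mu>}. \<chi> s = 0} = k}.
      \<Sum>p\<in>matching_nf \<mu>. col_term (\<lambda>c i j. ?w c * ?E c i j) \<mu> \<chi> p)"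
    by (rule sum.group[symmetric, OF finP]) (use card_le in auto)
  also have "\<dots> = (\<Sum>k\<le>\<mu>. 2 ^ (\<mu> - k) * pf_level ?E \<mu> k {2})"
    unfolding pf_level_def colourings_def weight sum_distrib_left
    by (intro sum.cong refl) auto
  finally show ?thesis unfolding \<mu>_def .
qed

text \<open>
  The terms with \<open>k\<close> edges of colour 0 carry the factor \<open>2 ^ (\<mu> - k)\<close>, and only \<open>k \<le> \<nu>\<close> contribute.
\<close>

lemma pfaffian_divisible:
  assumes n: "even n" and m: "even m" and nm: "n \<le> m"
  shows "\<exists>Z. pfaffian (B_mat n m) = 2 ^ (m div 2 - n div 2) *
    (pf_level (colour_forms n coords (\<lambda>_ _. 0)) (m div 2) (n div 2) {2} + 2 * Z)"
proof -
  define \<mu> \<nu> where "\<mu> = m div 2" and "\<nu> = n div 2"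
  have \<nu>: "\<nu> \<le> \<mu>" "n = 2 * \<nu>" using n m nm by (auto simp: \<mu>_def \<nu>_def)
  let ?P = "\<lambda>k. pf_level (colour_forms n coords (\<lambda>_ _. 0 :: int mpoly)) \<mu> k {2}"
  have "(\<Sum>k\<le>\<mu>. 2 ^ (\<mu> - k) * ?P k) = (\<Sum>k\<le>\<nu>. 2 ^ (\<mu> - k) * ?P k)"
  proof (rule sum.mono_neutral_right)
    show "\<forall>k\<in>{..\<mu>} - {..\<nu>}. 2 ^ (\<mu> - k) * ?P k = 0"
    proof
      fix k assume "k \<in> {..\<mu>} - {..\<nu>}"
      then have "?P k = 0" using \<nu> by (intro pf_level_eq_0[OF n]) auto
      then show "2 ^ (\<mu> - k) * ?P k = 0" by simp
    qed
  qed (use \<nu> in auto)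
  also have "\<dots> = 2 ^ (\<mu> - \<nu>) * ?P \<nu> + (\<Sum>k<\<nu>. 2 ^ (\<mu> - k) * ?P k)"
    by (simp add: lessThan_Suc_atMost[symmetric])
  also have "(\<Sum>k<\<nu>. 2 ^ (\<mu> - k) * ?P k) = (\<Sum>k<\<nu>. 2 ^ (\<mu> - \<nu>) * (2 * (2 ^ (\<nu> - k - 1) * ?P k)))"
  proof (intro sum.cong refl)
    fix k assume "k \<in> {..<\<nu>}"
    then have "\<mu> - k = (\<mu> - \<nu>) + Suc (\<nu> - k - 1)" using \<nu> by auto
    then show "2 ^ (\<mu> - k) * ?P k = 2 ^ (\<mu> - \<nu>) * (2 * (2 ^ (\<nu> - k - 1) * ?P k))"
      by (simp only: power_add power_Suc mult.assoc)
  qed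
  finally have "(\<Sum>k\<le>\<mu>. 2 ^ (\<mu> - k) * ?P k) =
      2 ^ (\<mu> - \<nu>) * (?P \<nu> + 2 * (\<Sum>k<\<nu>. 2 ^ (\<nu> - k - 1) * ?P k))"
    by (simp only: sum_distrib_left[symmetric] distrib_left)
  then show ?thesis
    unfolding pfaffian_levels[OF m, of n "\<lambda>_ _. 0"] \<mu>_def[symmetric] \<nu>_def[symmetric] by blast
qed

lemma lookup_power2_mult:
  "Poly_Mapping.lookup (2 ^ k * p) t = 2 ^ k * Poly_Mapping.lookup p t" for p :: "int mpoly"
proof -
  have "(2 :: int mpoly) ^ k = Poly_Mapping.single 0 (2 ^ k)"
    by (induction k) (simp_all add: single_numeral[symmetric] mult_single del: single_numeral)
  then show ?thesis by (simp add: mult_map_scale_conv_mult[symmetric] lookup_map)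
qed

lemma g_tilde_exact:
  assumes n: "even n" and m: "even m" and nm: "n \<le> m"
  shows "pfaffian (B_mat n m) = 2 ^ (m div 2 - n div 2) * g_tilde n m"
    and "\<exists>Z. g_tilde n m =
      pf_level (colour_forms n coords (\<lambda>_ _. 0)) (m div 2) (n div 2) {2} + 2 * Z"
proof -
  obtain Z where Z: "pfaffian (B_mat n m) = 2 ^ (m div 2 - n div 2) *
      (pf_level (colour_forms n coords (\<lambda>_ _. 0)) (m div 2) (n div 2) {2} + 2 * Z)"
    using pfaffian_divisible[OF assms] by blast
  have g: "g_tilde n m = pf_level (colour_forms n coords (\<lambda>_ _. 0)) (m div 2) (n div 2) {2} + 2 * Z"
    unfolding g_tilde_def Z by (rule poly_mapping_eqI) (simp add: lookup_map lookup_power2_mult)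
  show "pfaffian (B_mat n m) = 2 ^ (m div 2 - n div 2) * g_tilde n m" unfolding g Z ..
  show "\<exists>Z. g_tilde n m =
      pf_level (colour_forms n coords (\<lambda>_ _. 0)) (m div 2) (n div 2) {2} + 2 * Z" using g by blast
qed

lemma pf_level_hom:
  assumes "comm_ring_hom h"
  shows "h (pf_level E \<mu> k B) = pf_level (\<lambda>c i j. h (E c i j)) \<mu> k B"
proof -
  interpret comm_ring_hom h by fact
  show ?thesis by (simp add: pf_level_def hom_sum col_term_hom[OF assms])
qed

lemma two_eq_0:
  assumes "CHAR('k::comm_ring_1) = 2"
  shows "(2 :: 'k) = 0"
  using of_nat_CHAR[where 'a = 'k] assms by simp

lemma two_mpoly_eq_0:
  assumes "CHAR('k::comm_ring_1) = 2"
  shows "(2 :: 'k mpoly) = 0"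
proof -
  have "(2 :: 'k mpoly) = Poly_Mapping.single 0 2" by simp
  then show ?thesis by (simp only: two_eq_0[OF assms] single_zero)
qed

text \<open>
  Modulo 2 only the terms with the smallest power of 2 survive the division. There is no division left on
  the right-hand side, so the formula can be used over any ring of characteristic 2.
\<close>

lemma g_poly_eq_pf_level:
  assumes char: "CHAR('k::comm_ring_1) = 2" and n: "even n" and m: "even m" and nm: "n \<le> m"
  shows "(g_poly n m :: 'k mpoly) =
    pf_level (colour_forms n coords (\<lambda>_ _. 0)) (m div 2) (n div 2) {2}"
proof -
  have hom: "comm_ring_hom (Poly_Mapping.map of_int :: int mpoly \<Rightarrow> 'k mpoly)"
    by (rule comm_ring_hom_map[OF comm_ring_hom_of_int])
  interpret h: comm_ring_hom "Poly_Mapping.map of_int :: int mpoly \<Rightarrow> 'k mpoly" by (fact hom)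
  obtain Z where Z: "g_tilde n m =
      pf_level (colour_forms n coords (\<lambda>_ _. 0)) (m div 2) (n div 2) {2} + 2 * Z"
    using g_tilde_exact(2)[OF n m nm] by blast
  have two: "Poly_Mapping.map of_int (2 :: int mpoly) = (0 :: 'k mpoly)"
    using h.hom_numeral[of "num.Bit0 num.One"] two_mpoly_eq_0[OF char] by simp
  show ?thesis
    unfolding g_poly_def Z h.hom_add h.hom_mult two
    by (simp add: pf_level_hom[OF hom] colour_forms_hom[OF hom] coords_def[abs_def]
        map_Var[OF comm_ring_hom_of_int])
qed

section \<open>Invariance under the orthogonal group\<close>

text \<open>
  The matrix of the bilinear form \<open>N\<close> in the basis formed by the columns of the matrix \<open>a\<close>.
\<close>

definition half_gram :: "nat \<Rightarrow> (nat \<Rightarrow> nat \<Rightarrow> 'r::comm_ring_1) \<Rightarrow> nat \<Rightarrow> nat \<Rightarrow> 'r" where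
  "half_gram n a c d = (\<Sum>r<n div 2. a (2 * r + 1) c * a (2 * r) d)"

lemma polar_half_linear:
  fixes X Y :: "nat \<Rightarrow> nat \<Rightarrow> 'r::comm_ring_1"
  assumes "even n" and Y: "\<And>i c. c < n \<Longrightarrow> Y i c = (\<Sum>d<n. a c d * X i d)"
  shows "polar_half n Y i j = (\<Sum>c<n. \<Sum>d<n. X i c * half_gram n a c d * X j d)"
proof -
  have "polar_half n Y i j =
      (\<Sum>r<n div 2. \<Sum>c<n. \<Sum>d<n. X i c * (a (2 * r + 1) c * a (2 * r) d) * X j d)"
    unfolding polar_half_def
  proof (intro sum.cong refl)
    fix r assume "r \<in> {..<n div 2}"
    then have "2 * r + 1 < n" "2 * r < n" using \<open>even n\<close> by auto
    then have prod: "Y i (2 * r + 1) * Y j (2 * r) =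
        (\<Sum>c<n. a (2 * r + 1) c * X i c) * (\<Sum>d<n. a (2 * r) d * X j d)"
      by (simp only: Y)
    show "Y i (2 * r + 1) * Y j (2 * r) =
        (\<Sum>c<n. \<Sum>d<n. X i c * (a (2 * r + 1) c * a (2 * r) d) * X j d)"
      unfolding prod sum_product by (intro sum.cong refl) (simp only: mult_ac)
  qed
  also have "\<dots> = (\<Sum>c<n. \<Sum>r<n div 2. \<Sum>d<n. X i c * (a (2 * r + 1) c * a (2 * r) d) * X j d)"
    by (rule sum.swap)
  also have "\<dots> = (\<Sum>c<n. \<Sum>d<n. \<Sum>r<n div 2. X i c * (a (2 * r + 1) c * a (2 * r) d) * X j d)"
    by (intro sum.cong refl sum.swap)
  finally show ?thesis
    by (simp add: half_gram_def sum_distrib_left sum_distrib_right)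
qed

lemma quad_form_add:
  assumes "even n" and w: "\<And>c. c < n \<Longrightarrow> w $ c = a c i + a c j"
  shows "quad_form n w =
    half_gram n a i i + half_gram n a j j + (half_gram n a i j + half_gram n a j i)"
proof -
  have "quad_form n w =
      (\<Sum>r<n div 2. (a (2 * r) i + a (2 * r) j) * (a (2 * r + 1) i + a (2 * r + 1) j))"
    unfolding quad_form_def
  proof (intro sum.cong refl)
    fix r assume "r \<in> {..<n div 2}"
    then have "2 * r + 1 < n" "2 * r < n" using \<open>even n\<close> by auto
    then show "w $ (2 * r) * w $ (2 * r + 1) =
        (a (2 * r) i + a (2 * r) j) * (a (2 * r + 1) i + a (2 * r + 1) j)" by (simp only: w)
  qed
  then show ?thesis
    by (simp add: half_gram_def sum.distrib[symmetric] algebra_simps)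
qed

lemma quad_form_eq_half_gram:
  assumes "even n" and w: "\<And>c. c < n \<Longrightarrow> w $ c = a c i"
  shows "quad_form n w = half_gram n a i i"
  unfolding quad_form_def half_gram_def
proof (intro sum.cong refl)
  fix r assume "r \<in> {..<n div 2}"
  then have "2 * r + 1 < n" "2 * r < n" using \<open>even n\<close> by auto
  then show "w $ (2 * r) * w $ (2 * r + 1) = a (2 * r + 1) i * a (2 * r) i" by (simp only: w mult.commute)
qed

text \<open>
  Evaluating the quadratic form at unit vectors and at sums of two of them shows that the difference of the
  transformed and the original bilinear form \<open>N\<close> is alternating.
\<close>

lemma orthogonal_group_half_gram:
  assumes n: "even n" and A: "A \<in> orthogonal_group n" and i: "i < n" and j: "j < n"
  defines "a \<equiv> \<lambda>c d. A $$ (c, d)" and "e \<equiv> \<lambda>c d. of_bool (c = d)"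
  shows "half_gram n a i i = half_gram n e i i"
    and "half_gram n a i j + half_gram n a j i = half_gram n e i j + half_gram n e j i"
proof -
  have carr: "A \<in> carrier_mat n n" using A by (simp add: orthogonal_group_def)
  have q: "quad_form n (A *\<^sub>v v) = quad_form n v" if "v \<in> carrier_vec n" for v
    using A that by (simp add: orthogonal_group_def)
  have col: "(A *\<^sub>v unit_vec n k) $ c = a c k" if "c < n" "k < n" for c k
    using carr that by (simp add: a_def)
  have diag: "half_gram n a k k = half_gram n e k k" if "k < n" for k
  proof -
    have "half_gram n a k k = quad_form n (A *\<^sub>v unit_vec n k)"
      using col that by (intro quad_form_eq_half_gram[OF n, symmetric]) simp
    also have "\<dots> = quad_form n (unit_vec n k)" by (rule q) simp
    also have "\<dots> = half_gram n e k k"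
      using that by (intro quad_form_eq_half_gram[OF n]) (simp add: e_def)
    finally show ?thesis .
  qed
  show "half_gram n a i i = half_gram n e i i" by (rule diag[OF i])
  have "half_gram n a i i + half_gram n a j j + (half_gram n a i j + half_gram n a j i) =
      quad_form n (A *\<^sub>v (unit_vec n i + unit_vec n j))"
  proof (rule quad_form_add[OF n, symmetric])
    fix c assume "c < n"
    then show "(A *\<^sub>v (unit_vec n i + unit_vec n j)) $ c = a c i + a c j"
      using carr col[of c i] col[of c j] i j
      by (simp add: mult_add_distrib_mat_vec[OF carr] del: index_mult_mat_vec)
  qed
  also have "\<dots> = quad_form n (unit_vec n i + unit_vec n j)" by (rule q) simp
  also have "\<dots> = half_gram n e i i + half_gram n e j j + (half_gram n e i j + half_gram n e j i)"
    using i j by (intro quad_form_add[OF n]) (simp add: e_def)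
  finally show "half_gram n a i j + half_gram n a j i = half_gram n e i j + half_gram n e j i"
    using diag[OF i] diag[OF j] by simp
qed

lemma half_gram_hom:
  assumes "comm_ring_hom h"
  shows "h (half_gram n a c d) = half_gram n (\<lambda>c d. h (a c d)) c d"
proof -
  interpret comm_ring_hom h by fact
  show ?thesis by (simp add: half_gram_def hom_distribs)
qed

text \<open>
  The form \<open>\<delta>\<close> by which \<open>A\<close> changes \<open>N\<close> is alternating, hence symmetric in characteristic 2, so it drops out of
  \<open>M(u, v) = N(v, u) - N(u, v)\<close>. In the formula for \<open>g\<close> it therefore only affects the edges that carry \<open>N\<close>.
\<close>

lemma act_g_poly:
  assumes char: "CHAR('k::field) = 2" and n: "even n" and m: "even m" and nm: "n \<le> m"
    and A: "A \<in> orthogonal_group n"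
  shows "act n A (g_poly n m :: 'k mpoly) = g_poly n m"
proof -
  define \<mu> \<nu> where "\<mu> = m div 2" and "\<nu> = n div 2"
  define \<sigma> :: "nat \<times> nat \<Rightarrow> 'k mpoly"
    where "\<sigma> = (\<lambda>(i, c). \<Sum>d<n. Const (A $$ (c, d)) * Var (i, d))"
  define h where "h = eval_mpoly Const \<sigma>"
  have act: "act n A = h"
    unfolding act_def h_def \<sigma>_def by (rule subst_mpoly_eq_eval)
  have hom: "comm_ring_hom h" unfolding h_def by (rule comm_ring_hom_eval[OF comm_ring_hom_Const])
  interpret h: comm_ring_hom h by (fact hom)
  interpret C: comm_ring_hom "Const :: 'k \<Rightarrow> 'k mpoly" by (rule comm_ring_hom_Const)
  define a e :: "nat \<Rightarrow> nat \<Rightarrow> 'k" where "a = (\<lambda>c d. A $$ (c, d))" and "e = (\<lambda>c d. of_bool (c = d))"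
  define Y where "Y i c = h (coords i c)" for i c
  \<comment> \<open>The matrix of the alternating form by which \<open>A\<close> changes \<open>N\<close>.\<close>
  define D where "D c d = (if c < n \<and> d < n then Const (half_gram n a c d - half_gram n e c d) else 0)" for c d
  have Y: "Y i c = (\<Sum>d<n. Const (a c d) * coords i d)" for i c
    unfolding Y_def h_def coords_def eval_Var[OF comm_ring_hom_Const] by (simp add: \<sigma>_def a_def)
  have X: "coords i c = (\<Sum>d<n. Const (e c d) * coords i d)" if "c < n" for i c
    using that by (simp add: e_def C.hom_zero if_distrib[of "\<lambda>x. x * _"] of_bool_def
        if_distrib[of Const] cong: if_cong)
  have orth: "half_gram n a c c = half_gram n e c c"
    "half_gram n a c d + half_gram n a d c = half_gram n e c d + half_gram n e d c" if "c < n" "d < n" for c d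
    using orthogonal_group_half_gram[OF n A that] unfolding a_def e_def by auto
  have D_diag: "D c c = 0" for c using orth(1)[of c c] by (simp add: D_def)
  have D_skew: "D d c = - D c d" for c d
  proof (cases "c < n \<and> d < n")
    case True
    have "half_gram n a d c - half_gram n e d c = - (half_gram n a c d - half_gram n e c d)"
      using orth(2)[of c d] True by (simp add: algebra_simps)
    then show ?thesis using True by (simp add: D_def flip: C.hom_uminus)
  qed (auto simp: D_def)
  have D_sym: "D d c = D c d" for c d
  proof -
    have "D d c + D c d = 0" by (simp add: D_skew[of c d])
    moreover have "D c d + D c d = 0" using two_mpoly_eq_0[OF char] mult_2[of "D c d"] by simp
    ultimately show ?thesis by (metis add_right_cancel)
  qed
  have half: "polar_half n Y i j = polar_half n coords i j + colour_forms n coords D 1 i j" for i j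
  proof -
    have "polar_half n Y i j =
        (\<Sum>c<n. \<Sum>d<n. coords i c * half_gram n (\<lambda>c d. Const (a c d)) c d * coords j d)"
      by (rule polar_half_linear[OF n Y])
    moreover have "polar_half n coords i j =
        (\<Sum>c<n. \<Sum>d<n. coords i c * half_gram n (\<lambda>c d. Const (e c d)) c d * coords j d)"
      by (rule polar_half_linear[OF n X])
    moreover have "colour_forms n coords D 1 i j = (\<Sum>c<n. \<Sum>d<n. coords i c *
        (half_gram n (\<lambda>c d. Const (a c d)) c d - half_gram n (\<lambda>c d. Const (e c d)) c d) * coords j d)"
      by (simp add: colour_forms_def D_def C.hom_minus half_gram_hom[OF comm_ring_hom_Const])
    ultimately show ?thesis
      by (simp add: sum.distrib[symmetric] algebra_simps)
  qed
  have c1_sym: "colour_forms n coords D 1 j i = colour_forms n coords D 1 i j" for i j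
  proof -
    have "colour_forms n coords D 1 j i = (\<Sum>c<n. \<Sum>d<n. coords j c * D c d * coords i d)"
      by (simp add: colour_forms_def)
    also have "\<dots> = (\<Sum>d<n. \<Sum>c<n. coords j c * D c d * coords i d)" by (rule sum.swap)
    also have "\<dots> = (\<Sum>d<n. \<Sum>c<n. coords i d * D d c * coords j c)"
      by (intro sum.cong refl) (simp only: D_sym mult_ac)
    finally show ?thesis by (simp add: colour_forms_def)
  qed
  have c0: "colour_forms n Y (\<lambda>_ _. 0) 0 i j = colour_forms n coords D 0 i j" for i j
    using half[of i j] half[of j i] c1_sym[of i j] by (simp add: colour_forms_def[of _ _ _ 0])
  have c2: "colour_forms n Y (\<lambda>_ _. 0) 2 i j =
      colour_forms n coords D 1 i j + colour_forms n coords D 2 i j" if "i < j" for i j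
    using half[of i j] that by (simp add: colour_forms_def[of _ _ _ 2])
  have lt: "p (2 * s) < p (2 * s + 1)" if "p \<in> matching_nf \<mu>" "s \<in> {..<\<mu>}" for p s
    using that by (simp add: matching_nf_def)
  have g: "(g_poly n m :: 'k mpoly) = pf_level (colour_forms n coords (\<lambda>_ _. 0)) \<mu> \<nu> {2}"
    unfolding \<mu>_def \<nu>_def by (rule g_poly_eq_pf_level[OF char n m nm])
  have B: "finite {2::nat}" "0 \<notin> {2::nat}" "finite {1, 2::nat}" "0 \<notin> {1, 2::nat}" by auto
  have "h (g_poly n m) = pf_level (colour_forms n Y (\<lambda>_ _. 0)) \<mu> \<nu> {2}"
    unfolding g pf_level_hom[OF hom] colour_forms_hom[OF hom] by (simp add: Y_def[abs_def])
  also have "\<dots> = pf_level (colour_forms n coords D) \<mu> \<nu> {1, 2}"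
    unfolding pf_level_eq[OF B(1,2)] pf_level_eq[OF B(3,4)]
  proof (intro sum.cong refl arg_cong2[of _ _ _ _ "(*)"] prod.cong)
    fix T p s assume p: "p \<in> matching_nf \<mu>" and s: "s \<in> {..<\<mu>}"
    have "(\<Sum>c\<in>{2}. colour_forms n Y (\<lambda>_ _. 0) c (p (2 * s)) (p (2 * s + 1))) =
        (\<Sum>c\<in>{1, 2}. colour_forms n coords D c (p (2 * s)) (p (2 * s + 1)))"
      using c2[OF lt[OF p s]] by simp
    then show "(if s \<in> T then colour_forms n Y (\<lambda>_ _. 0) 0 (p (2 * s)) (p (2 * s + 1))
          else \<Sum>c\<in>{2}. colour_forms n Y (\<lambda>_ _. 0) c (p (2 * s)) (p (2 * s + 1))) =
        (if s \<in> T then colour_forms n coords D 0 (p (2 * s)) (p (2 * s + 1))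
          else \<Sum>c\<in>{1, 2}. colour_forms n coords D c (p (2 * s)) (p (2 * s + 1)))"
      by (simp only: c0)
  qed
  also have "\<dots> = pf_level (colour_forms n coords D) \<mu> \<nu> {2}"
    by (rule pf_level_perturb[OF n D_skew D_diag]) (use n in \<open>simp add: \<nu>_def\<close>)
  also have "\<dots> = g_poly n m"
  proof -
    have "colour_forms n coords D 0 = colour_forms n coords (\<lambda>_ _. 0) 0"
      "colour_forms n coords D 2 = colour_forms n coords (\<lambda>_ _. 0) 2"
      by (intro ext, simp add: colour_forms_def)+
    then show ?thesis unfolding g pf_level_eq[OF B(1,2)] by (simp cong: if_cong)
  qed
  finally show ?thesis by (simp add: act)
qed

section \<open>Multilinearity\<close>

text \<open>
  Linear in each of the vectors with index in \<open>I\<close> and independent of the other ones.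
\<close>

definition multilinear_in :: "nat \<Rightarrow> nat \<Rightarrow> nat set \<Rightarrow> 'a::comm_ring_1 mpoly \<Rightarrow> bool" where
  "multilinear_in n m I p \<longleftrightarrow> (\<forall>t\<in>Poly_Mapping.keys p. Poly_Mapping.keys t \<subseteq> {..<m} \<times> {..<n} \<and>
     (\<forall>i<m. (\<Sum>c<n. Poly_Mapping.lookup t (i, c)) = of_bool (i \<in> I)))"

lemma multilinear_in_add:
  assumes "multilinear_in n m I p" "multilinear_in n m I q"
  shows "multilinear_in n m I (p + q)"
  using assms keys_add[of p q] unfolding multilinear_in_def by blast

lemma multilinear_in_sum:
  assumes "\<And>x. x \<in> S \<Longrightarrow> multilinear_in n m I (f x)"
  shows "multilinear_in n m I (sum f S)"
  using assms
  by (induction S rule: infinite_finite_induct)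
    (auto intro: multilinear_in_add simp: multilinear_in_def[of _ _ _ 0])

lemma multilinear_in_mult:
  assumes p: "multilinear_in n m I p" and q: "multilinear_in n m J q" and disj: "I \<inter> J = {}"
  shows "multilinear_in n m (I \<union> J) (p * q)"
  unfolding multilinear_in_def
proof
  fix t assume "t \<in> Poly_Mapping.keys (p * q)"
  then obtain u v where uv: "u \<in> Poly_Mapping.keys p" "v \<in> Poly_Mapping.keys q" "t = u + v"
    using keys_mult[of p q] by blast
  have "Poly_Mapping.keys t \<subseteq> {..<m} \<times> {..<n}"
    using p q uv keys_add[of u v] unfolding multilinear_in_def by blast
  moreover have "(\<Sum>c<n. Poly_Mapping.lookup t (i, c)) = of_bool (i \<in> I \<union> J)" if "i < m" for i
  proof -
    have "(\<Sum>c<n. Poly_Mapping.lookup t (i, c)) = of_bool (i \<in> I) + of_bool (i \<in> J)"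
      using p q uv that by (simp add: multilinear_in_def lookup_add sum.distrib)
    then show ?thesis using disj by auto
  qed
  ultimately show "Poly_Mapping.keys t \<subseteq> {..<m} \<times> {..<n} \<and>
     (\<forall>i<m. (\<Sum>c<n. Poly_Mapping.lookup t (i, c)) = of_bool (i \<in> I \<union> J))" by blast
qed

lemma multilinear_in_Var:
  assumes "i < m" "c < n"
  shows "multilinear_in n m {i} (Var (i, c) :: 'a::comm_ring_1 mpoly)"
  using assms unfolding multilinear_in_def Var_def
  by (auto simp: lookup_single when_def)

lemma multilinear_in_prod:
  assumes "finite S" "\<And>s. s \<in> S \<Longrightarrow> multilinear_in n m (I s) (f s)"
    and "\<And>s t. s \<in> S \<Longrightarrow> t \<in> S \<Longrightarrow> s \<noteq> t \<Longrightarrow> I s \<inter> I t = {}"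
  shows "multilinear_in n m (\<Union>s\<in>S. I s) (prod f S)"
  using assms
proof (induction S rule: finite_induct)
  case empty
  show ?case by (simp add: multilinear_in_def)
next
  case (insert x S)
  have "multilinear_in n m (I x \<union> (\<Union>s\<in>S. I s)) (f x * prod f S)"
  proof (rule multilinear_in_mult)
    show "multilinear_in n m (\<Union>s\<in>S. I s) (prod f S)" using insert by blast
    show "I x \<inter> (\<Union>s\<in>S. I s) = {}" using insert.prems(2)[of x] insert.hyps(2) by blast
  qed (use insert in blast)
  then show ?case using insert.hyps by simp
qed

lemma multilinear_in_of_int_mult:
  assumes "multilinear_in n m I p"
  shows "multilinear_in n m I (of_int z * p)"
proof -
  have one: "multilinear_in n m {} (of_int z :: 'a mpoly)"
    by (simp add: multilinear_in_def flip: single_of_int)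
  show ?thesis using multilinear_in_mult[OF one assms] by simp
qed

lemma multilinear_in_B_poly:
  assumes "i < m" "j < m" "i \<noteq> j" "even n"
  shows "multilinear_in n m {i, j} (B_poly n i j)"
  unfolding B_poly_def
proof (rule multilinear_in_sum)
  fix r assume "r \<in> {..<n div 2}"
  then have r: "2 * r < n" "2 * r + 1 < n" using \<open>even n\<close> by auto
  have "{i} \<inter> {j} = {}" using \<open>i \<noteq> j\<close> by simp
  from multilinear_in_add[OF multilinear_in_mult[OF multilinear_in_Var multilinear_in_Var this]
      multilinear_in_mult[OF multilinear_in_Var multilinear_in_Var this], OF assms(1) r(1) assms(2) r(2)
      assms(1) r(2) assms(2) r(1)]
  show "multilinear_in n m {i, j}
      (Var (i, 2 * r) * Var (j, 2 * r + 1) + Var (i, 2 * r + 1) * Var (j, 2 * r))"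
    by (simp add: insert_commute)
qed

lemma multilinear_pfaffian:
  assumes n: "even n" and m: "even m"
  shows "multilinear_in n m {..<m} (pfaffian (B_mat n m))"
proof -
  define \<mu> where "\<mu> = m div 2"
  have \<mu>: "m = 2 * \<mu>" using m by (simp add: \<mu>_def)
  show ?thesis
    unfolding pfaffian_B_mat[OF m] \<mu>_def[symmetric]
  proof (intro multilinear_in_sum multilinear_in_of_int_mult)
    fix p assume p: "p \<in> matching_nf \<mu>"
    then have perm: "p permutes {..<m}" by (simp add: matching_nf_def \<mu>)
    let ?I = "\<lambda>s. {p (2 * s), p (2 * s + 1)}"
    have inj: "p a = p b \<longleftrightarrow> a = b" for a b using permutes_inj[OF perm] by (auto dest: injD)
    have "multilinear_in n m (\<Union>s\<in>{..<\<mu>}. ?I s) (\<Prod>s<\<mu>. B_poly n (p (2 * s)) (p (2 * s + 1)))"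
    proof (rule multilinear_in_prod)
      fix s assume "s \<in> {..<\<mu>}"
      then have "2 * s < m" "2 * s + 1 < m" by (auto simp: \<mu>)
      then show "multilinear_in n m (?I s) (B_poly n (p (2 * s)) (p (2 * s + 1)))"
        using permutes_in_image[OF perm] inj n by (intro multilinear_in_B_poly) auto
    next
      fix s t :: nat assume "s \<noteq> t"
      then show "?I s \<inter> ?I t = {}" by (simp add: inj)
    qed simp
    moreover have "(\<Union>s\<in>{..<\<mu>}. ?I s) = {..<m}"
    proof (intro equalityI subsetI)
      fix i assume "i \<in> {..<m}"
      then obtain k where k: "k < m" "i = p k" using permutes_image[OF perm] by blast
      then show "i \<in> (\<Union>s\<in>{..<\<mu>}. ?I s)"
        by (cases k rule: nat_parity_cases) (auto simp: \<mu>)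
    next
      fix i assume "i \<in> (\<Union>s\<in>{..<\<mu>}. ?I s)"
      then obtain s where s: "s < \<mu>" "i = p (2 * s) \<or> i = p (2 * s + 1)" by blast
      then have "2 * s \<in> {..<m}" "2 * s + 1 \<in> {..<m}" by (simp_all add: \<mu>)
      then show "i \<in> {..<m}"
        using s(2) permutes_in_image[OF perm, of "2 * s"] permutes_in_image[OF perm, of "2 * s + 1"] by metis
    qed
    ultimately show "multilinear_in n m {..<m} (\<Prod>s<\<mu>. B_poly n (p (2 * s)) (p (2 * s + 1)))" by simp
  qed
qed

lemma multilinear_g_poly:
  assumes "even n" "even m"
  shows "multilinear n m (g_poly n m :: 'k::comm_ring_1 mpoly)"
proof -
  have "Poly_Mapping.keys (g_poly n m :: 'k mpoly) \<subseteq> Poly_Mapping.keys (pfaffian (B_mat n m))"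
    by (auto simp: g_poly_def g_tilde_def in_keys_iff lookup_map)
  with multilinear_pfaffian[OF assms] have "multilinear_in n m {..<m} (g_poly n m :: 'k mpoly)"
    unfolding multilinear_in_def by blast
  then show ?thesis by (auto simp: multilinear_in_def multilinear_def poly_ring_def)
qed

section \<open>Parity of the number of matchings\<close>

text \<open>
  The fixed-point-free involution that sends a point to its partner in the matching of \<open>p\<close>. In contrast to
  the normal form, it can be conjugated by a transposition without any sorting.
\<close>

definition edge_map :: "(nat \<Rightarrow> nat) \<Rightarrow> nat \<Rightarrow> nat" where
  "edge_map p i = p (mate (inv_into UNIV p i))"

lemma edge_map_apply: "p permutes S \<Longrightarrow> edge_map p (p i) = p (mate i)"
  by (simp add: edge_map_def permutes_inverses)

lemma edge_map_involution: "p permutes S \<Longrightarrow> edge_map p (edge_map p i) = i"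
  by (simp add: edge_map_def permutes_inverses)

lemma edge_map_neq:
  assumes "p permutes S"
  shows "edge_map p i \<noteq> i"
proof
  assume "edge_map p i = i"
  then have "p (mate (inv_into UNIV p i)) = p (inv_into UNIV p i)"
    using permutes_inverses(1)[OF assms] by (simp add: edge_map_def)
  then have "mate (inv_into UNIV p i) = inv_into UNIV p i" using permutes_inj[OF assms] by (auto dest: injD)
  then show False by (cases "inv_into UNIV p i" rule: nat_parity_cases) simp_all
qed

lemma edge_map_id: "edge_map id = mate"
  by (rule ext) (simp add: edge_map_def)

lemma id_matching_nf: "id \<in> matching_nf \<mu>"
  by (simp add: matching_nf_def permutes_id)

lemma inj_on_edge_map: "inj_on edge_map (matching_nf \<mu>)"
proof (rule inj_onI)
  fix p q assume p: "p \<in> matching_nf \<mu>" and q: "q \<in> matching_nf \<mu>" and eq: "edge_map p = edge_map q"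
  have pp: "p permutes {..<2 * \<mu>}" and qp: "q permutes {..<2 * \<mu>}"
    using p q by (auto simp: matching_nf_def)
  define h where "h = inv_into UNIV p \<circ> q"
  have h: "h permutes {..<2 * \<mu>}" unfolding h_def by (rule permutes_compose[OF qp permutes_inv[OF pp]])
  have ph: "p \<circ> h = q" by (rule ext) (simp add: h_def permutes_inverses[OF pp])
  have "h (mate i) = mate (h i)" for i
  proof -
    have "p (mate (h i)) = edge_map p (q i)"
      by (simp add: edge_map_def h_def)
    also have "\<dots> = q (mate i)" unfolding eq by (rule edge_map_apply[OF qp])
    finally show ?thesis by (metis comp_apply h_def permutes_inv_eq[OF pp])
  qed
  then have "h = id" using matching_nf_unique[OF p _ h] q ph by simp
  then show "p = q" using ph by simp
qed

lemma edge_map_flip: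
  assumes "p permutes {..<2 * \<mu>}" "s < \<mu>"
  shows "edge_map (flip s \<circ> p) = flip s \<circ> edge_map p \<circ> flip s"
proof
  fix i
  have perm: "(flip s \<circ> p) permutes {..<2 * \<mu>}"
    by (rule permutes_compose[OF assms(1) flip_permutes[OF assms(2)]])
  have ff: "flip s (flip s i) = i" for i using flip_flip[of s] by (metis comp_apply id_apply)
  define k where "k = inv_into UNIV p (flip s i)"
  have k: "i = (flip s \<circ> p) k" by (simp add: k_def permutes_inverses[OF assms(1)] ff)
  have "edge_map (flip s \<circ> p) i = flip s (p (mate k))"
    unfolding k edge_map_apply[OF perm] by simp
  also have "\<dots> = (flip s \<circ> edge_map p \<circ> flip s) i"
    by (simp add: k_def edge_map_def)
  finally show "edge_map (flip s \<circ> p) i = (flip s \<circ> edge_map p \<circ> flip s) i" .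
qed

lemma edge_map_nf:
  assumes "p permutes {..<2 * \<mu>}"
  obtains q where "q \<in> matching_nf \<mu>" "edge_map q = edge_map p"
proof -
  obtain h where h: "h \<in> hyperoct \<mu>" "p \<circ> h \<in> matching_nf \<mu>"
    using matching_nf_exists[OF assms] by blast
  have perm: "(p \<circ> h) permutes {..<2 * \<mu>}" using h(2) by (simp add: matching_nf_def)
  have "edge_map (p \<circ> h) = edge_map p"
  proof
    fix i
    define k where "k = inv_into UNIV (p \<circ> h) i"
    have k: "i = p (h k)" using permutes_inverses(1)[OF perm, of i] by (simp add: k_def)
    have "edge_map (p \<circ> h) i = p (h (mate k))" by (simp add: edge_map_def k_def)
    also have "\<dots> = edge_map p i"
      unfolding k edge_map_apply[OF assms] by (simp add: hyperoct_mate[OF h(1)])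
    finally show "edge_map (p \<circ> h) i = edge_map p i" .
  qed
  then show ?thesis using that h(2) by blast
qed

lemma edge_map_eq_mateI:
  assumes p: "p permutes {..<2 * \<mu>}" and eq: "\<And>s. s < \<mu> \<Longrightarrow> edge_map p (2 * s) = 2 * s + 1"
  shows "edge_map p = mate"
proof
  fix i
  show "edge_map p i = mate i"
  proof (cases "i < 2 * \<mu>")
    case True
    show ?thesis
    proof (cases i rule: nat_parity_cases)
      case (even r)
      then show ?thesis using eq[of r] True by simp
    next
      case (odd r)
      then show ?thesis using eq[of r] True edge_map_involution[OF p, of "2 * r"] by simp
    qed
  next
    case False
    then have "mate i \<notin> {..<2 * \<mu>}" by (cases i rule: nat_parity_cases) auto
    moreover have "inv_into UNIV p i = i" using False permutes_inv[OF p] by (auto simp: permutes_def)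
    ultimately show ?thesis using p by (auto simp: edge_map_def permutes_def)
  qed
qed

text \<open>
  The number of perfect matchings all of whose edges stay inside a class of \<open>\<phi>\<close> is odd, provided that \<open>2 * s\<close>
  and \<open>2 * s + 1\<close> always belong to the same class. To see this, let \<open>s\<close> be the first index for which
  \<open>{2 * s, 2 * s + 1}\<close> is not an edge and exchange the partners of these two points. This is a
  fixed-point-free involution on all matchings in question except the standard one.
\<close>

lemma sum_1_matchings:
  fixes \<phi> :: "nat \<Rightarrow> 'b"
  assumes two: "(2 :: 'k::comm_ring_1) = 0"
  shows "(\<Sum>p\<in>{p\<in>matching_nf \<mu>. \<forall>s<\<mu>. \<phi> (p (2 * s) div 2) = \<phi> (p (2 * s + 1) div 2)}. (1 :: 'k)) = 1"
proof -
  define A where "A = {p\<in>matching_nf \<mu>. \<forall>s<\<mu>. \<phi> (p (2 * s) div 2) = \<phi> (p (2 * s + 1) div 2)}"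
  define F where "F = edge_map ` (A - {id})"
  define G where "G = {f. (\<exists>p. p permutes {..<2 * \<mu>} \<and> f = edge_map p) \<and>
     (\<forall>i<2 * \<mu>. \<phi> (f i div 2) = \<phi> (i div 2)) \<and> f \<noteq> mate}"
  have finA: "finite A" unfolding A_def using finite_matching_nf by simp
  have idA: "id \<in> A" by (simp add: A_def id_matching_nf)
  have FG: "F = G"
  proof (intro equalityI subsetI)
    fix f assume "f \<in> F"
    then obtain p where p: "p \<in> A" "p \<noteq> id" "f = edge_map p" by (auto simp: F_def)
    have nf: "p \<in> matching_nf \<mu>" using p(1) by (simp add: A_def)
    then have perm: "p permutes {..<2 * \<mu>}" by (simp add: matching_nf_def)
    have "f \<noteq> mate"
      using inj_onD[OF inj_on_edge_map _ nf id_matching_nf] p(2,3) edge_map_id by metis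
    moreover have "\<phi> (f i div 2) = \<phi> (i div 2)" if "i < 2 * \<mu>" for i
    proof -
      have "i \<in> p ` {..<2 * \<mu>}" unfolding permutes_image[OF perm] using that by simp
      then obtain k where k: "k < 2 * \<mu>" "i = p k" by blast
      have all: "\<phi> (p (2 * s) div 2) = \<phi> (p (2 * s + 1) div 2)" if "s < \<mu>" for s
        using p(1) that by (simp add: A_def)
      show ?thesis
        unfolding p(3) k(2) edge_map_apply[OF perm]
      proof (cases k rule: nat_parity_cases)
        case (even s)
        then show "\<phi> (p (mate k) div 2) = \<phi> (p k div 2)" using k(1) all[of s] by simp
      next
        case (odd s)
        then show "\<phi> (p (mate k) div 2) = \<phi> (p k div 2)" using k(1) all[of s] by simp
      qed
    qed
    ultimately show "f \<in> G" using perm p(3) unfolding G_def by blast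
  next
    fix f assume f: "f \<in> G"
    then obtain p where "p permutes {..<2 * \<mu>}" "f = edge_map p" by (auto simp: G_def)
    then obtain q where q: "q \<in> matching_nf \<mu>" "f = edge_map q" by (metis edge_map_nf)
    then have perm: "q permutes {..<2 * \<mu>}" by (simp add: matching_nf_def)
    have "\<phi> (q (2 * s) div 2) = \<phi> (q (2 * s + 1) div 2)" if "s < \<mu>" for s
    proof -
      have "q (2 * s) < 2 * \<mu>" using permutes_in_image[OF perm, of "2 * s"] that by simp
      then have "\<phi> (f (q (2 * s)) div 2) = \<phi> (q (2 * s) div 2)" using f by (simp add: G_def)
      then show ?thesis unfolding q(2) edge_map_apply[OF perm] by simp
    qed
    moreover have "q \<noteq> id" using f q(2) edge_map_id by (auto simp: G_def)
    ultimately show "f \<in> F" using q unfolding F_def A_def by blast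
  qed
  define \<kappa> where "\<kappa> f = (LEAST s. f (2 * s) \<noteq> 2 * s + 1)" for f :: "nat \<Rightarrow> nat"
  \<comment> \<open>Conjugation by the transposition of \<open>2 * s\<close> and \<open>2 * s + 1\<close>. It does not change the index \<open>s\<close>, since the
  edges before it are unaffected.\<close>
  define \<Theta> where "\<Theta> f = flip (\<kappa> f) \<circ> f \<circ> flip (\<kappa> f)" for f
  have ff: "flip s (flip s i) = i" for s i using flip_flip[of s] by (metis comp_apply id_apply)
  have fs: "flip s (2 * s) = 2 * s + 1" "flip s (2 * s + 1) = 2 * s" for s by (simp_all add: flip_def)
  have fo: "flip s i = i" if "i div 2 \<noteq> s" for s i using that by (auto simp: flip_def transpose_def)
  have fd: "flip s i div 2 = i div 2" for s i by (auto simp: flip_def transpose_def)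
  have step: "\<Theta> f \<in> G \<and> \<Theta> (\<Theta> f) = f \<and> \<Theta> f \<noteq> f" if f: "f \<in> G" for f
  proof -
    obtain p where p: "p permutes {..<2 * \<mu>}" "f = edge_map p" using f by (auto simp: G_def)
    have inv: "f (f i) = i" and neq: "f i \<noteq> i" for i
      unfolding p(2) by (rule edge_map_involution[OF p(1)], rule edge_map_neq[OF p(1)])
    define s where "s = \<kappa> f"
    obtain s' where s': "s' < \<mu>" "f (2 * s') \<noteq> 2 * s' + 1"
      using edge_map_eq_mateI[OF p(1)] f p(2) by (auto simp: G_def)
    have s: "f (2 * s) \<noteq> 2 * s + 1"
      unfolding s_def \<kappa>_def by (rule LeastI[where P = "\<lambda>s. f (2 * s) \<noteq> 2 * s + 1", OF s'(2)])
    have "s \<le> s'" unfolding s_def \<kappa>_def by (rule Least_le) (rule s'(2))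
    then have s_lt: "s < \<mu>" using s'(1) by simp
    have below: "f (2 * r) = 2 * r + 1" if "r < s" for r
      using not_less_Least[of r "\<lambda>s. f (2 * s) \<noteq> 2 * s + 1"] that unfolding s_def \<kappa>_def by blast
    have \<Theta>: "\<Theta> f = flip s \<circ> f \<circ> flip s" by (simp add: \<Theta>_def s_def)
    have b: "f (2 * s + 1) \<noteq> 2 * s" using s inv[of "2 * s + 1"] by metis
    have at: "\<Theta> f (2 * s) = f (2 * s + 1)"
    proof -
      have "f (2 * s + 1) div 2 \<noteq> s" using b neq[of "2 * s + 1"] by presburger
      then show ?thesis unfolding \<Theta> o_apply fs by (rule fo)
    qed
    have \<Theta>s: "\<Theta> f (2 * s) \<noteq> 2 * s + 1" unfolding at by (rule neq)
    have "\<Theta> f (2 * r) = 2 * r + 1" if "r < s" for r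
      unfolding \<Theta> o_apply using that by (simp add: fo below)
    then have "\<kappa> (\<Theta> f) = s"
      unfolding \<kappa>_def using \<Theta>s by (intro Least_equality) (auto simp: not_le[symmetric])
    then have "\<Theta> (\<Theta> f) = f"
      unfolding \<Theta>_def[of "\<Theta> f"] by (intro ext) (simp add: \<Theta> ff)
    moreover have ne: "\<Theta> f \<noteq> f"
    proof
      assume "\<Theta> f = f"
      then have "f (2 * s + 1) = f (2 * s)" using at by simp
      then have "2 * s + 1 = 2 * s" using inv by metis
      then show False by simp
    qed
    moreover have "\<Theta> f \<in> G"
    proof -
      have "\<Theta> f = edge_map (flip s \<circ> p)"
        unfolding edge_map_flip[OF p(1) s_lt] \<Theta> p(2)[symmetric] ..
      moreover have "(flip s \<circ> p) permutes {..<2 * \<mu>}"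
        by (rule permutes_compose[OF p(1) flip_permutes[OF s_lt]])
      moreover have "\<phi> (\<Theta> f i div 2) = \<phi> (i div 2)" if "i < 2 * \<mu>" for i
      proof -
        have "flip s i < 2 * \<mu>"
          using permutes_in_image[OF flip_permutes[OF s_lt], of i] that by simp
        then have "\<phi> (f (flip s i) div 2) = \<phi> (flip s i div 2)" using f by (simp add: G_def)
        then show ?thesis unfolding \<Theta> o_apply fd .
      qed
      moreover have "\<Theta> f \<noteq> mate" using \<Theta>s by (metis Suc_eq_plus1 mate_even)
      ultimately show ?thesis unfolding G_def by blast
    qed
    ultimately show ?thesis by blast
  qed
  have "(\<Sum>p\<in>A. (1 :: 'k)) = 1 + (\<Sum>p\<in>A - {id}. 1)"
    by (rule sum.remove[OF finA idA])
  also have "(\<Sum>p\<in>A - {id}. (1 :: 'k)) = (\<Sum>f\<in>F. 1)"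
    unfolding F_def
    by (subst sum.reindex) (auto intro: inj_on_subset[OF inj_on_edge_map] simp: A_def)
  also have "\<dots> = 0"
    unfolding FG by (rule sum_involution_eq_0[where h = \<Theta>]) (use step two in auto)
  finally show ?thesis by (simp add: A_def)
qed

section \<open>The value of the invariant at a special point\<close>

text \<open>
  The hyperbolic plane that contains the \<open>i\<close>-th vector of the special point. The last plane gets all vectors
  from \<open>n - 2\<close> on.
\<close>

definition block :: "nat \<Rightarrow> nat \<Rightarrow> nat" where
  "block n i = min (i div 2) (n div 2 - 1)"

text \<open>
  The special point \<open>(e\<^sub>1, w\<^sub>1, \<dots>, e\<^sub>\<nu>, w\<^sub>\<nu>, w\<^sub>\<nu>, \<dots>, w\<^sub>\<nu>)\<close>.
\<close>

definition special :: "nat \<Rightarrow> nat \<Rightarrow> nat \<Rightarrow> 'a::comm_ring_1" where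
  "special n i c = (if c = 2 * block n i \<or> c = 2 * block n i + 1 \<and> \<not> (even i \<and> i < n) then 1 else 0)"

lemma eval_B_poly_special:
  assumes n: "even n" "2 \<le> n" and ij: "i < j"
  shows "eval_mpoly (\<lambda>x. x) (\<lambda>(i, c). special n i c) (B_poly n i j) =
    (if block n i \<noteq> block n j then 0 else if i < n - 1 then 1 else 2 :: int)"
proof -
  let ?x = "special n :: nat \<Rightarrow> nat \<Rightarrow> int"
  obtain \<nu> where \<nu>: "n = 2 * \<nu>" "1 \<le> \<nu>" using n by (auto elim!: evenE)
  have half: "n div 2 = \<nu>" using \<nu> by simp
  interpret ev: comm_ring_hom "eval_mpoly (\<lambda>x. x) (\<lambda>(i, c). ?x i c)"
    by (rule comm_ring_hom_eval[OF comm_ring_hom_id])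
  have "eval_mpoly (\<lambda>x. x) (\<lambda>(i, c). ?x i c) (B_poly n i j) =
      (\<Sum>r<\<nu>. ?x i (2 * r) * ?x j (2 * r + 1) + ?x i (2 * r + 1) * ?x j (2 * r))"
    by (simp add: B_poly_def ev.hom_sum ev.hom_add ev.hom_mult eval_Var[OF comm_ring_hom_id] half)
  also have "\<dots> = (\<Sum>r<\<nu>. if r = block n i then
      (if block n i \<noteq> block n j then 0 else of_bool (\<not> (even j \<and> j < n)) + of_bool (\<not> (even i \<and> i < n))) else 0)"
    by (intro sum.cong refl) (auto simp: special_def)
  also have "\<dots> = (if block n i \<noteq> block n j then 0
      else of_bool (\<not> (even j \<and> j < n)) + of_bool (\<not> (even i \<and> i < n)))"
  proof -
    have "block n i < \<nu>" using \<nu> by (auto simp: block_def)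
    then show ?thesis by simp
  qed
  also have "\<dots> = (if block n i \<noteq> block n j then 0 else if i < n - 1 then 1 else 2)"
  proof (cases "block n i = block n j")
    case True
    have j: "\<not> (even j \<and> j < n)"
    proof
      assume j: "even j \<and> j < n"
      then obtain b where b: "j = 2 * b" by (auto elim: evenE)
      then have "block n j = b" "block n i < b" using j ij \<nu> by (auto simp: block_def)
      with True show False by simp
    qed
    have "even i \<and> i < n \<longleftrightarrow> i < n - 1"
    proof
      show "i < n - 1" if "even i \<and> i < n"
        using that \<nu> by presburger
      assume i: "i < n - 1"
      have "even i"
      proof (rule ccontr)
        assume "odd i"
        then obtain a where a: "i = 2 * a + 1" by (elim oddE)
        then have "block n i = a" "a < block n j" using i ij \<nu> by (auto simp: block_def)
        with True show False by simp
      qed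
      then show "even i \<and> i < n" using i by simp
    qed
    then show ?thesis using j True by auto
  qed simp
  finally show ?thesis .
qed

text \<open>
  The polar form vanishes between different planes, is 1 on \<open>(e\<^sub>r, w\<^sub>r)\<close> and 2 on two copies of \<open>w\<^sub>\<nu>\<close>. In a
  matching that respects the blocks, each of the \<open>\<nu>\<close> vectors \<open>e\<^sub>r\<close> is paired with a vector \<open>w\<^sub>r\<close>, so all the other
  \<open>\<mu> - \<nu>\<close> edges contribute a factor 2.
\<close>

lemma prod_special:
  assumes n: "even n" "2 \<le> n" and nm: "n \<le> 2 * \<mu>" and p: "p \<in> matching_nf \<mu>"
  shows "(\<Prod>s<\<mu>. if block n (p (2 * s)) \<noteq> block n (p (2 * s + 1)) then 0
      else if p (2 * s) < n - 1 then 1 else 2 :: int) =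
    (if \<forall>s<\<mu>. block n (p (2 * s)) = block n (p (2 * s + 1)) then 2 ^ (\<mu> - n div 2) else 0)"
proof (cases "\<forall>s<\<mu>. block n (p (2 * s)) = block n (p (2 * s + 1))")
  case False
  then obtain s where "s < \<mu>" "block n (p (2 * s)) \<noteq> block n (p (2 * s + 1))" by blast
  then have "(\<Prod>s<\<mu>. if block n (p (2 * s)) \<noteq> block n (p (2 * s + 1)) then 0
      else if p (2 * s) < n - 1 then 1 else 2 :: int) = 0"
    by (intro prod_zero) auto
  then show ?thesis using False by (simp only: if_False)
next
  case True
  obtain \<nu> where \<nu>: "n = 2 * \<nu>" "1 \<le> \<nu>" "\<nu> \<le> \<mu>" using n nm by (auto elim!: evenE)
  have lt: "p (2 * s) < p (2 * s + 1)" if "s < \<mu>" for s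
    using p that by (simp add: matching_nf_def)
  have perm: "p permutes {..<2 * \<mu>}" using p by (simp add: matching_nf_def)
  let ?S = "{s\<in>{..<\<mu>}. p (2 * s) < n - 1}"
  have firsts: "(\<lambda>s. p (2 * s)) ` ?S = (\<lambda>r. 2 * r) ` {..<\<nu>}"
  proof (intro equalityI subsetI)
    fix i assume "i \<in> (\<lambda>s. p (2 * s)) ` ?S"
    then obtain s where s: "s < \<mu>" "i = p (2 * s)" "i < n - 1" by auto
    show "i \<in> (\<lambda>r. 2 * r) ` {..<\<nu>}"
    proof (cases i rule: nat_parity_cases)
      case (even r)
      then show ?thesis using s(3) \<nu> by auto
    next
      case (odd r)
      then have "block n i = r" using s(3) \<nu> by (simp add: block_def)
      moreover have "r < block n (p (2 * s + 1))"
        using lt[OF s(1)] s(2,3) odd \<nu> by (auto simp: block_def)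
      ultimately show ?thesis using True s(1,2) by auto
    qed
  next
    fix i assume "i \<in> (\<lambda>r. 2 * r) ` {..<\<nu>}"
    then obtain r where r: "r < \<nu>" "i = 2 * r" by auto
    have "i \<in> p ` {..<2 * \<mu>}" unfolding permutes_image[OF perm] using r \<nu> by simp
    then obtain k where k: "k < 2 * \<mu>" "i = p k" by blast
    show "i \<in> (\<lambda>s. p (2 * s)) ` ?S"
    proof (cases k rule: nat_parity_cases)
      case (even s)
      then show ?thesis using k r \<nu> by auto
    next
      case (odd s)
      then have s: "s < \<mu>" "i = p (2 * s + 1)" using k by auto
      have "block n i = r" using r \<nu> by (simp add: block_def)
      moreover have "block n (p (2 * s)) < r" using lt[OF s(1)] s(2) r by (auto simp: block_def)
      ultimately show ?thesis using True s by auto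
    qed
  qed
  have inj: "inj_on (\<lambda>s. p (2 * s)) ?S"
  proof (rule inj_onI)
    fix s t assume "p (2 * s) = p (2 * t)"
    then show "s = t" using injD[OF permutes_inj[OF perm], of "2 * s" "2 * t"] by simp
  qed
  have "card ?S = card ((\<lambda>r. 2 * r) ` {..<\<nu>})"
    using card_image[OF inj] unfolding firsts by (rule sym)
  also have "\<dots> = \<nu>" by (subst card_image) (auto simp: inj_on_def)
  finally have card: "card ?S = \<nu>" .
  have "(\<Prod>s<\<mu>. if block n (p (2 * s)) \<noteq> block n (p (2 * s + 1)) then 0
      else if p (2 * s) < n - 1 then 1 else 2 :: int) = (\<Prod>s\<in>{..<\<mu>} - ?S. 2)"
    using True by (intro prod.mono_neutral_cong_right) auto
  also have "\<dots> = 2 ^ (\<mu> - card ?S)"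
    unfolding prod_constant by (subst card_Diff_subset) auto
  finally show ?thesis using True unfolding card by (simp add: \<nu>)
qed

lemma g_poly_special:
  assumes char: "CHAR('k::comm_ring_1) = 2" and n: "even n" "2 \<le> n" and m: "even m" and nm: "n \<le> m"
  shows "eval_mpoly (\<lambda>x. x) (\<lambda>(i, c). special n i c) (g_poly n m :: 'k mpoly) = 1"
proof -
  define \<mu> where "\<mu> = m div 2"
  have \<mu>: "m = 2 * \<mu>" using m by (simp add: \<mu>_def)
  define A where "A = {p\<in>matching_nf \<mu>. \<forall>s<\<mu>. block n (p (2 * s)) = block n (p (2 * s + 1))}"
  define ev where "ev = eval_mpoly (\<lambda>x. x) (\<lambda>(i, c). special n i c :: int)"
  have hom: "comm_ring_hom ev" unfolding ev_def by (rule comm_ring_hom_eval[OF comm_ring_hom_id])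
  interpret ev: comm_ring_hom ev by fact
  have B: "(\<Prod>s<\<mu>. ev (B_poly n (p (2 * s)) (p (2 * s + 1)))) =
      (if p \<in> A then 2 ^ (\<mu> - n div 2) else 0)" if p: "p \<in> matching_nf \<mu>" for p
  proof -
    have "(\<Prod>s<\<mu>. ev (B_poly n (p (2 * s)) (p (2 * s + 1)))) =
        (\<Prod>s<\<mu>. if block n (p (2 * s)) \<noteq> block n (p (2 * s + 1)) then 0
          else if p (2 * s) < n - 1 then 1 else 2)"
      unfolding ev_def
      by (intro prod.cong refl eval_B_poly_special n) (use p in \<open>simp add: matching_nf_def\<close>)
    also have "\<dots> = (if p \<in> A then 2 ^ (\<mu> - n div 2) else 0)"
      using prod_special[OF n _ p] nm p unfolding \<mu> A_def by simp
    finally show ?thesis .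
  qed
  have "2 ^ (\<mu> - n div 2) * ev (g_tilde n m) = ev (pfaffian (B_mat n m))"
    unfolding g_tilde_exact(1)[OF n(1) m nm] \<mu>_def[symmetric]
    by (simp add: ev.hom_mult ev.hom_power ev.hom_numeral)
  also have "\<dots> = (\<Sum>p\<in>matching_nf \<mu>. sign p * (\<Prod>s<\<mu>. ev (B_poly n (p (2 * s)) (p (2 * s + 1)))))"
    unfolding pfaffian_B_mat[OF m] \<mu>_def[symmetric]
    by (simp add: ev.hom_sum ev.hom_mult ev.hom_of_int ev.hom_prod)
  also have "\<dots> = (\<Sum>p\<in>matching_nf \<mu>. if p \<in> A then 2 ^ (\<mu> - n div 2) * sign p else 0)"
    by (rule sum.cong[OF refl], subst B) simp_all
  also have "\<dots> = (\<Sum>p\<in>A. 2 ^ (\<mu> - n div 2) * sign p)"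
    unfolding A_def by (intro sum.mono_neutral_cong_right finite_matching_nf) auto
  finally have gt: "ev (g_tilde n m) = (\<Sum>p\<in>A. sign p)"
    by (simp flip: sum_distrib_left)
  have pt: "(\<lambda>(i, c). special n i c :: 'k) = (\<lambda>v. of_int (case v of (i, c) \<Rightarrow> special n i c))"
    by (auto simp: special_def)
  have "eval_mpoly (\<lambda>x. x) (\<lambda>(i, c). special n i c) (g_poly n m :: 'k mpoly) =
      eval_mpoly of_int (\<lambda>(i, c). special n i c) (g_tilde n m)"
    unfolding g_poly_def by (rule eval_map[OF comm_ring_hom_of_int])
  also have "\<dots> = of_int (ev (g_tilde n m))"
    unfolding ev_def pt by (rule hom_eval_mpoly[OF comm_ring_hom_of_int, symmetric])
  also have "\<dots> = (\<Sum>p\<in>A. of_int (sign p))" unfolding gt by simp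
  also have "\<dots> = (\<Sum>p\<in>A. 1)"
  proof (intro sum.cong refl)
    fix p
    have "(- 1 :: 'k) = 1" using two_eq_0[OF char] by (metis add.inverse_unique one_add_one)
    then show "of_int (sign p) = (1 :: 'k)" by (simp add: sign_def)
  qed
  also have "\<dots> = 1"
    unfolding A_def block_def
    by (rule sum_1_matchings[OF two_eq_0[OF char], where \<phi> = "\<lambda>a. min a (n div 2 - 1)"])
  finally show ?thesis .
qed

section \<open>Reflections and functionals invariant under them\<close>

definition basis_vec :: "nat \<Rightarrow> nat \<Rightarrow> 'a::comm_ring_1" where
  "basis_vec k c = of_bool (c = k)"

definition quad :: "nat \<Rightarrow> (nat \<Rightarrow> 'a::comm_ring_1) \<Rightarrow> 'a" where
  "quad n x = (\<Sum>r<n div 2. x (2 * r) * x (2 * r + 1))"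

text \<open>
  The polar form of the quadratic form: \<open>mate\<close> exchanges the coordinates of each hyperbolic pair.
\<close>

definition polar :: "nat \<Rightarrow> (nat \<Rightarrow> 'a::comm_ring_1) \<Rightarrow> (nat \<Rightarrow> 'a) \<Rightarrow> 'a" where
  "polar n x y = (\<Sum>c<n. x (mate c) * y c)"

text \<open>
  The orthogonal reflection in a vector \<open>a\<close> with \<open>q(a) = 1\<close>, in the form it takes in characteristic 2.
\<close>

definition reflect :: "nat \<Rightarrow> (nat \<Rightarrow> 'a::comm_ring_1) \<Rightarrow> (nat \<Rightarrow> 'a) \<Rightarrow> nat \<Rightarrow> 'a" where
  "reflect n a x c = x c + polar n x a * a c"

lemma polar_eq:
  assumes "even n"
  shows "polar n x y = (\<Sum>r<n div 2. x (2 * r + 1) * y (2 * r) + x (2 * r) * y (2 * r + 1))"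
proof -
  obtain k where "n = 2 * k" using assms by (elim evenE)
  then show ?thesis by (simp add: polar_def sum_lessThan_double)
qed

lemma quad_add:
  assumes "even n"
  shows "quad n (\<lambda>c. x c + y c) = quad n x + quad n y + polar n x y"
  unfolding polar_eq[OF assms] quad_def by (simp add: sum.distrib[symmetric] algebra_simps)

lemma quad_scale: "quad n (\<lambda>c. b * x c) = b\<^sup>2 * quad n x"
  by (simp add: quad_def sum_distrib_left power2_eq_square mult_ac)

lemma polar_self:
  assumes "even n" "(2 :: 'a::comm_ring_1) = 0"
  shows "polar n x x = (0 :: 'a)"
proof -
  have "x (2 * r + 1) * x (2 * r) + x (2 * r) * x (2 * r + 1) = 0" for r
    using assms(2) mult_2[of "x (2 * r) * x (2 * r + 1)"] by (simp add: mult.commute)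
  then show ?thesis unfolding polar_eq[OF assms(1)] by simp
qed

lemma polar_add_right: "polar n x (\<lambda>c. y c + z c) = polar n x y + polar n x z"
  by (simp add: polar_def algebra_simps sum.distrib)

lemma polar_scale_right: "polar n x (\<lambda>c. b * y c) = b * polar n x y"
  by (simp add: polar_def sum_distrib_left mult_ac)

lemma polar_basis_right: "k < n \<Longrightarrow> polar n x (basis_vec k) = x (mate k)"
  by (simp add: polar_def basis_vec_def of_bool_def if_distrib[of "\<lambda>y. _ * y"] cong: if_cong)

lemma quad_basis: "quad n (basis_vec k) = 0"
  unfolding quad_def basis_vec_def by (intro sum.neutral) auto

text \<open>
  The matrix \<open>R\<close> is its own inverse, since \<open>a\<close> is orthogonal to itself and \<open>2 = 0\<close>.
\<close>

lemma reflection_orthogonal: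
  fixes a :: "nat \<Rightarrow> 'k::field"
  assumes n: "even n" and two: "(2 :: 'k) = 0" and a: "quad n a = 1"
  defines "R \<equiv> mat n n (\<lambda>(c, d). of_bool (c = d) + a c * a (mate d))"
  shows "R \<in> orthogonal_group n"
    and "c < n \<Longrightarrow> (\<Sum>d<n. R $$ (c, d) * x d) = reflect n a x c"
proof -
  have mate_lt: "mate d < n \<longleftrightarrow> d < n" for d
    using n by (cases d rule: nat_parity_cases) (auto elim!: evenE)
  have polar': "(\<Sum>d<n. a (mate d) * x d) = polar n x a" for x
    unfolding polar_def
    by (rule sum.reindex_bij_witness[where i = mate and j = mate]) (auto simp: mate_lt mult.commute)
  have delta: "(\<Sum>d<n. (of_bool (c = d) + a c * a (mate d)) * x d) = reflect n a x c" if "c < n" for c x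
  proof -
    have "(\<Sum>d<n. (of_bool (c = d) + a c * a (mate d)) * x d) =
        (\<Sum>d<n. if d = c then x d else 0) + (\<Sum>d<n. a c * (a (mate d) * x d))"
      unfolding sum.distrib[symmetric] by (intro sum.cong refl) (simp add: algebra_simps)
    also have "\<dots> = reflect n a x c"
      unfolding sum_distrib_left[symmetric] polar' reflect_def using that by simp
    finally show ?thesis .
  qed
  show action: "(\<Sum>d<n. R $$ (c, d) * x d) = reflect n a x c" if "c < n" for c x
    unfolding delta[OF that, symmetric] R_def using that by (intro sum.cong refl) simp
  have carr: "R \<in> carrier_mat n n" by (simp add: R_def)
  have aa: "polar n a a = 0" by (rule polar_self[OF n two])
  have RR: "R * R = 1\<^sub>m n"
  proof (rule eq_matI)
    fix c d assume "c < dim_row (1\<^sub>m n)" "d < dim_col (1\<^sub>m n)"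
    then have cd: "c < n" "d < n" by auto
    have ad: "polar n (\<lambda>c. R $$ (c, d)) a = a (mate d)"
    proof -
      have "polar n (\<lambda>c. R $$ (c, d)) a = (\<Sum>e<n. a (mate e) * (of_bool (e = d) + a e * a (mate d)))"
        unfolding polar'[symmetric] by (intro sum.cong refl) (use cd in \<open>simp add: R_def\<close>)
      also have "\<dots> = (\<Sum>e<n. if e = d then a (mate e) else 0) + (\<Sum>e<n. a (mate e) * a e) * a (mate d)"
        unfolding sum_distrib_right sum.distrib[symmetric]
        by (intro sum.cong refl) (simp add: algebra_simps)
      also have "(\<Sum>e<n. a (mate e) * a e) = polar n a a" by (rule polar')
      finally show ?thesis using aa cd by simp
    qed
    have "(R * R) $$ (c, d) = (\<Sum>e<n. R $$ (c, e) * R $$ (e, d))"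
      using cd carr by (simp add: scalar_prod_def atLeast0LessThan)
    also have "\<dots> = R $$ (c, d) + a (mate d) * a c"
      unfolding action[OF cd(1)] by (simp add: reflect_def ad)
    also have "\<dots> = of_bool (c = d) + 2 * (a c * a (mate d))"
      using cd unfolding R_def mult_2 by (simp add: algebra_simps)
    finally show "(R * R) $$ (c, d) = 1\<^sub>m n $$ (c, d)" using cd two by simp
  qed (use carr in auto)
  have "invertible_mat R"
    unfolding invertible_mat_def inverts_mat_def using carr RR by auto
  moreover have "quad_form n (R *\<^sub>v v) = quad_form n v" if v: "v \<in> carrier_vec n" for v
  proof -
    have Rv: "(R *\<^sub>v v) $ c = reflect n a (\<lambda>c. v $ c) c" if "c < n" for c
      using v carr that action[OF that, of "\<lambda>c. v $ c"]
      by (simp add: scalar_prod_def atLeast0LessThan)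
    let ?b = "polar n (\<lambda>c. v $ c) a"
    have "quad_form n (R *\<^sub>v v) = quad n (reflect n a (\<lambda>c. v $ c))"
      unfolding quad_form_def quad_def using n by (intro sum.cong refl) (auto simp: Rv)
    also have "reflect n a (\<lambda>c. v $ c) = (\<lambda>c. v $ c + ?b * a c)"
      by (rule ext) (simp add: reflect_def)
    also have "quad n \<dots> = quad n (\<lambda>c. v $ c) + 2 * ?b\<^sup>2"
      by (simp add: quad_add[OF n] quad_scale polar_scale_right a power2_eq_square)
    finally show ?thesis using two by (simp add: quad_def quad_form_def)
  qed
  ultimately show "R \<in> orthogonal_group n" using carr by (simp add: orthogonal_group_def)
qed

text \<open>
  What remains of an invariant after its part that is multilinear in the vectors with index in \<open>J\<close> has been
  isolated: a function of these vectors, linear in each of them, and invariant under reflections. These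
  properties suffice for all vanishing statements below.
\<close>

locale reflection_invariant =
  fixes n :: nat and J :: "nat set" and F :: "(nat \<Rightarrow> nat \<Rightarrow> 'k::field) \<Rightarrow> 'k"
  assumes even: "even n" and two: "(2 :: 'k) = 0"
    and locality: "\<And>v v'. (\<And>i. i \<in> J \<Longrightarrow> v i = v' i) \<Longrightarrow> F v = F v'"
    and linear: "\<And>v j x y b d. j \<in> J \<Longrightarrow>
      F (v(j := \<lambda>c. b * x c + d * y c)) = b * F (v(j := x)) + d * F (v(j := y))"
    and reflection: "\<And>a v. quad n a = 1 \<Longrightarrow> F (\<lambda>i. reflect n a (v i)) = F v"
begin

lemma add:
  assumes "j \<in> J"
  shows "F (v(j := \<lambda>c. x c + y c)) = F (v(j := x)) + F (v(j := y))"
  using linear[OF assms, of v 1 x 1 y] by simp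

lemma scale:
  assumes "j \<in> J"
  shows "F (v(j := \<lambda>c. b * x c)) = b * F (v(j := x))"
  using linear[OF assms, of v b x 0 x] by simp

lemma double_eq_0: "x + x = (0 :: 'k)"
  using two mult_2[of x] by simp

definition e where "e r = (basis_vec (2 * r) :: nat \<Rightarrow> 'k)"
definition f where "f r = (basis_vec (2 * r + 1) :: nat \<Rightarrow> 'k)"
definition w where "w r = (\<lambda>c. e r c + f r c)"

lemma polar_e: "r < n div 2 \<Longrightarrow> polar n x (e r) = x (2 * r + 1)"
  unfolding e_def by (subst polar_basis_right) auto

lemma polar_f: "r < n div 2 \<Longrightarrow> polar n x (f r) = x (2 * r)"
  unfolding f_def using even by (subst polar_basis_right) auto

lemma polar_w: "r < n div 2 \<Longrightarrow> polar n x (w r) = x (2 * r) + x (2 * r + 1)"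
  by (simp add: w_def polar_add_right polar_e polar_f)

lemma coord_values:
  "e r (2 * s) = of_bool (r = s)" "e r (2 * s + 1) = 0"
  "f r (2 * s) = 0" "f r (2 * s + 1) = of_bool (r = s)"
  "w r (2 * s) = of_bool (r = s)" "w r (2 * s + 1) = of_bool (r = s)"
  by (auto simp: e_def f_def w_def basis_vec_def) presburger+

lemma quad_w: "r < n div 2 \<Longrightarrow> quad n (w r) = 1"
  unfolding w_def quad_add[OF even] polar_f by (simp add: polar_f coord_values) (simp add: e_def f_def quad_basis)

lemma reflect_w_e:
  assumes "r < n div 2"
  shows "reflect n (w r) (e r) = f r"
proof
  fix c
  have p: "polar n (e r) (w r) = 1" unfolding polar_w[OF assms] by (simp only: coord_values) simp
  have "reflect n (w r) (e r) c = (e r c + e r c) + f r c"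
    unfolding reflect_def p by (simp add: w_def algebra_simps)
  then show "reflect n (w r) (e r) c = f r c" using double_eq_0 by simp
qed

text \<open>
  If the reflection in \<open>w\<^sub>r\<close> fixes all vectors that matter, and one of them is \<open>w\<^sub>r = e\<^sub>r + f\<^sub>r\<close> itself, then the
  reflection exchanges the two summands of the value. In characteristic 2 they cancel.
\<close>

lemma eq_0_of_w:
  assumes j: "j \<in> J" and r: "r < n div 2" and vj: "v j = w r"
    and orth: "\<And>i. i \<in> J \<Longrightarrow> v i (2 * r) + v i (2 * r + 1) = 0"
  shows "F v = 0"
proof -
  have "v(j := \<lambda>c. e r c + f r c) = v" by (rule fun_upd_idem) (simp only: vj w_def)
  then have sum: "F v = F (v(j := e r)) + F (v(j := f r))"
    using add[OF j, of v "e r" "f r"] by simp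
  have "F (v(j := e r)) = F (\<lambda>i. reflect n (w r) ((v(j := e r)) i))"
    by (rule reflection[OF quad_w[OF r], symmetric])
  also have "\<dots> = F (v(j := f r))"
  proof (rule locality)
    fix i assume i: "i \<in> J"
    show "reflect n (w r) ((v(j := e r)) i) = (v(j := f r)) i"
    proof (cases "i = j")
      case True
      then show ?thesis by (simp add: reflect_w_e[OF r])
    next
      case False
      then show ?thesis using orth[OF i] by (auto simp: reflect_def polar_w[OF r])
    qed
  qed
  finally show ?thesis unfolding sum by (simp only: double_eq_0)
qed

text \<open>
  Let \<open>e, f, w\<close> be the vectors of the plane \<open>t\<close> and \<open>e', f'\<close> those of the plane \<open>r\<close>, which contains none of the
  given vectors. The products of two reflections in the plane \<open>r\<close> contain a torus that scales \<open>e'\<close> and \<open>f'\<close>, so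
  the value is 0 whenever one of the first two arguments is \<open>e'\<close> or \<open>f'\<close> and the other one is \<open>e\<close>, \<open>f\<close> or \<open>w\<close>,
  and also if both are \<open>e'\<close>. It is 0 at \<open>(e', f')\<close> by \<open>eq_0_of_w\<close>, because a third argument is \<open>w\<close>. Now apply the reflection in
  \<open>w + e'\<close>, which fixes \<open>w\<close>, to the arguments \<open>(e, f')\<close>, where the value is 0. The result is the value at
  \<open>(f + e', f' + e' + w)\<close>, in which all terms but the one at \<open>(f, w)\<close> are known to be 0. So that one is
  0 too, and the reflection in \<open>w\<close> carries it to \<open>(e, w)\<close>.
\<close>

lemma eq_0_of_large_block:
  assumes t: "t < n div 2" and r: "r < n div 2" and tr: "t \<noteq> r"
    and c: "(b :: 'k) * b' = 1" "b'\<^sup>2 \<noteq> 1" "b' ^ 4 \<noteq> 1"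
    and j: "j0 \<in> J" "j1 \<in> J" "j2 \<in> J" "j0 \<noteq> j1" "j0 \<noteq> j2" "j1 \<noteq> j2"
    and v: "v j0 = e t" "v j1 = w t" "v j2 = w t"
    and other: "\<And>i. i \<in> J \<Longrightarrow> i \<noteq> j0 \<Longrightarrow> i \<noteq> j1 \<Longrightarrow> v i = w t \<or>
      v i (2 * t) = 0 \<and> v i (2 * t + 1) = 0 \<and> v i (2 * r) = 0 \<and> v i (2 * r + 1) = 0"
  shows "F v = 0"
proof -
  define V where "V x y = F (v(j0 := x, j1 := y))" for x y
  have V_add1: "V (\<lambda>c. x c + x' c) y = V x y + V x' y" for x x' y
    unfolding V_def fun_upd_twist[OF j(4)] by (rule add[OF j(1)])
  have V_add2: "V x (\<lambda>c. y c + y' c) = V x y + V x y'" for x y y'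
    unfolding V_def by (rule add[OF j(2)])
  have V_scale1: "V (\<lambda>c. d * x c) y = d * V x y" for x y d
    unfolding V_def fun_upd_twist[OF j(4)] by (rule scale[OF j(1)])
  have V_scale2: "V x (\<lambda>c. d * y c) = d * V x y" for x y d
    unfolding V_def by (rule scale[OF j(2)])
  \<comment> \<open>All reflection vectors that are needed, with \<open>q(a) = \<alpha> \<beta> + \<gamma>\<^sup>2\<close>.\<close>
  define a where "a \<alpha> \<beta> \<gamma> = (\<lambda>c. (\<alpha> * e r c + \<beta> * f r c) + \<gamma> * w t c)" for \<alpha> \<beta> \<gamma>
  have polar_a: "polar n x (a \<alpha> \<beta> \<gamma>) =
      (\<alpha> * x (2 * r + 1) + \<beta> * x (2 * r)) + \<gamma> * (x (2 * t) + x (2 * t + 1))" for x \<alpha> \<beta> \<gamma>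
    unfolding a_def polar_add_right polar_scale_right
    by (simp only: polar_e[OF r] polar_f[OF r] polar_w[OF t])
  have quad_a: "quad n (a \<alpha> \<beta> \<gamma>) = \<alpha> * \<beta> + \<gamma>\<^sup>2" for \<alpha> \<beta> \<gamma>
  proof -
    have "quad n (a \<alpha> \<beta> \<gamma>) = \<beta> * \<alpha> + \<gamma>\<^sup>2"
      unfolding a_def quad_add[OF even] quad_scale quad_w[OF t] polar_scale_right polar_f[OF r] polar_w[OF t]
        coord_values using tr by (simp add: e_def f_def quad_basis)
    then show ?thesis by (simp add: mult.commute)
  qed
  have fixed: "reflect n (a \<alpha> \<beta> \<gamma>) (v i) = v i" if "i \<in> J" "i \<noteq> j0" "i \<noteq> j1" for i \<alpha> \<beta> \<gamma>
  proof -
    have "polar n (v i) (a \<alpha> \<beta> \<gamma>) = 0"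
      using other[OF that] tr double_eq_0[of 1] unfolding polar_a by (auto simp: coord_values simp del: One_nat_def)
    then show ?thesis by (auto simp: reflect_def)
  qed
  have move: "V x y = V (reflect n (a \<alpha> \<beta> \<gamma>) x) (reflect n (a \<alpha> \<beta> \<gamma>) y)"
    if "\<alpha> * \<beta> + \<gamma>\<^sup>2 = 1" for x y \<alpha> \<beta> \<gamma>
  proof -
    have "V x y = F (\<lambda>i. reflect n (a \<alpha> \<beta> \<gamma>) ((v(j0 := x, j1 := y)) i))"
      unfolding V_def by (rule reflection[symmetric]) (use that quad_a in simp)
    also have "\<dots> = V (reflect n (a \<alpha> \<beta> \<gamma>) x) (reflect n (a \<alpha> \<beta> \<gamma>) y)"
      unfolding V_def by (rule locality) (use fixed j(4) in auto)
    finally show ?thesis .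
  qed
  have torus_t: "reflect n (a \<alpha> \<beta> 0) x = x" if "x \<in> {e t, f t, w t}" for x \<alpha> \<beta>
  proof -
    have "polar n x (a \<alpha> \<beta> 0) = 0"
      using that tr unfolding polar_a by (auto simp: coord_values simp del: One_nat_def)
    then show ?thesis by (auto simp: reflect_def)
  qed
  have torus_e: "reflect n (a \<alpha> \<beta> 0) (e r) = (\<lambda>c. \<beta>\<^sup>2 * f r c)" if "\<alpha> * \<beta> = 1" for \<alpha> \<beta>
  proof
    fix c
    have p: "polar n (e r) (a \<alpha> \<beta> 0) = \<beta>" unfolding polar_a by (simp only: coord_values) simp
    have "reflect n (a \<alpha> \<beta> 0) (e r) c = e r c + (\<alpha> * \<beta>) * e r c + \<beta>\<^sup>2 * f r c"
      unfolding reflect_def p by (simp add: a_def algebra_simps power2_eq_square)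
    then show "reflect n (a \<alpha> \<beta> 0) (e r) c = \<beta>\<^sup>2 * f r c" using that double_eq_0 by simp
  qed
  have vanish: "z = 0" if "z = d * u" "z = u" "d \<noteq> 1" for z d u :: 'k
    using that by auto
  have tor2: "V x (e r) = \<beta>\<^sup>2 * V x (f r)" if "x \<in> {e t, f t, w t}" "\<alpha> * \<beta> = 1" for x \<alpha> \<beta>
    using move[of \<alpha> \<beta> 0 x "e r"] that by (simp add: torus_t torus_e V_scale2)
  have tor1: "V (e r) x = \<beta>\<^sup>2 * V (f r) x" if "x \<in> {e t, f t, w t}" "\<alpha> * \<beta> = 1" for x \<alpha> \<beta>
    using move[of \<alpha> \<beta> 0 "e r" x] that by (simp add: torus_t torus_e V_scale1)
  have tor12: "V (e r) (e r) = \<beta> ^ 4 * V (f r) (f r)" if "\<alpha> * \<beta> = 1" for \<alpha> \<beta>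
    using move[of \<alpha> \<beta> 0 "e r" "e r"] that
    by (simp add: torus_e V_scale1 V_scale2 power2_eq_square power4_eq_xxxx mult_ac)
  have z2: "V x (e r) = 0 \<and> V x (f r) = 0" if x: "x \<in> {e t, f t, w t}" for x
    using vanish[OF tor2[OF x c(1)] _ c(2)] tor2[OF x, of 1 1] by auto
  have z1: "V (e r) x = 0" if x: "x \<in> {e t, f t, w t}" for x
    using vanish[OF tor1[OF x c(1)] _ c(2)] tor1[OF x, of 1 1] by auto
  have z12: "V (e r) (e r) = 0"
    using vanish[OF tor12[OF c(1)] _ c(3)] tor12[of 1 1] by auto
  have zef: "V (e r) (f r) = 0"
    unfolding V_def
  proof (rule eq_0_of_w[OF j(3) t])
    show "(v(j0 := e r, j1 := f r)) j2 = w t" using j v by simp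
    show "(v(j0 := e r, j1 := f r)) i (2 * t) + (v(j0 := e r, j1 := f r)) i (2 * t + 1) = 0"
      if "i \<in> J" for i
      using other[OF that] tr double_eq_0[of 1] by (auto simp: coord_values simp del: One_nat_def)
  qed
  have mix_e: "reflect n (a 1 0 1) (e t) = (\<lambda>c. e r c + f t c)"
  proof
    fix c
    have p: "polar n (e t) (a 1 0 1) = 1" unfolding polar_a by (simp only: coord_values) (use tr in simp)
    have "reflect n (a 1 0 1) (e t) c = (e t c + e t c) + (e r c + f t c)"
      unfolding reflect_def p by (simp add: a_def w_def algebra_simps)
    then show "reflect n (a 1 0 1) (e t) c = e r c + f t c" using double_eq_0 by simp
  qed
  have mix_f: "reflect n (a 1 0 1) (f r) = (\<lambda>c. (f r c + e r c) + w t c)"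
  proof
    fix c
    have p: "polar n (f r) (a 1 0 1) = 1" unfolding polar_a by (simp only: coord_values) (use tr in simp)
    show "reflect n (a 1 0 1) (f r) c = (f r c + e r c) + w t c"
      unfolding reflect_def p by (simp add: a_def algebra_simps)
  qed
  have "0 = V (e t) (f r)" using z2 by simp
  also have "\<dots> = V (\<lambda>c. e r c + f t c) (\<lambda>c. (f r c + e r c) + w t c)"
    using move[of 1 0 1 "e t" "f r"] unfolding mix_e mix_f by simp
  also have "\<dots> = V (f t) (w t)"
    unfolding V_add1 V_add2 using z1 z2 z12 zef by simp
  also have "\<dots> = V (e t) (w t)"
  proof -
    have "a 0 0 1 = w t" by (rule ext) (simp add: a_def)
    then have e: "reflect n (a 0 0 1) (e t) = f t" using reflect_w_e[OF t] by simp
    have "polar n (w t) (a 0 0 1) = 0"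
      unfolding polar_a by (simp only: coord_values) (use double_eq_0[of 1] in simp)
    then have "reflect n (a 0 0 1) (w t) = w t" by (auto simp: reflect_def)
    then show ?thesis using move[of 0 0 1 "e t" "w t"] e by simp
  qed
  also have "\<dots> = F v"
    unfolding V_def v(1)[symmetric] v(2)[symmetric] fun_upd_triv ..
  finally show ?thesis by simp
qed

end

section \<open>Multilinear parts of polynomials\<close>

text \<open>
  The polynomial \<open>p(z\<^sub>1 v\<^sub>1, \<dots>, z\<^sub>m v\<^sub>m)\<close> in new variables \<open>z\<^sub>i\<close>. It is multiplicative in \<open>p\<close>, and its coefficients are
  the values at \<open>v\<close> of the multihomogeneous components of \<open>p\<close>.
\<close>

definition graded_eval :: "(nat \<Rightarrow> nat \<Rightarrow> 'a::comm_ring_1) \<Rightarrow> 'a mpoly \<Rightarrow> ((nat \<Rightarrow>\<^sub>0 nat) \<Rightarrow>\<^sub>0 'a)" where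
  "graded_eval v = eval_mpoly (Poly_Mapping.single 0)
     (\<lambda>(i, c). Poly_Mapping.single (Poly_Mapping.single i 1) (v i c))"

definition squarefree_mon :: "nat set \<Rightarrow> (nat \<Rightarrow>\<^sub>0 nat)" where
  "squarefree_mon J = (\<Sum>j\<in>J. Poly_Mapping.single j 1)"

definition multilinear_part :: "nat set \<Rightarrow> 'a::comm_ring_1 mpoly \<Rightarrow> (nat \<Rightarrow> nat \<Rightarrow> 'a) \<Rightarrow> 'a" where
  "multilinear_part J p v = Poly_Mapping.lookup (graded_eval v p) (squarefree_mon J)"

definition multidegree :: "((nat \<times> nat) \<Rightarrow>\<^sub>0 nat) \<Rightarrow> (nat \<Rightarrow>\<^sub>0 nat)" where
  "multidegree t = (\<Sum>u\<in>Poly_Mapping.keys t. Poly_Mapping.single (fst u) (Poly_Mapping.lookup t u))"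

lemma lookup_squarefree_mon: "finite J \<Longrightarrow> Poly_Mapping.lookup (squarefree_mon J) i = of_bool (i \<in> J)"
  by (simp add: squarefree_mon_def lookup_sum lookup_single when_def)

lemma comm_ring_hom_single_0: "comm_ring_hom (Poly_Mapping.single (0 :: nat \<Rightarrow>\<^sub>0 nat) :: 'a::comm_ring_1 \<Rightarrow> _)"
  by (rule comm_ring_homI) (simp_all add: single_add mult_single)

lemma single_power:
  "Poly_Mapping.single (Poly_Mapping.single i (1::nat)) (x :: 'a::comm_ring_1) ^ k =
    Poly_Mapping.single (Poly_Mapping.single i k) (x ^ k)"
  by (induction k) (simp_all add: mult_single flip: single_add)

lemma prod_single:
  "(\<Prod>u\<in>S. Poly_Mapping.single (g u :: nat \<Rightarrow>\<^sub>0 nat) (x u :: 'a::comm_ring_1)) =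
    Poly_Mapping.single (\<Sum>u\<in>S. g u) (\<Prod>u\<in>S. x u)"
  by (induction S rule: infinite_finite_induct) (simp_all add: mult_single)

lemma multilinear_part_eq:
  "multilinear_part J p v = (\<Sum>t\<in>Poly_Mapping.keys p. if multidegree t = squarefree_mon J
     then Poly_Mapping.lookup p t * (\<Prod>u\<in>Poly_Mapping.keys t. v (fst u) (snd u) ^ Poly_Mapping.lookup t u)
     else 0)"
proof -
  have "graded_eval v p = (\<Sum>t\<in>Poly_Mapping.keys p. Poly_Mapping.single (multidegree t)
      (Poly_Mapping.lookup p t * (\<Prod>u\<in>Poly_Mapping.keys t. v (fst u) (snd u) ^ Poly_Mapping.lookup t u)))"
    unfolding graded_eval_def eval_mpoly_def case_prod_unfold single_power prod_single mult_single
    by (simp add: multidegree_def)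
  then show ?thesis
    by (simp add: multilinear_part_def lookup_sum lookup_single when_def)
qed

lemma lookup_multidegree:
  "Poly_Mapping.lookup (multidegree t) i =
    (\<Sum>u\<in>{u\<in>Poly_Mapping.keys t. fst u = i}. Poly_Mapping.lookup t u)"
  by (simp add: multidegree_def lookup_sum lookup_single when_def sum.inter_filter)

lemma multidegree_squarefreeD:
  assumes J: "finite J" and t: "multidegree t = squarefree_mon J"
  shows "\<And>u. u \<in> Poly_Mapping.keys t \<Longrightarrow> fst u \<in> J"
    and "\<And>j. j \<in> J \<Longrightarrow> \<exists>u\<in>Poly_Mapping.keys t. fst u = j \<and> Poly_Mapping.lookup t u = 1 \<and>
      (\<forall>u'\<in>Poly_Mapping.keys t - {u}. fst u' \<noteq> j)"
proof -
  have sum: "(\<Sum>u\<in>{u\<in>Poly_Mapping.keys t. fst u = i}. Poly_Mapping.lookup t u) = of_bool (i \<in> J)" for i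
    using lookup_multidegree[of t i] t lookup_squarefree_mon[OF J] by simp
  show "fst u \<in> J" if u: "u \<in> Poly_Mapping.keys t" for u
  proof (rule ccontr)
    assume "fst u \<notin> J"
    then have "(\<Sum>u'\<in>{u'\<in>Poly_Mapping.keys t. fst u' = fst u}. Poly_Mapping.lookup t u') = 0"
      using sum[of "fst u"] by simp
    then show False using u by (cases u) (simp add: in_keys_iff)
  qed
  show "\<exists>u\<in>Poly_Mapping.keys t. fst u = j \<and> Poly_Mapping.lookup t u = 1 \<and>
      (\<forall>u'\<in>Poly_Mapping.keys t - {u}. fst u' \<noteq> j)" if "j \<in> J" for j
  proof -
    let ?S = "{u\<in>Poly_Mapping.keys t. fst u = j}"
    have "(\<Sum>u\<in>?S. Poly_Mapping.lookup t u) = 1" using sum[of j] that by simp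
    then obtain u where u: "u \<in> ?S" "Poly_Mapping.lookup t u = 1"
        "\<forall>u'\<in>?S. u \<noteq> u' \<longrightarrow> Poly_Mapping.lookup t u' = 0"
      using sum_eq_1_iff[of ?S "Poly_Mapping.lookup t"] by auto
    have "fst u' \<noteq> j" if "u' \<in> Poly_Mapping.keys t - {u}" for u'
    proof
      assume "fst u' = j"
      then have "u' \<in> ?S" "u \<noteq> u'" using that by auto
      then have "Poly_Mapping.lookup t u' = 0" by (rule u(3)[THEN bspec, THEN mp])
      then show False using that by (simp add: in_keys_iff)
    qed
    then show ?thesis using u by blast
  qed
qed

lemma multilinear_part_local:
  assumes J: "finite J" and v: "\<And>i. i \<in> J \<Longrightarrow> v i = v' i"
  shows "multilinear_part J p v = multilinear_part J p v'"
  unfolding multilinear_part_eq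
proof (intro sum.cong refl if_cong arg_cong2[of _ _ _ _ "(*)"] prod.cong arg_cong2[of _ _ _ _ "(^)"])
  fix t u assume "multidegree t = squarefree_mon J" "u \<in> Poly_Mapping.keys t"
  then show "v (fst u) (snd u) = v' (fst u) (snd u)"
    using multidegree_squarefreeD(1)[OF J] v by metis
qed

lemma multilinear_part_linear:
  assumes J: "finite J" and j: "j \<in> J"
  shows "multilinear_part J p (v(j := \<lambda>c. b * x c + d * y c)) =
    b * multilinear_part J p (v(j := x)) + d * multilinear_part J p (v(j := y))"
proof -
  let ?m = "\<lambda>v t. \<Prod>u\<in>Poly_Mapping.keys t. v (fst u) (snd u) ^ Poly_Mapping.lookup t u"
  have "?m (v(j := \<lambda>c. b * x c + d * y c)) t = b * ?m (v(j := x)) t + d * ?m (v(j := y)) t"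
    if t: "multidegree t = squarefree_mon J" for t
  proof -
    obtain u where u: "u \<in> Poly_Mapping.keys t" "fst u = j" "Poly_Mapping.lookup t u = 1"
        "\<forall>u'\<in>Poly_Mapping.keys t - {u}. fst u' \<noteq> j"
      using multidegree_squarefreeD(2)[OF J t j] by blast
    have "?m (v(j := z)) t =
        z (snd u) * (\<Prod>u'\<in>Poly_Mapping.keys t - {u}. v (fst u') (snd u') ^ Poly_Mapping.lookup t u')" for z
    proof -
      have "(\<Prod>u'\<in>Poly_Mapping.keys t - {u}. (v(j := z)) (fst u') (snd u') ^ Poly_Mapping.lookup t u') =
          (\<Prod>u'\<in>Poly_Mapping.keys t - {u}. v (fst u') (snd u') ^ Poly_Mapping.lookup t u')"
        using u(4) by (intro prod.cong refl) auto
      then show ?thesis using u(2,3) by (simp only: prod.remove[OF finite_keys u(1)] fun_upd_same power_one_right)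
    qed
    then show ?thesis by (simp add: algebra_simps)
  qed
  then have "(if multidegree t = squarefree_mon J then Poly_Mapping.lookup p t *
        ?m (v(j := \<lambda>c. b * x c + d * y c)) t else 0) =
      b * (if multidegree t = squarefree_mon J then Poly_Mapping.lookup p t * ?m (v(j := x)) t else 0) +
      d * (if multidegree t = squarefree_mon J then Poly_Mapping.lookup p t * ?m (v(j := y)) t else 0)" for t
    by (simp add: algebra_simps)
  then show ?thesis
    unfolding multilinear_part_eq by (simp only: sum_distrib_left sum.distrib)
qed

text \<open>
  The consequence of invariance that is used for the elements of the generated subalgebra: unlike membership
  in the set of invariants, it passes to sums and products simply because \<open>graded_eval\<close> is a homomorphism.
\<close>

definition reflection_closed :: "nat \<Rightarrow> 'k::field mpoly \<Rightarrow> bool" where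
  "reflection_closed n p \<longleftrightarrow> (\<forall>a v. quad n a = 1 \<longrightarrow>
     graded_eval (\<lambda>i. reflect n a (v i)) p = graded_eval v p)"

lemma comm_ring_hom_graded_eval: "comm_ring_hom (graded_eval v)"
  unfolding graded_eval_def by (rule comm_ring_hom_eval[OF comm_ring_hom_single_0])

lemma reflection_closed_invariant:
  fixes p :: "'k::field mpoly"
  assumes n: "even n" and two: "(2 :: 'k) = 0" and p: "p \<in> invariants n m (orthogonal_group n)"
  shows "reflection_closed n p"
  unfolding reflection_closed_def
proof (intro allI impI)
  fix a :: "nat \<Rightarrow> 'k" and v :: "nat \<Rightarrow> nat \<Rightarrow> 'k"
  assume a: "quad n a = 1"
  define R where "R = mat n n (\<lambda>(c, d). of_bool (c = d) + a c * a (mate d))"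
  have R: "R \<in> orthogonal_group n" "\<And>c x. c < n \<Longrightarrow> (\<Sum>d<n. R $$ (c, d) * x d) = reflect n a x c"
    using reflection_orthogonal[OF n two a] unfolding R_def by auto
  have poly: "p \<in> poly_ring n m" and act: "act n R p = p" using p R(1) by (auto simp: invariants_def)
  let ?\<sigma> = "\<lambda>(i, c). \<Sum>d<n. Const (R $$ (c, d)) * Var (i, d)"
  interpret G: comm_ring_hom "graded_eval v" by (rule comm_ring_hom_graded_eval)
  have "graded_eval v p = graded_eval v (eval_mpoly Const ?\<sigma> p)"
    using act by (simp add: act_def subst_mpoly_eq_eval)
  also have "\<dots> = eval_mpoly (\<lambda>a. graded_eval v (Const a)) (\<lambda>u. graded_eval v (?\<sigma> u)) p"
    by (rule hom_eval_mpoly[OF comm_ring_hom_graded_eval])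
  also have "(\<lambda>a. graded_eval v (Const a)) = Poly_Mapping.single 0"
    unfolding graded_eval_def by (rule ext) (rule eval_Const[OF comm_ring_hom_single_0])
  also have "eval_mpoly (Poly_Mapping.single 0) (\<lambda>u. graded_eval v (?\<sigma> u)) p =
      graded_eval (\<lambda>i. reflect n a (v i)) p"
    unfolding graded_eval_def[of "\<lambda>i. reflect n a (v i)"]
  proof (rule eval_mpoly_cong)
    fix t u assume "t \<in> Poly_Mapping.keys p" "u \<in> Poly_Mapping.keys t"
    then obtain i c where u: "u = (i, c)" "c < n" using poly by (fastforce simp: poly_ring_def)
    have "graded_eval v (?\<sigma> u) = (\<Sum>d<n. Poly_Mapping.single (Poly_Mapping.single i 1) (R $$ (c, d) * v i d))"
      unfolding u(1) case_prod_conv G.hom_sum G.hom_mult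
      by (simp add: graded_eval_def eval_Const[OF comm_ring_hom_single_0]
          eval_Var[OF comm_ring_hom_single_0] mult_single)
    also have "\<dots> = Poly_Mapping.single (Poly_Mapping.single i 1) (\<Sum>d<n. R $$ (c, d) * v i d)"
      by (rule poly_mapping_eqI) (simp add: lookup_sum lookup_single when_def)
    finally show "graded_eval v (?\<sigma> u) =
        (case u of (i, c) \<Rightarrow> Poly_Mapping.single (Poly_Mapping.single i 1) (reflect n a (v i) c))"
      using u R(2) by simp
  qed
  finally show "graded_eval (\<lambda>i. reflect n a (v i)) p = graded_eval v p" ..
qed

lemma reflection_invariant_multilinear_part:
  fixes p :: "'k::field mpoly"
  assumes "even n" "(2 :: 'k) = 0" "reflection_closed n p" "finite J"
  shows "reflection_invariant n J (multilinear_part J p)"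
proof
  show "multilinear_part J p (\<lambda>i. reflect n a (v i)) = multilinear_part J p v" if "quad n a = 1" for a v
    using assms(3) that by (simp add: multilinear_part_def reflection_closed_def)
  show "multilinear_part J p v = multilinear_part J p v'" if "\<And>i. i \<in> J \<Longrightarrow> v i = v' i" for v v'
    by (rule multilinear_part_local[OF assms(4) that])
  show "multilinear_part J p (v(j := \<lambda>c. b * x c + d * y c)) =
      b * multilinear_part J p (v(j := x)) + d * multilinear_part J p (v(j := y))"
    if "j \<in> J" for v j x y b d
    by (rule multilinear_part_linear[OF assms(4) that])
qed (fact assms)+

text \<open>
  A primitive third root of unity does it; the prime field is too small.
\<close>

lemma exists_torus_element:
  assumes "CHAR('k::alg_closed_field) = 2"
  obtains b b' :: "'k::alg_closed_field" where "b * b' = 1" "b'\<^sup>2 \<noteq> 1" "b' ^ 4 \<noteq> 1"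
proof -
  have two: "(2 :: 'k) = 0" by (rule two_eq_0[OF assms])
  obtain c :: 'k where c: "poly [:1, 1, 1:] c = 0"
    using alg_closed_imp_poly_has_root[of "[:1, 1, 1 :: 'k:]"] by auto
  then have c': "1 + c + c\<^sup>2 = 0" by (simp add: power2_eq_square algebra_simps)
  have pm: "- x = x" for x :: 'k using two mult_2[of x] by (simp add: eq_neg_iff_add_eq_0 neg_eq_iff_add_eq_0)
  have sq: "c\<^sup>2 = 1 + c" using c' pm by (metis add.commute add_eq_0_iff)
  have "c \<noteq> 0" using c' by auto
  have "c\<^sup>2 \<noteq> 1" using sq \<open>c \<noteq> 0\<close> by simp
  moreover have "c ^ 4 = c"
  proof -
    have "c ^ 4 = (1 + c)\<^sup>2" by (simp add: power4_eq_xxxx power2_eq_square flip: sq)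
    also have "\<dots> = 1 + c\<^sup>2" using two by (simp add: power2_sum)
    also have "\<dots> = c" using two unfolding sq by (simp flip: add.assoc)
    finally show ?thesis .
  qed
  moreover have "c \<noteq> 1" using \<open>c\<^sup>2 \<noteq> 1\<close> by auto
  moreover have "inverse c * c = 1" using \<open>c \<noteq> 0\<close> by simp
  ultimately show ?thesis using that by metis
qed

section \<open>Indecomposability\<close>

context reflection_invariant
begin

lemma special_eq:
  assumes "2 \<le> n"
  shows "special n i = (if even i \<and> i < n then e (block n i) else w (block n i))"
  by (rule ext) (auto simp: special_def e_def w_def f_def basis_vec_def)

text \<open>
  If the vector \<open>e\<^sub>r\<close> of a block is absent, the block is represented by copies of \<open>w\<^sub>r\<close> only.
\<close>

lemma special_vanish_partial_block:
  assumes n: "2 \<le> n" and j: "j \<in> J" "2 * block n j \<notin> J"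
  shows "F (special n) = 0"
proof (rule eq_0_of_w[OF j(1), of "block n j"])
  show r: "block n j < n div 2" using n even by (auto simp: block_def)
  have not_e: "\<not> (even i \<and> i < n)" if "i \<in> J" "block n i = block n j" for i
  proof
    assume i: "even i \<and> i < n"
    then have "i = 2 * block n i" using even by (auto simp: block_def elim!: evenE)
    with that j(2) show False by metis
  qed
  then show "special n j = w (block n j)" 
    unfolding special_eq[OF n] using not_e[OF j(1) refl] by (simp only: if_False)
  fix i assume i: "i \<in> J"
  show "special n i (2 * block n j) + special n i (2 * block n j + 1) = (0 :: 'k)"
  proof (cases "block n i = block n j")
    case True
    then have "special n i = w (block n j)" 
      unfolding special_eq[OF n] using not_e[OF i True] True by (simp only: if_False)
    then show ?thesis using double_eq_0[of 1] by (simp only: coord_values) simp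
  next
    case False
    then show ?thesis by (auto simp: special_def)
  qed
qed

text \<open>
  The vectors with the indices \<open>n - 2\<close>, \<open>n - 1\<close> and \<open>n\<close> are \<open>e\<^sub>\<nu>, w\<^sub>\<nu>, w\<^sub>\<nu>\<close>, and the plane \<open>r\<close> is free.
\<close>

lemma special_vanish_missing_block:
  assumes char: "(b :: 'k) * b' = 1" "b'\<^sup>2 \<noteq> 1" "b' ^ 4 \<noteq> 1"
    and n: "2 \<le> n" and last: "n - 2 \<in> J" "n - 1 \<in> J" "n \<in> J"
    and r: "r < n div 2 - 1" "\<And>i. i \<in> J \<Longrightarrow> block n i \<noteq> r"
  shows "F (special n) = 0"
proof -
  obtain \<nu> where \<nu>: "n = 2 * \<nu>" using even by (elim evenE)
  let ?t = "n div 2 - 1"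
  show ?thesis
  proof (rule eq_0_of_large_block[of ?t r b b' "n - 2" "n - 1" n])
    have "block n (n - 2) = ?t" "block n (n - 1) = ?t" "block n n = ?t"
      "even (n - 2) \<and> n - 2 < n" "\<not> (even (n - 1) \<and> n - 1 < n)" "\<not> (even n \<and> n < n)"
      using n \<nu> by (auto simp: block_def)
    then show "special n (n - 2) = e ?t" "special n (n - 1) = w ?t" "special n n = w ?t"
      unfolding special_eq[OF n] by (simp_all only: if_True if_False simp_thms)
    fix i assume i: "i \<in> J" "i \<noteq> n - 2" "i \<noteq> n - 1"
    show "special n i = w ?t \<or> special n i (2 * ?t) = (0 :: 'k) \<and> special n i (2 * ?t + 1) = 0 \<and>
        special n i (2 * r) = 0 \<and> special n i (2 * r + 1) = 0"
    proof (cases "block n i = ?t")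
      case True
      have "\<not> (even i \<and> i < n)"
      proof
        assume "even i \<and> i < n"
        then have "i = 2 * ?t" using True even by (auto simp: block_def elim!: evenE)
        then show False using i(2) \<nu> by simp
      qed
      then have "special n i = w ?t" unfolding special_eq[OF n] using True by (simp only: if_False)
      then show ?thesis ..
    next
      case False
      then show ?thesis using r(2)[OF i(1)] by (auto simp: special_def)
    qed
  qed (use char last r n in auto)
qed

end

text \<open>
  Either some block meets both \<open>J\<close> and \<open>K\<close>, and then the side without its vector \<open>e\<^sub>r\<close> vanishes; or each block
  lies on one side, and then the side of the last block misses any block of the other side.
\<close>

lemma special_vanish_product:
  fixes F F' :: "(nat \<Rightarrow> nat \<Rightarrow> 'k::field) \<Rightarrow> 'k"
  assumes F: "reflection_invariant n J F" and F': "reflection_invariant n K F'"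
    and char: "(b :: 'k) * b' = 1" "b'\<^sup>2 \<noteq> 1" "b' ^ 4 \<noteq> 1"
    and n: "2 \<le> n" and m: "n < m"
    and JK: "J \<union> K = {..<m}" "J \<inter> K = {}" "J \<noteq> {}" "K \<noteq> {}"
  shows "F (special n) = 0 \<or> F' (special n) = 0"
proof -
  interpret F: reflection_invariant n J F by fact
  interpret F': reflection_invariant n K F' by fact
  have block_lt: "block n i < n div 2" for i using n by (auto simp: block_def)
  have head: "2 * block n i \<in> J \<or> 2 * block n i \<in> K" for i
  proof -
    have "2 * block n i \<in> {..<m}" using block_lt[of i] m by simp
    then show ?thesis unfolding JK(1)[symmetric] by blast
  qed
  show ?thesis
  proof (cases "\<exists>j\<in>J. \<exists>k\<in>K. block n j = block n k")
    case True
    then obtain j k where jk: "j \<in> J" "k \<in> K" "block n j = block n k" by blast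
    show ?thesis
      using head[of j] F.special_vanish_partial_block[OF n jk(1)]
        F'.special_vanish_partial_block[OF n jk(2)] jk(3) JK(2) by auto
  next
    case False
    have last_block: "block n i = n div 2 - 1" if "i \<in> {n - 2, n - 1, n}" for i
      using that n F.even by (auto simp: block_def elim!: evenE)
    have lt: "{n - 2, n - 1, n} \<subseteq> J \<union> K" unfolding JK(1) using m by auto
    have r: "block n i < n div 2 - 1" if "block n i \<noteq> n div 2 - 1" for i
      using that by (auto simp: block_def)
    show ?thesis
    proof (cases "n \<in> J")
      case True
      obtain k where k: "k \<in> K" using JK(4) by blast
      have J: "i \<in> J" if "i \<in> {n - 2, n - 1, n}" for i
      proof (rule ccontr)
        assume "i \<notin> J"
        then have "i \<in> K" using that lt by blast
        moreover have "block n i = block n n" using last_block[of i] last_block[of n] that by simp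
        ultimately show False using False True by metis
      qed
      have k': "block n k \<noteq> n div 2 - 1" using False True k last_block[of n] by (metis insertCI)
      have "F (special n) = 0"
        by (rule F.special_vanish_missing_block[OF char n J J J r[OF k']]) (use False k in auto)
      then show ?thesis ..
    next
      case n': False
      then have nK: "n \<in> K" using lt by auto
      obtain k where k: "k \<in> J" using JK(3) by blast
      have K: "i \<in> K" if "i \<in> {n - 2, n - 1, n}" for i
      proof (rule ccontr)
        assume "i \<notin> K"
        then have "i \<in> J" using that lt by blast
        moreover have "block n i = block n n" using last_block[of i] last_block[of n] that by simp
        ultimately show False using False nK by metis
      qed
      have k': "block n k \<noteq> n div 2 - 1" using False nK k last_block[of n] by (metis insertCI)
      have "F' (special n) = 0"
        by (rule F'.special_vanish_missing_block[OF char n K K K r[OF k']])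
          (simp, simp, simp, use False k in metis)
      then show ?thesis ..
    qed
  qed
qed


lemma multidegree_degree:
  assumes "multidegree t = squarefree_mon {..<m}"
  shows "(\<Sum>u\<in>Poly_Mapping.keys t. Poly_Mapping.lookup t u) = m"
proof -
  have "(\<Sum>i<m. \<Sum>u\<in>{u\<in>Poly_Mapping.keys t. fst u = i}. Poly_Mapping.lookup t u) =
      (\<Sum>u\<in>Poly_Mapping.keys t. Poly_Mapping.lookup t u)"
    by (rule sum.group) (use multidegree_squarefreeD(1)[OF _ assms] in auto)
  then have "(\<Sum>u\<in>Poly_Mapping.keys t. Poly_Mapping.lookup t u) =
      (\<Sum>i<m. Poly_Mapping.lookup (multidegree t) i)"
    by (simp only: lookup_multidegree)
  also have "\<dots> = m" by (simp add: assms lookup_squarefree_mon)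
  finally show ?thesis .
qed

lemma multidegree_multilinear:
  assumes p: "multilinear n m p" and t: "t \<in> Poly_Mapping.keys p"
  shows "multidegree t = squarefree_mon {..<m}"
proof (rule poly_mapping_eqI)
  fix i
  have sub: "Poly_Mapping.keys t \<subseteq> {..<m} \<times> {..<n}"
    using p t by (auto simp: multilinear_def poly_ring_def)
  have "Poly_Mapping.lookup (multidegree t) i =
      (\<Sum>u\<in>Pair i ` {..<n}. Poly_Mapping.lookup t u)"
    unfolding lookup_multidegree
  proof (rule sum.mono_neutral_left)
    show "{u \<in> Poly_Mapping.keys t. fst u = i} \<subseteq> Pair i ` {..<n}" using sub by fastforce
  qed (auto simp: in_keys_iff)
  also have "\<dots> = (\<Sum>c<n. Poly_Mapping.lookup t (i, c))"
    by (subst sum.reindex) (auto simp: inj_on_def)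
  also have "\<dots> = of_bool (i < m)"
  proof (cases "i < m")
    case True
    then show ?thesis using p t by (simp add: multilinear_def)
  next
    case False
    then have "(i, c) \<notin> Poly_Mapping.keys t" for c using sub by auto
    then show ?thesis using False by (simp add: in_keys_iff)
  qed
  finally show "Poly_Mapping.lookup (multidegree t) i = Poly_Mapping.lookup (squarefree_mon {..<m}) i"
    by (simp add: lookup_squarefree_mon)
qed

lemma multilinear_part_multilinear:
  assumes "multilinear n m p"
  shows "multilinear_part {..<m} p v = eval_mpoly (\<lambda>x. x) (\<lambda>(i, c). v i c) p"
  unfolding multilinear_part_eq eval_mpoly_def
  by (intro sum.cong refl) (simp add: multidegree_multilinear[OF assms] case_prod_unfold)

lemma degree_le_total_degree:
  assumes "t \<in> Poly_Mapping.keys p"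
  shows "(\<Sum>u\<in>Poly_Mapping.keys t. Poly_Mapping.lookup t u) \<le> total_degree p"
  unfolding total_degree_def by (rule Max_ge) (use assms in auto)

lemma total_degree_multilinear_le:
  assumes "multilinear n m p"
  shows "total_degree p \<le> m"
  unfolding total_degree_def
  using multidegree_degree[OF multidegree_multilinear[OF assms]] by (subst Max_le_iff) auto

lemma multilinear_part_low_degree:
  assumes "total_degree p < m"
  shows "multilinear_part {..<m} p v = 0"
  unfolding multilinear_part_eq
proof (intro sum.neutral ballI)
  fix t assume "t \<in> Poly_Mapping.keys p"
  then have "multidegree t \<noteq> squarefree_mon {..<m}"
    using degree_le_total_degree[of t p] multidegree_degree[of t m] assms by auto
  then show "(if multidegree t = squarefree_mon {..<m} then Poly_Mapping.lookup p t *
      (\<Prod>u\<in>Poly_Mapping.keys t. v (fst u) (snd u) ^ Poly_Mapping.lookup t u) else 0) = 0" by simp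
qed

lemma squarefree_mon_split:
  assumes m: "squarefree_mon {..<m} = s + t"
  obtains J K where "J \<union> K = {..<m}" "J \<inter> K = {}" "finite J" "finite K"
    "s = squarefree_mon J" "t = squarefree_mon K"
proof -
  define J K where "J = {i. Poly_Mapping.lookup s i \<noteq> 0}" and "K = {i. Poly_Mapping.lookup t i \<noteq> 0}"
  have sum: "Poly_Mapping.lookup s i + Poly_Mapping.lookup t i = of_bool (i < m)" for i
    using arg_cong[OF m, of "\<lambda>x. Poly_Mapping.lookup x i"]
    by (simp add: lookup_add lookup_squarefree_mon)
  have cases: "Poly_Mapping.lookup s i = of_bool (i \<in> J)" "Poly_Mapping.lookup t i = of_bool (i \<in> K)"
    "i \<in> J \<or> i \<in> K \<longleftrightarrow> i < m" "\<not> (i \<in> J \<and> i \<in> K)" for i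
    using sum[of i] by (auto simp: J_def K_def of_bool_def split: if_splits)
  have JK: "J \<union> K = {..<m}" "J \<inter> K = {}" using cases(3,4) by auto
  then have fin: "finite J" "finite K" by (metis finite_Un finite_lessThan)+
  have "s = squarefree_mon J" "t = squarefree_mon K"
    by (rule poly_mapping_eqI, simp add: cases(1,2) lookup_squarefree_mon fin)+
  then show ?thesis using that JK fin by blast
qed

text \<open>
  Induction over the generation of the subalgebra. The product rule is used in a weak form: a nonzero coefficient
  of \<open>z\<^sub>1 \<dots> z\<^sub>m\<close> in a product requires squarefree monomials with disjoint index sets and nonzero coefficients in
  the factors.
\<close>

lemma decomposable_multilinear_part_special:
  fixes p :: "'k::alg_closed_field mpoly"
  assumes char: "CHAR('k) = 2" and n: "even n" "2 \<le> n" and m: "n < m"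
    and p: "p \<in> subalgebra_generated {h \<in> invariants n m (orthogonal_group n). total_degree h < m}"
  shows "reflection_closed n p \<and> multilinear_part {..<m} p (special n) = 0"
  using p
proof (induction rule: subalgebra_generated.induct)
  case (const a)
  have G: "graded_eval v (Const a) = Poly_Mapping.single 0 a" for v :: "nat \<Rightarrow> nat \<Rightarrow> 'k"
    unfolding graded_eval_def by (rule eval_Const[OF comm_ring_hom_single_0])
  have "squarefree_mon {..<m} \<noteq> 0"
  proof
    assume "squarefree_mon {..<m} = 0"
    then have "Poly_Mapping.lookup (squarefree_mon {..<m}) 0 = 0" by simp
    then show False using m by (simp add: lookup_squarefree_mon)
  qed
  then show ?case by (simp add: reflection_closed_def multilinear_part_def G lookup_single when_def)
next
  case (gen h)
  then show ?case
    using reflection_closed_invariant[OF n(1) two_eq_0[OF char]] multilinear_part_low_degree by blast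
next
  case (add p q)
  interpret G: comm_ring_hom "graded_eval v" for v :: "nat \<Rightarrow> nat \<Rightarrow> 'k" by (rule comm_ring_hom_graded_eval)
  show ?case
    using add.IH by (auto simp: reflection_closed_def multilinear_part_def G.hom_add lookup_add)
next
  case (mult p q)
  interpret G: comm_ring_hom "graded_eval v" for v :: "nat \<Rightarrow> nat \<Rightarrow> 'k" by (rule comm_ring_hom_graded_eval)
  let ?p = "graded_eval (special n) p" and ?q = "graded_eval (special n) q"
  have closed: "reflection_closed n p" "reflection_closed n q" using mult.IH by auto
  have "Poly_Mapping.lookup (?p * ?q) (squarefree_mon {..<m}) = 0"
  proof (rule ccontr)
    assume "Poly_Mapping.lookup (?p * ?q) (squarefree_mon {..<m}) \<noteq> 0"
    then have "squarefree_mon {..<m} \<in> Poly_Mapping.keys (?p * ?q)" by (simp add: in_keys_iff)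
    then obtain s t where st: "squarefree_mon {..<m} = s + t" "s \<in> Poly_Mapping.keys ?p"
        "t \<in> Poly_Mapping.keys ?q"
      using keys_mult[of ?p ?q] by blast
    obtain J K where JK: "J \<union> K = {..<m}" "J \<inter> K = {}" "finite J" "finite K"
        "s = squarefree_mon J" "t = squarefree_mon K"
      by (rule squarefree_mon_split[OF st(1)])
    have nz: "multilinear_part J p (special n) \<noteq> 0" "multilinear_part K q (special n) \<noteq> 0"
      using st(2,3) JK(5,6) by (simp_all add: multilinear_part_def in_keys_iff)
    have ne: "J \<noteq> {}" "K \<noteq> {}"
    proof -
      have "K \<noteq> {..<m}" "J \<noteq> {..<m}" using nz mult.IH by (metis, metis)
      then show "J \<noteq> {}" "K \<noteq> {}" using JK(1) by (metis Un_empty_left, metis Un_empty_right)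
    qed
    obtain b b' :: 'k where b: "b * b' = 1" "b'\<^sup>2 \<noteq> 1" "b' ^ 4 \<noteq> 1"
      by (rule exists_torus_element[OF char])
    show False
      using special_vanish_product[OF
          reflection_invariant_multilinear_part[OF n(1) two_eq_0[OF char] closed(1) JK(3)]
          reflection_invariant_multilinear_part[OF n(1) two_eq_0[OF char] closed(2) JK(4)]
          b n(2) m JK(1,2) ne] nz by blast
  qed
  then show ?case
    using closed by (simp add: reflection_closed_def multilinear_part_def G.hom_mult)
qed

theorem theorem6:
  fixes n m :: nat
  assumes "CHAR('k::alg_closed_field) = 2"
    and "even n" and "even m" and "2 \<le> n" and "n < m"
  shows "multilinear n m (g_poly n m :: 'k mpoly) \<and>
    indecomposable_in (invariants n m (orthogonal_group n)) (g_poly n m :: 'k mpoly)"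
proof -
  let ?g = "g_poly n m :: 'k mpoly"
  let ?I = "invariants n m (orthogonal_group n) :: 'k mpoly set"
  have le: "n \<le> m" using assms(5) by simp
  have lin: "multilinear n m ?g" by (rule multilinear_g_poly[OF assms(2,3)])
  have inv: "?g \<in> ?I"
    using lin act_g_poly[OF assms(1-3) le] by (simp add: invariants_def multilinear_def)
  have one: "multilinear_part {..<m} ?g (special n) = 1"
    unfolding multilinear_part_multilinear[OF lin] by (rule g_poly_special[OF assms(1,2,4,3) le])
  have "total_degree ?g = m"
    using multilinear_part_low_degree[of ?g m "special n"] total_degree_multilinear_le[OF lin] one
    by fastforce
  moreover have "?g \<notin> subalgebra_generated {h \<in> ?I. total_degree h < m}"
    using decomposable_multilinear_part_special[OF assms(1,2,4,5), of ?g] one by auto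
  ultimately show ?thesis using lin inv by (simp add: indecomposable_in_def)
qed

end
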